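(* Assume hypotheses H(A), H(B), H(F), H(G), H(0), H(W), H($\ell$) and H($\varphi$) spelled out in the context, and let $\mathcal P\subset\Lambda\times\Xi$ be a nonempty compact set. Put $$\mathcal F_{rob}(w)=\sup_{(\zeta,\eta)\in\mathcal P}\{m_{\zeta,\eta}(w)+\mathcal R(w)\},\qquad w\in\mathcal W_{ad}.$$ Then there exists $w^*\in\mathcal W_{ad}$ such that $\mathcal F_{rob}(w^* )=\inf_{w\in\mathcal W_{ad}}\mathcal F_{rob}(w)$.
   Context: **Setting.** $E,H,Y$ are real separable Hilbert spaces with norms $\|\cdot\|_E,\|\cdot\|,\|\cdot\|_Y$ ($\langle\cdot,\cdot\rangle$ is the inner product of $H$), $I=[0,b]$ with $b>0$, $(\Lambda,d_\Lambda)$ and $(\Xi,d_\Xi)$ are metric spaces, $\Lambda\times\Xi$ has the product metric. Spaces $C(I,\cdot)$ carry the sup norm. $\operatorname{Haus}$ is the Hausdorff metric between sets; for a set $S$ in a normed space $\|S\|:=\sup_{s\in S}\|s\|$. A multifunction $\Phi$ on $I$ is measurable if $\{t:\Phi(t)\subset O\}$ is Lebesgue measurable for every open $O$. A set $S\subset H$ is ball-relatively compact if its intersection with every closed ball centered at $0$ is relatively compact. For a maximal monotone $B:D(B)\subset H\rightrightarrows H$, $B^0(v)$ is the minimal-norm element of $B(v)$. The pseudo-distance of maximal monotone operators is $$\operatorname{dis}(B_1,B_2)=\sup\Big\{\tfrac{\langle y-y',x'-x\rangle}{1+\|y\|+\|y'\|}: x\in D(B_1),y\in B_1(x),x'\in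 D(B_2),y'\in B_2(x')\Big\}\in[0,\infty].$$ **Data.** Linear operators $A_\zeta:D(A_\zeta)\subset E\to E$ ($\zeta\in\Lambda$); maximal monotone operators $B(t,u,\eta):D(B(t,u,\eta))\subset H\rightrightarrows H$ ($(t,u,\eta)\in I\times H\times\Xi$); multifunctions $F:I\times E\times H\times\Lambda\rightrightarrows E$, $G:I\times E\times H\times\Xi\rightrightarrows H$, $W:I\rightrightarrows Y$; a bounded linear operator $\mathcal B:Y\to E$; maps $x_0:\Lambda\to E$, $u_0:\Xi\to H$ with $u_0(\eta)\in D(B(0,u_0(\eta),\eta))$; functions $\ell:I\times E\times H\times\Lambda\times\Xi\to\mathbb R$, $\varphi:E\times H\times\Lambda\times\Xi\to\mathbb R$. **H(A).** Each $A_\zeta$ generates a $C_0$-semigroup $\{T_\zeta(t)\}_{t\ge0}$ on $E$ with $T_\zeta(t)$ compact for all $t>0$; for every bounded $D\subset\Lambda$ there is $M_D>0$ with $\sup_{t\in I}\|T_\zeta(t)\|_{\mathcal L(E)}\le M_D$ for all $\zeta\in D$; whenever $\zeta_n\to\zeta$, $\sup_{t\in I}\|T_{\zeta_n}(t)x-T_\zeta(t)x\|_E\to0$ for every $x\in E$, and $\sup_{t\in[\delta,b]}\|T_{\zeta_n}(t)-T_\zeta(t)\|_{\mathcal L(E)}\to0$ for every $0<\delta<b$. **H(B).** (i) There are $\theta\in W^{1,2}(I,\mathbb R)$, $\lambda\in[0,1)$, $\lambda'>0$ with $\operatorname{dis}(B(t,u,\eta_1),B(s,v,\eta_2))\le|\theta(t)-\theta(s)|+\lambda\|u-v\|+\lambda'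 d_\Xi(\eta_1,\eta_2)$ for all $t,s\in I$, $u,v\in H$, $\eta_1,\eta_2\in\Xi$. (ii) There is $M_B>0$ with $\|B^0(t,u,\eta)v\|\le M_B(1+\|u\|+\|v\|)$ for all $t\in I$, $u\in H$, $\eta\in\Xi$, $v\in D(B(t,u,\eta))$. (iii) For every bounded $\Omega\subset H\times\Xi$, $\bigcup_{t\in I,(u,\eta)\in\Omega}D(B(t,u,\eta))$ is ball-relatively compact in $H$. (iv) For every bounded $D\subset\Xi$ and $r>0$ there is $\varrho_D\in L^1(I,\mathbb R_+)$ with $\langle v_1-v_2,u_1-u_2\rangle\ge-\varrho_D(t)\|u_1-u_2\|^2$ for all $t\in I$, $\|u_1\|,\|u_2\|\le r$, $\eta_1,\eta_2\in D$, $v_i\in B(t,u_i,\eta_i)(u_i)$. **H(F).** $F$ has nonempty weakly compact convex values and: (i) $t\mapsto F(t,x,u,\zeta)$ is measurable for all $(x,u,\zeta)$; (ii) for every bounded $D\subset\Lambda$ there is $k_D\in L^1(I,\mathbb R_+)$ with $\operatorname{Haus}(F(t,x,u,\zeta),F(t,y,v,\zeta))\le k_D(t)(\|x-y\|_E+\|u-v\|)$ for all $(x,u),(y,v)$, $\zeta\in D$, a.e. $t$; (iii) for every bounded $D\subset\Lambda$ there is $M_F>0$ with $\|F(t,x,u,\zeta)\|_E\le M_F(1+\|x\|_E+\|u\|)$ for a.e. $t$ and all $(x,u,\zeta)\in E\times H\times D$; (iv) $\operatorname{Haus}(F(t,x,u,\zeta_1),F(t,x,u,\zeta_2))\le\gamma_1(d_\Lambda(\zeta_1,\zeta_2))\rho_1(t,\|x\|_E,\|u\|)$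 for all $(x,u)$, $\zeta_1,\zeta_2$, a.e. $t$, where $\gamma_1(r)\to0$ as $r\to0^+$ and for every bounded $S\subset L^2(I,E)\times L^2(I,H)$ there is $\omega_S\in L^1(I,\mathbb R_+)$ with $\rho_1(t,\|x(t)\|_E,\|u(t)\|)\le\omega_S(t)$ for a.e. $t$ and all $(x,u)\in S$. **H(G).** $G$ has nonempty weakly compact convex values and: (i) $t\mapsto G(t,x,u,\eta)$ is measurable; (ii) for every bounded $D\subset\Xi$ there is $l_D\in L^1(I,\mathbb R_+)$ with $\operatorname{Haus}(G(t,x,u,\eta),G(t,y,v,\eta))\le l_D(t)(\|x-y\|_E+\|u-v\|)$ for all $(x,u),(y,v)$, $\eta\in D$, a.e. $t$; (iii) for every bounded $D\subset\Xi$ there is $M_G>0$ with $\|G(t,x,u,\eta)\|\le M_G(1+\|x\|_E+\|u\|)$ for a.e. $t$ and all $(x,u,\eta)\in E\times H\times D$; (iv) $\operatorname{Haus}(G(t,x,u,\eta_1),G(t,x,u,\eta_2))\le\gamma_2(d_\Xi(\eta_1,\eta_2))\rho_2(t,\|x\|_E,\|u\|)$ for all $(x,u)$, $\eta_1,\eta_2$, a.e. $t$, where $\gamma_2(r)\to0$ as $r\to0^+$ and for every bounded $Q\subset C(I,E)\times C(I,H)$ there is $\omega_Q\in L^1(I,\mathbb R_+)$ with $\rho_2(t,\|x(t)\|_E,\|u(t)\|)\le\omega_Q(t)$ for a.e. $t$ and all $(x,u)\in Q$. **H(0).** $x_0$ and $u_0$ are continuous, and for every bounded $D\subset\Lambda\times\Xi$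 there is $\varpi_D>0$ with $\max\{\|x_0(\zeta)\|_E,\|u_0(\eta)\|\}\le\varpi_D$ for all $(\zeta,\eta)\in D$. **H(W).** $W$ is measurable with nonempty closed convex values, and there is $\phi_W\in L^2(I,\mathbb R_+)$ with $\sup_{v\in W(t)}\|v\|_Y\le\phi_W(t)$ for a.e. $t$. **H($\ell$).** (i) $t\mapsto\ell(t,x,u,\zeta,\eta)$ is measurable for all $(x,u,\zeta,\eta)$. (ii) For a.e. $t$, all $x,y\in E$ and all $(u,\zeta,\eta)$, $|\ell(t,x,u,\zeta,\eta)-\ell(t,y,u,\zeta,\eta)|\le(1+\max\{\|x\|_E,\|y\|_E\})\,\kappa(t,\|x-y\|_E)$, where $\kappa:I\times\mathbb R_+\to\mathbb R_+$ is Carath\'eodory, $\kappa(t,0)=0$ for a.e. $t$, and for each $R>0$ there is $\beta_R\in L^1(I,\mathbb R_+)$ with $\sup_{0\le r\le R}\kappa(t,r)\le\beta_R(t)$ for a.e. $t$. (iii) For a.e. $t$ and all $(x,\zeta,\eta)$, $u\mapsto\ell(t,x,u,\zeta,\eta)$ is convex. (iv) For every bounded $D\subset\Lambda\times\Xi$ there is $\vartheta_D\in L^1(I,\mathbb R_+)$ with $|\ell(t,0,u,\zeta,\eta)|\le\vartheta_D(t)(1+\|u\|)$ for a.e. $t$, all $u\in H$, $(\zeta,\eta)\in D$. (v) For a.e. $t$, $(x,u,\zeta,\eta)\mapsto\ell(t,x,u,\zeta,\eta)$ is continuous. **H($\varphi$).** $\varphi$ is continuous. **Controls and controlled solution sets.**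 $\mathcal W_{ad}=\{w\in L^2(I,Y):w(t)\in W(t)\text{ for a.e. }t\in I\}$. For $w\in\mathcal W_{ad}$ and $(\zeta,\eta)\in\Lambda\times\Xi$, $\mathcal S_{\zeta,\eta}(w)$ is the set of mild solutions of $\dot x\in A_\zeta x+F(t,x,u,\zeta)+\mathcal Bw(t)$, $\dot u\in-B(t,u,\eta)(u)+G(t,x,u,\eta)$, $x(0)=x_0(\zeta)$, $u(0)=u_0(\eta)$, i.e. pairs $(x,u)\in C(I,E)\times W^{1,2}(I,H)$ with $u(0)=u_0(\eta)$ for which there are integrable $f:I\to E$, $g:I\to H$ such that, for a.e. $t\in I$, $f(t)\in F(t,x(t),u(t),\zeta)$, $g(t)\in G(t,x(t),u(t),\eta)$, $-\dot u(t)+g(t)\in B(t,u(t),\eta)(u(t))$ (in particular $u(t)\in D(B(t,u(t),\eta))$), and for all $t\in I$, $x(t)=T_\zeta(t)x_0(\zeta)+\int_0^tT_\zeta(t-s)(f(s)+\mathcal Bw(s))\,ds$. **Costs.** $\mathcal J_{\zeta,\eta}(x,u)=\int_0^b\ell(t,x(t),u(t),\zeta,\eta)\,dt+\varphi(x(b),u(b),\zeta,\eta)$; $m_{\zeta,\eta}(w)=\inf_{(x,u)\in\mathcal S_{\zeta,\eta}(w)}\mathcal J_{\zeta,\eta}(x,u)$; $\mathcal R(w)=\frac12\int_0^b\|w(t)\|_Y^2\,dt$. *)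

theory Defs
  imports "HOL-Analysis.Analysis"
begin

text \<open>
  Real separable Hilbert spaces are types of sort
  \<open>{real_inner, banach, second_countable_topology}\<close>. Functions on \<open>I = [0,b]\<close> are total functions
  on the reals that are only ever inspected on \<open>{0..b}\<close>; elements of Lebesgue spaces are
  represented by functions rather than by classes of functions. A multivalued operator is a
  set-valued function whose domain is the set of points with nonempty value.
\<close>

section \<open>Function spaces on an interval\<close>

definition L1_nonneg :: "real \<Rightarrow> (real \<Rightarrow> real) \<Rightarrow> bool" where
  "L1_nonneg b k \<longleftrightarrow> integrable (lebesgue_on {0..b}) k \<and> (\<forall>t\<in>{0..b}. 0 \<le> k t)"

definition L2_on :: "real \<Rightarrow> (real \<Rightarrow> 'a::{real_normed_vector, second_countable_topology}) \<Rightarrow> bool" where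
  "L2_on b w \<longleftrightarrow> w \<in> borel_measurable (lebesgue_on {0..b}) \<and>
     integrable (lebesgue_on {0..b}) (\<lambda>t. (norm (w t))\<^sup>2)"

definition L2_norm_on :: "real \<Rightarrow> (real \<Rightarrow> 'a::real_normed_vector) \<Rightarrow> real" where
  "L2_norm_on b w = sqrt (integral\<^sup>L (lebesgue_on {0..b}) (\<lambda>t. (norm (w t))\<^sup>2))"

text \<open>
  \<open>u \<in> W\<^sup>1\<^sup>,\<^sup>2(I,X)\<close> with derivative \<open>v\<close>: the continuous representative \<open>u\<close> is a primitive
  of the \<open>L\<^sup>2\<close> function \<open>v\<close>, which is unique up to null sets.
\<close>

definition has_L2_derivative ::
  "real \<Rightarrow> (real \<Rightarrow> 'a::{banach, second_countable_topology}) \<Rightarrow> (real \<Rightarrow> 'a) \<Rightarrow> bool" where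
  "has_L2_derivative b u v \<longleftrightarrow> L2_on b v \<and>
     (\<forall>t\<in>{0..b}. u t = u 0 + integral\<^sup>L (lebesgue_on {0..t}) v)"

definition W12 :: "real \<Rightarrow> (real \<Rightarrow> 'a::{banach, second_countable_topology}) \<Rightarrow> bool" where
  "W12 b u \<longleftrightarrow> (\<exists>v. has_L2_derivative b u v)"

section \<open>Sets and multifunctions\<close>

text \<open>Suprema are taken in the extended reals, so that unbounded sets get the value \<open>\<infinity>\<close>.\<close>

definition set_norm :: "'a::real_normed_vector set \<Rightarrow> ereal" where
  "set_norm S = (SUP s\<in>S. ereal (norm s))"

definition Haus :: "'a::metric_space set \<Rightarrow> 'a set \<Rightarrow> ereal" where
  "Haus S R = max (SUP s\<in>S. ereal (infdist s R)) (SUP r\<in>R. ereal (infdist r S))"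

definition measurable_multifunction :: "real \<Rightarrow> (real \<Rightarrow> 'a::topological_space set) \<Rightarrow> bool" where
  "measurable_multifunction b \<Phi> \<longleftrightarrow>
     (\<forall>U. open U \<longrightarrow> {t\<in>{0..b}. \<Phi> t \<subseteq> U} \<in> sets (lebesgue_on {0..b}))"

definition relatively_compact :: "'a::topological_space set \<Rightarrow> bool" where
  "relatively_compact S \<longleftrightarrow> compact (closure S)"

definition ball_relatively_compact :: "'a::real_normed_vector set \<Rightarrow> bool" where
  "ball_relatively_compact S \<longleftrightarrow> (\<forall>r. relatively_compact (S \<inter> cball 0 r))"

definition weak_topology :: "'a::real_normed_vector topology" where
  "weak_topology =
     topology_generated_by {f -` U | (f :: 'a \<Rightarrow> real) U. bounded_linear f \<and> open U}"

definition weakly_compact :: "'a::real_normed_vector set \<Rightarrow> bool" where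
  "weakly_compact S \<longleftrightarrow> compactin weak_topology S"

section \<open>Linear operators and semigroups\<close>

definition linear_operator :: "'a::real_vector set \<Rightarrow> ('a \<Rightarrow> 'a) \<Rightarrow> bool" where
  "linear_operator D A \<longleftrightarrow> subspace D \<and>
     (\<forall>x\<in>D. \<forall>y\<in>D. A (x + y) = A x + A y) \<and> (\<forall>c. \<forall>x\<in>D. A (c *\<^sub>R x) = c *\<^sub>R A x)"

definition C0_semigroup :: "(real \<Rightarrow> 'a::real_normed_vector \<Rightarrow>\<^sub>L 'a) \<Rightarrow> bool" where
  "C0_semigroup T \<longleftrightarrow> T 0 = id_blinfun \<and>
     (\<forall>s\<ge>0. \<forall>t\<ge>0. T (s + t) = T s o\<^sub>L T t) \<and>
     (\<forall>x. ((\<lambda>t. blinfun_apply (T t) x) \<longlongrightarrow> x) (at_right 0))"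

definition generates_C0_semigroup ::
  "'a::real_normed_vector set \<Rightarrow> ('a \<Rightarrow> 'a) \<Rightarrow> (real \<Rightarrow> 'a \<Rightarrow>\<^sub>L 'a) \<Rightarrow> bool" where
  "generates_C0_semigroup D A T \<longleftrightarrow> C0_semigroup T \<and>
     D = {x. \<exists>y. ((\<lambda>h. (blinfun_apply (T h) x - x) /\<^sub>R h) \<longlongrightarrow> y) (at_right 0)} \<and>
     (\<forall>x\<in>D. ((\<lambda>h. (blinfun_apply (T h) x - x) /\<^sub>R h) \<longlongrightarrow> A x) (at_right 0))"

definition compact_operator :: "('a::real_normed_vector \<Rightarrow>\<^sub>L 'b::real_normed_vector) \<Rightarrow> bool" where
  "compact_operator L \<longleftrightarrow> (\<forall>S. bounded S \<longrightarrow> relatively_compact (blinfun_apply L ` S))"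

section \<open>Maximal monotone operators\<close>

definition op_dom :: "('a \<Rightarrow> 'b set) \<Rightarrow> 'a set" where
  "op_dom B = {v. B v \<noteq> {}}"

definition monotone_operator :: "('a::real_inner \<Rightarrow> 'a set) \<Rightarrow> bool" where
  "monotone_operator B \<longleftrightarrow> (\<forall>x x'. \<forall>y\<in>B x. \<forall>y'\<in>B x'. 0 \<le> inner (y - y') (x - x'))"

definition maximal_monotone :: "('a::real_inner \<Rightarrow> 'a set) \<Rightarrow> bool" where
  "maximal_monotone B \<longleftrightarrow> monotone_operator B \<and>
     (\<forall>C. monotone_operator C \<and> (\<forall>x. B x \<subseteq> C x) \<longrightarrow> C = B)"

definition min_section :: "('a \<Rightarrow> 'b::real_normed_vector set) \<Rightarrow> 'a \<Rightarrow> 'b" where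
  "min_section B v = (THE y. y \<in> B v \<and> (\<forall>z\<in>B v. norm y \<le> norm z))"

definition dis :: "('a::real_inner \<Rightarrow> 'a set) \<Rightarrow> ('a \<Rightarrow> 'a set) \<Rightarrow> ereal" where
  "dis B\<^sub>1 B\<^sub>2 =
     (SUP (x, y, x', y') \<in> {(x, y, x', y'). x \<in> op_dom B\<^sub>1 \<and> y \<in> B\<^sub>1 x \<and> x' \<in> op_dom B\<^sub>2 \<and> y' \<in> B\<^sub>2 x'}.
        ereal (inner (y - y') (x' - x) / (1 + norm y + norm y')))"

section \<open>Hypotheses\<close>

definition hyp_A ::
  "real \<Rightarrow> ('p::metric_space \<Rightarrow> 'e::real_normed_vector set) \<Rightarrow> ('p \<Rightarrow> 'e \<Rightarrow> 'e) \<Rightarrow>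
   ('p \<Rightarrow> real \<Rightarrow> 'e \<Rightarrow>\<^sub>L 'e) \<Rightarrow> bool" where
  "hyp_A b DA A T \<longleftrightarrow>
     (\<forall>\<zeta>. generates_C0_semigroup (DA \<zeta>) (A \<zeta>) (T \<zeta>) \<and> (\<forall>t>0. compact_operator (T \<zeta> t))) \<and>
     (\<forall>D. bounded D \<longrightarrow> (\<exists>M>0. \<forall>\<zeta>\<in>D. \<forall>t\<in>{0..b}. norm (T \<zeta> t) \<le> M)) \<and>
     (\<forall>\<zeta>s \<zeta>. \<zeta>s \<longlonglongrightarrow> \<zeta> \<longrightarrow>
        (\<forall>x. (\<lambda>n. SUP t\<in>{0..b}. norm (blinfun_apply (T (\<zeta>s n) t) x - blinfun_apply (T \<zeta> t) x)) \<longlonglongrightarrow> 0) \<and>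
        (\<forall>\<delta>. 0 < \<delta> \<and> \<delta> < b \<longrightarrow> (\<lambda>n. SUP t\<in>{\<delta>..b}. norm (T (\<zeta>s n) t - T \<zeta> t)) \<longlonglongrightarrow> 0))"

definition hyp_B ::
  "real \<Rightarrow> (real \<Rightarrow> 'h::real_inner \<Rightarrow> 'q::metric_space \<Rightarrow> 'h \<Rightarrow> 'h set) \<Rightarrow> bool" where
  "hyp_B b B \<longleftrightarrow>
     (\<exists>(\<theta>::real \<Rightarrow> real) lam lam'. W12 b \<theta> \<and> 0 \<le> lam \<and> lam < 1 \<and> 0 < lam' \<and>
        (\<forall>t\<in>{0..b}. \<forall>s\<in>{0..b}. \<forall>u v \<eta>\<^sub>1 \<eta>\<^sub>2.
           dis (B t u \<eta>\<^sub>1) (B s v \<eta>\<^sub>2) \<le> ereal (\<bar>\<theta> t - \<theta> s\<bar> + lam * norm (u - v) + lam' * dist \<eta>\<^sub>1 \<eta>\<^sub>2))) \<and>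
     (\<exists>M>0. \<forall>t\<in>{0..b}. \<forall>u \<eta>. \<forall>v\<in>op_dom (B t u \<eta>).
        norm (min_section (B t u \<eta>) v) \<le> M * (1 + norm u + norm v)) \<and>
     (\<forall>\<Omega>. bounded \<Omega> \<longrightarrow> ball_relatively_compact (\<Union>t\<in>{0..b}. \<Union>(u, \<eta>)\<in>\<Omega>. op_dom (B t u \<eta>))) \<and>
     (\<forall>D r. bounded D \<and> 0 < r \<longrightarrow> (\<exists>\<rho>. L1_nonneg b \<rho> \<and>
        (\<forall>t\<in>{0..b}. \<forall>u\<^sub>1 u\<^sub>2. norm u\<^sub>1 \<le> r \<and> norm u\<^sub>2 \<le> r \<longrightarrow>
           (\<forall>\<eta>\<^sub>1\<in>D. \<forall>\<eta>\<^sub>2\<in>D. \<forall>v\<^sub>1\<in>B t u\<^sub>1 \<eta>\<^sub>1 u\<^sub>1. \<forall>v\<^sub>2\<in>B t u\<^sub>2 \<eta>\<^sub>2 u\<^sub>2.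
              - \<rho> t * (norm (u\<^sub>1 - u\<^sub>2))\<^sup>2 \<le> inner (v\<^sub>1 - v\<^sub>2) (u\<^sub>1 - u\<^sub>2)))))"

text \<open>The part of the hypotheses that has the same form for \<open>F\<close> and \<open>G\<close>.\<close>

definition hyp_multifunction ::
  "real \<Rightarrow> (real \<Rightarrow> 'e::real_normed_vector \<Rightarrow> 'h::real_normed_vector \<Rightarrow> 'p::metric_space \<Rightarrow>
   'z::real_normed_vector set) \<Rightarrow> bool" where
  "hyp_multifunction b F \<longleftrightarrow>
     (\<forall>t\<in>{0..b}. \<forall>x u \<zeta>. F t x u \<zeta> \<noteq> {} \<and> weakly_compact (F t x u \<zeta>) \<and> convex (F t x u \<zeta>)) \<and>
     (\<forall>x u \<zeta>. measurable_multifunction b (\<lambda>t. F t x u \<zeta>)) \<and>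
     (\<forall>D. bounded D \<longrightarrow> (\<exists>k. L1_nonneg b k \<and>
        (AE t in lebesgue_on {0..b}. \<forall>x u y v. \<forall>\<zeta>\<in>D.
           Haus (F t x u \<zeta>) (F t y v \<zeta>) \<le> ereal (k t * (norm (x - y) + norm (u - v)))))) \<and>
     (\<forall>D. bounded D \<longrightarrow> (\<exists>M>0.
        (AE t in lebesgue_on {0..b}. \<forall>x u. \<forall>\<zeta>\<in>D.
           set_norm (F t x u \<zeta>) \<le> ereal (M * (1 + norm x + norm u)))))"

text \<open>
  Evaluating an element of \<open>L\<^sup>2\<close> at a point only makes sense off a null set depending on that
  element; hence in \<open>hyp_F\<close> the bound by \<open>\<omega>\<close> holds almost everywhere for each pair of the bounded
  set, while in \<open>hyp_G\<close>, for continuous functions, the null set is common to all pairs.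
\<close>

definition hyp_F ::
  "real \<Rightarrow> (real \<Rightarrow> 'e::{real_normed_vector, second_countable_topology} \<Rightarrow>
   'h::{real_normed_vector, second_countable_topology} \<Rightarrow> 'p::metric_space \<Rightarrow> 'e set) \<Rightarrow> bool" where
  "hyp_F b F \<longleftrightarrow> hyp_multifunction b F \<and>
     (\<exists>(\<gamma> :: real \<Rightarrow> real) (\<rho> :: real \<Rightarrow> real \<Rightarrow> real \<Rightarrow> real). (\<gamma> \<longlongrightarrow> 0) (at_right 0) \<and>
        (AE t in lebesgue_on {0..b}. \<forall>x u \<zeta>\<^sub>1 \<zeta>\<^sub>2.
           Haus (F t x u \<zeta>\<^sub>1) (F t x u \<zeta>\<^sub>2) \<le> ereal (\<gamma> (dist \<zeta>\<^sub>1 \<zeta>\<^sub>2) * \<rho> t (norm x) (norm u))) \<and>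
        (\<forall>S :: ((real \<Rightarrow> 'e) \<times> (real \<Rightarrow> 'h)) set.
           (\<forall>(x, u)\<in>S. L2_on b x \<and> L2_on b u) \<and>
           (\<exists>C. \<forall>(x, u)\<in>S. L2_norm_on b x \<le> C \<and> L2_norm_on b u \<le> C) \<longrightarrow>
           (\<exists>\<omega>. L1_nonneg b \<omega> \<and>
              (\<forall>(x, u)\<in>S. AE t in lebesgue_on {0..b}. \<rho> t (norm (x t)) (norm (u t)) \<le> \<omega> t))))"

definition hyp_G ::
  "real \<Rightarrow> (real \<Rightarrow> 'e::real_normed_vector \<Rightarrow> 'h::real_normed_vector \<Rightarrow> 'q::metric_space \<Rightarrow>
   'h set) \<Rightarrow> bool" where
  "hyp_G b G \<longleftrightarrow> hyp_multifunction b G \<and>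
     (\<exists>(\<gamma> :: real \<Rightarrow> real) (\<rho> :: real \<Rightarrow> real \<Rightarrow> real \<Rightarrow> real). (\<gamma> \<longlongrightarrow> 0) (at_right 0) \<and>
        (AE t in lebesgue_on {0..b}. \<forall>x u \<eta>\<^sub>1 \<eta>\<^sub>2.
           Haus (G t x u \<eta>\<^sub>1) (G t x u \<eta>\<^sub>2) \<le> ereal (\<gamma> (dist \<eta>\<^sub>1 \<eta>\<^sub>2) * \<rho> t (norm x) (norm u))) \<and>
        (\<forall>Q :: ((real \<Rightarrow> 'e) \<times> (real \<Rightarrow> 'h)) set.
           (\<forall>(x, u)\<in>Q. continuous_on {0..b} x \<and> continuous_on {0..b} u) \<and>
           (\<exists>C. \<forall>(x, u)\<in>Q. \<forall>t\<in>{0..b}. norm (x t) \<le> C \<and> norm (u t) \<le> C) \<longrightarrow>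
           (\<exists>\<omega>. L1_nonneg b \<omega> \<and>
              (AE t in lebesgue_on {0..b}. \<forall>(x, u)\<in>Q. \<rho> t (norm (x t)) (norm (u t)) \<le> \<omega> t))))"

definition hyp_0 ::
  "('p::metric_space \<Rightarrow> 'e::real_normed_vector) \<Rightarrow> ('q::metric_space \<Rightarrow> 'h::real_normed_vector) \<Rightarrow> bool" where
  "hyp_0 x\<^sub>0 u\<^sub>0 \<longleftrightarrow> continuous_on UNIV x\<^sub>0 \<and> continuous_on UNIV u\<^sub>0 \<and>
     (\<forall>D. bounded D \<longrightarrow> (\<exists>c>0. \<forall>(\<zeta>, \<eta>)\<in>D. max (norm (x\<^sub>0 \<zeta>)) (norm (u\<^sub>0 \<eta>)) \<le> c))"

definition hyp_W :: "real \<Rightarrow> (real \<Rightarrow> 'y::real_normed_vector set) \<Rightarrow> bool" where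
  "hyp_W b W \<longleftrightarrow> measurable_multifunction b W \<and>
     (\<forall>t\<in>{0..b}. W t \<noteq> {} \<and> closed (W t) \<and> convex (W t)) \<and>
     (\<exists>\<phi>::real \<Rightarrow> real. L2_on b \<phi> \<and> (\<forall>t\<in>{0..b}. 0 \<le> \<phi> t) \<and>
        (AE t in lebesgue_on {0..b}. set_norm (W t) \<le> ereal (\<phi> t)))"

definition caratheodory_modulus :: "real \<Rightarrow> (real \<Rightarrow> real \<Rightarrow> real) \<Rightarrow> bool" where
  "caratheodory_modulus b \<kappa> \<longleftrightarrow>
     (\<forall>t\<in>{0..b}. \<forall>r\<ge>0. 0 \<le> \<kappa> t r) \<and>
     (\<forall>r\<ge>0. (\<lambda>t. \<kappa> t r) \<in> borel_measurable (lebesgue_on {0..b})) \<and>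
     (AE t in lebesgue_on {0..b}. continuous_on {0..} (\<kappa> t))"

definition hyp_l ::
  "real \<Rightarrow> (real \<Rightarrow> 'e::real_normed_vector \<Rightarrow> 'h::real_normed_vector \<Rightarrow> 'p::metric_space \<Rightarrow>
   'q::metric_space \<Rightarrow> real) \<Rightarrow> bool" where
  "hyp_l b l \<longleftrightarrow>
     (\<forall>x u \<zeta> \<eta>. (\<lambda>t. l t x u \<zeta> \<eta>) \<in> borel_measurable (lebesgue_on {0..b})) \<and>
     (\<exists>\<kappa>. caratheodory_modulus b \<kappa> \<and>
        (AE t in lebesgue_on {0..b}. \<forall>x y u \<zeta> \<eta>.
           \<bar>l t x u \<zeta> \<eta> - l t y u \<zeta> \<eta>\<bar> \<le> (1 + max (norm x) (norm y)) * \<kappa> t (norm (x - y))) \<and>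
        (AE t in lebesgue_on {0..b}. \<kappa> t 0 = 0) \<and>
        (\<forall>R>0. \<exists>\<beta>. L1_nonneg b \<beta> \<and> (AE t in lebesgue_on {0..b}. \<forall>r\<in>{0..R}. \<kappa> t r \<le> \<beta> t))) \<and>
     (AE t in lebesgue_on {0..b}. \<forall>x \<zeta> \<eta>. convex_on UNIV (\<lambda>u. l t x u \<zeta> \<eta>)) \<and>
     (\<forall>D. bounded D \<longrightarrow> (\<exists>\<theta>. L1_nonneg b \<theta> \<and>
        (AE t in lebesgue_on {0..b}. \<forall>u. \<forall>(\<zeta>, \<eta>)\<in>D. \<bar>l t 0 u \<zeta> \<eta>\<bar> \<le> \<theta> t * (1 + norm u)))) \<and>
     (AE t in lebesgue_on {0..b}. continuous_on UNIV (\<lambda>(x, u, \<zeta>, \<eta>). l t x u \<zeta> \<eta>))"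

definition hyp_phi ::
  "('e::real_normed_vector \<Rightarrow> 'h::real_normed_vector \<Rightarrow> 'p::metric_space \<Rightarrow> 'q::metric_space \<Rightarrow> real) \<Rightarrow> bool" where
  "hyp_phi \<phi> \<longleftrightarrow> continuous_on UNIV (\<lambda>(x, u, \<zeta>, \<eta>). \<phi> x u \<zeta> \<eta>)"

section \<open>Controls, controlled solutions and costs\<close>

definition admissible_controls ::
  "real \<Rightarrow> (real \<Rightarrow> 'y::{real_normed_vector, second_countable_topology} set) \<Rightarrow> (real \<Rightarrow> 'y) set" where
  "admissible_controls b W = {w. L2_on b w \<and> (AE t in lebesgue_on {0..b}. w t \<in> W t)}"

definition mild_solutions ::
  "real \<Rightarrow> ('p \<Rightarrow> real \<Rightarrow> 'e \<Rightarrow>\<^sub>L 'e) \<Rightarrow> (real \<Rightarrow> 'h \<Rightarrow> 'q \<Rightarrow> 'h \<Rightarrow> 'h set) \<Rightarrow>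
   (real \<Rightarrow> 'e::{real_inner, banach, second_countable_topology} \<Rightarrow>
      'h::{real_inner, banach, second_countable_topology} \<Rightarrow> 'p \<Rightarrow> 'e set) \<Rightarrow>
   (real \<Rightarrow> 'e \<Rightarrow> 'h \<Rightarrow> 'q \<Rightarrow> 'h set) \<Rightarrow> ('y::real_normed_vector \<Rightarrow>\<^sub>L 'e) \<Rightarrow>
   ('p \<Rightarrow> 'e) \<Rightarrow> ('q \<Rightarrow> 'h) \<Rightarrow> 'p \<Rightarrow> 'q \<Rightarrow> (real \<Rightarrow> 'y) \<Rightarrow> ((real \<Rightarrow> 'e) \<times> (real \<Rightarrow> 'h)) set" where
  "mild_solutions b T B F G K x\<^sub>0 u\<^sub>0 \<zeta> \<eta> w =
     {(x, u). continuous_on {0..b} x \<and> u 0 = u\<^sub>0 \<eta> \<and>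
        (\<exists>u' f g. has_L2_derivative b u u' \<and>
           integrable (lebesgue_on {0..b}) f \<and> integrable (lebesgue_on {0..b}) g \<and>
           (AE t in lebesgue_on {0..b}.
              f t \<in> F t (x t) (u t) \<zeta> \<and> g t \<in> G t (x t) (u t) \<eta> \<and>
              - u' t + g t \<in> B t (u t) \<eta> (u t)) \<and>
           (\<forall>t\<in>{0..b}. x t = blinfun_apply (T \<zeta> t) (x\<^sub>0 \<zeta>) +
              integral\<^sup>L (lebesgue_on {0..t})
                (\<lambda>s. blinfun_apply (T \<zeta> (t - s)) (f s + blinfun_apply K (w s)))))}"

definition cost ::
  "real \<Rightarrow> (real \<Rightarrow> 'e \<Rightarrow> 'h \<Rightarrow> 'p \<Rightarrow> 'q \<Rightarrow> real) \<Rightarrow> ('e \<Rightarrow> 'h \<Rightarrow> 'p \<Rightarrow> 'q \<Rightarrow> real) \<Rightarrow>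
   'p \<Rightarrow> 'q \<Rightarrow> (real \<Rightarrow> 'e) \<times> (real \<Rightarrow> 'h) \<Rightarrow> real" where
  "cost b l \<phi> \<zeta> \<eta> = (\<lambda>(x, u).
     integral\<^sup>L (lebesgue_on {0..b}) (\<lambda>t. l t (x t) (u t) \<zeta> \<eta>) + \<phi> (x b) (u b) \<zeta> \<eta>)"

text \<open>
  Infima and suprema of costs are taken in the extended reals; in particular the infimum over an
  empty set of solutions is \<open>\<infinity>\<close>.
\<close>

definition min_cost ::
  "real \<Rightarrow> ('p \<Rightarrow> real \<Rightarrow> 'e \<Rightarrow>\<^sub>L 'e) \<Rightarrow> (real \<Rightarrow> 'h \<Rightarrow> 'q \<Rightarrow> 'h \<Rightarrow> 'h set) \<Rightarrow>
   (real \<Rightarrow> 'e::{real_inner, banach, second_countable_topology} \<Rightarrow>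
      'h::{real_inner, banach, second_countable_topology} \<Rightarrow> 'p \<Rightarrow> 'e set) \<Rightarrow>
   (real \<Rightarrow> 'e \<Rightarrow> 'h \<Rightarrow> 'q \<Rightarrow> 'h set) \<Rightarrow> ('y::real_normed_vector \<Rightarrow>\<^sub>L 'e) \<Rightarrow>
   ('p \<Rightarrow> 'e) \<Rightarrow> ('q \<Rightarrow> 'h) \<Rightarrow>
   (real \<Rightarrow> 'e \<Rightarrow> 'h \<Rightarrow> 'p \<Rightarrow> 'q \<Rightarrow> real) \<Rightarrow> ('e \<Rightarrow> 'h \<Rightarrow> 'p \<Rightarrow> 'q \<Rightarrow> real) \<Rightarrow>
   'p \<Rightarrow> 'q \<Rightarrow> (real \<Rightarrow> 'y) \<Rightarrow> ereal" where
  "min_cost b T B F G K x\<^sub>0 u\<^sub>0 l \<phi> \<zeta> \<eta> w =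
     (INF z\<in>mild_solutions b T B F G K x\<^sub>0 u\<^sub>0 \<zeta> \<eta> w. ereal (cost b l \<phi> \<zeta> \<eta> z))"

definition control_cost :: "real \<Rightarrow> (real \<Rightarrow> 'y::real_normed_vector) \<Rightarrow> real" where
  "control_cost b w = 1 / 2 * integral\<^sup>L (lebesgue_on {0..b}) (\<lambda>t. (norm (w t))\<^sup>2)"

definition robust_cost ::
  "real \<Rightarrow> ('p \<Rightarrow> real \<Rightarrow> 'e \<Rightarrow>\<^sub>L 'e) \<Rightarrow> (real \<Rightarrow> 'h \<Rightarrow> 'q \<Rightarrow> 'h \<Rightarrow> 'h set) \<Rightarrow>
   (real \<Rightarrow> 'e::{real_inner, banach, second_countable_topology} \<Rightarrow>
      'h::{real_inner, banach, second_countable_topology} \<Rightarrow> 'p \<Rightarrow> 'e set) \<Rightarrow>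
   (real \<Rightarrow> 'e \<Rightarrow> 'h \<Rightarrow> 'q \<Rightarrow> 'h set) \<Rightarrow> ('y::real_normed_vector \<Rightarrow>\<^sub>L 'e) \<Rightarrow>
   ('p \<Rightarrow> 'e) \<Rightarrow> ('q \<Rightarrow> 'h) \<Rightarrow>
   (real \<Rightarrow> 'e \<Rightarrow> 'h \<Rightarrow> 'p \<Rightarrow> 'q \<Rightarrow> real) \<Rightarrow> ('e \<Rightarrow> 'h \<Rightarrow> 'p \<Rightarrow> 'q \<Rightarrow> real) \<Rightarrow>
   ('p \<times> 'q) set \<Rightarrow> (real \<Rightarrow> 'y) \<Rightarrow> ereal" where
  "robust_cost b T B F G K x\<^sub>0 u\<^sub>0 l \<phi> P w =
     (SUP (\<zeta>, \<eta>)\<in>P. min_cost b T B F G K x\<^sub>0 u\<^sub>0 l \<phi> \<zeta> \<eta> w + ereal (control_cost b w))"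

end

theory Submission
  imports Defs "HOL-Library.Diagonal_Subsequence"
begin

text \<open>
  A supremum of lower semicontinuous functions is lower semicontinuous, so it suffices to show, for each
  fixed parameter, that the marginal cost is weakly sequentially lower semicontinuous in the control;
  the direct method then applies, since the admissible controls are dominated by one \<open>L\<^sup>2\<close> function.

  Weak convergence in \<open>L\<^sup>2\<close> is expressed through convex combinations of tails: a dominated sequence
  always has such combinations that converge almost everywhere, and a subsequence can be chosen for which
  all limits arising from further subsequences agree. For solutions belonging to controls \<open>w\<^sub>n\<close>, comparing
  the inclusion at time \<open>t\<close> with the minimal section at time \<open>t - h\<close> bounds the derivative of \<open>u\<^sub>n\<close>, and
  Gronwall's inequality gives uniform bounds. Compactness of the semigroup and of the domains of the
  monotone operators yields a subsequence of \<open>(x\<^sub>n, u\<^sub>n)\<close> that converges at every time. The inclusions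
  pass to the limit pointwise, because \<open>F\<close> and \<open>G\<close> have closed convex values and the graph of a maximal
  monotone operator is an intersection of conditions that are half-spaces in the second variable.
\<close>

text \<open>Two constraints shape the argument. First, the limit control must serve all parameters
  at once, while the compactness argument for the states extracts a further subsequence and chooses
  new weights for each parameter separately. Hence the limit control is characterised by a property
  that survives both choices, and this property is what the semicontinuity argument takes as input.
  Second, weak limits do not pass through nonlinear data. The quantities that converge only weakly,
  namely the control, the two selections and the derivative of \<open>u\<close>, enter affinely or
  as members of convex sets, so averaging them is harmless; the states enter nonlinearly, but their
  convergence is strong at every time. The derivative bound rests on a sign: for a step backwards in
  time the comparison yields the square of the derivative with a positive sign, and
  \<open>lam < 1\<close> allows the contribution of the state dependence of \<open>B\<close> to be
  absorbed.\<close>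

abbreviation lebesgue_from_0 :: "real \<Rightarrow> real measure" (\<open>\<L>\<close>) where
  "\<L> t \<equiv> lebesgue_on {0..t}"

section \<open>Convex combinations of tails of dominated sequences\<close>

text \<open>The weights are total functions that vanish outside \<open>{n..N}\<close>, so that two
  combinations with different ranges become comparable, and can be averaged, after enlarging
  \<open>N\<close>.\<close>

definition tail_weights :: "nat \<Rightarrow> nat \<Rightarrow> (nat \<Rightarrow> real) \<Rightarrow> bool" where
  "tail_weights n N c \<longleftrightarrow> (\<forall>k. 0 \<le> c k) \<and> (\<forall>k. k < n \<or> N < k \<longrightarrow> c k = 0) \<and> sum c {..N} = 1"

lemma tail_weights_mono:
  assumes "tail_weights n N c" "n' \<le> n" "N \<le> N'"
  shows "tail_weights n' N' c"
proof -
  have "sum c {..N'} = sum c {..N}"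
    using assms by (intro sum.mono_neutral_right) (auto simp: tail_weights_def)
  with assms show ?thesis by (auto simp: tail_weights_def)
qed

lemma tail_weights_extend_sum:
  fixes f :: "nat \<Rightarrow> 'a::real_vector"
  assumes "tail_weights n N c" "N \<le> N'"
  shows "(\<Sum>k\<le>N'. c k *\<^sub>R f k) = (\<Sum>k\<le>N. c k *\<^sub>R f k)"
  using assms by (intro sum.mono_neutral_right) (auto simp: tail_weights_def)

lemma tail_weights_midpoint:
  assumes "tail_weights n N c" "tail_weights n N c'"
  shows "tail_weights n N (\<lambda>k. (c k + c' k) / 2)"
  using assms by (auto simp: tail_weights_def sum.distrib simp flip: sum_divide_distrib)

lemma tail_weights_sum_in_convex:
  fixes f :: "nat \<Rightarrow> 'a::real_vector"
  assumes c: "tail_weights n N c" and S: "convex S" and f: "\<And>k. n \<le> k \<Longrightarrow> f k \<in> S"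
  shows "(\<Sum>k\<le>N. c k *\<^sub>R f k) \<in> S"
proof -
  have *: "(\<Sum>k\<le>N. c k *\<^sub>R f k) = (\<Sum>k\<in>{n..N}. c k *\<^sub>R f k)"
    using c by (intro sum.mono_neutral_right) (auto simp: tail_weights_def)
  have **: "sum c {..N} = sum c {n..N}"
    using c by (intro sum.mono_neutral_right) (auto simp: tail_weights_def)
  show ?thesis unfolding *
    using c ** f by (intro convex_sum[OF _ S]) (auto simp: tail_weights_def)
qed

text \<open>Balls are convex: once a tail lies in a ball around the limit, so do all its convex
  combinations.\<close>

lemma tail_weights_sum_tendsto:
  fixes f :: "nat \<Rightarrow> 'a::real_normed_vector"
  assumes c: "\<And>n. tail_weights n (N n) (c n)" and f: "f \<longlonglongrightarrow> l"
  shows "(\<lambda>n. \<Sum>k\<le>N n. c n k *\<^sub>R f k) \<longlonglongrightarrow> l"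
proof (rule LIMSEQ_I)
  fix e :: real assume e: "0 < e"
  then obtain m where m: "\<And>k. k \<ge> m \<Longrightarrow> dist (f k) l < e"
    using f by (auto simp: lim_sequentially)
  have "norm ((\<Sum>k\<le>N n. c n k *\<^sub>R f k) - l) < e" if "n \<ge> m" for n
  proof -
    have "(\<Sum>k\<le>N n. c n k *\<^sub>R f k) \<in> ball l e"
      using m that by (intro tail_weights_sum_in_convex[OF c]) (auto simp: dist_commute)
    then show ?thesis by (simp add: dist_norm norm_minus_commute)
  qed
  then show "\<exists>no. \<forall>n\<ge>no. norm ((\<Sum>k\<le>N n. c n k *\<^sub>R f k) - l) < e" by blast
qed

lemma diagonal_convergent_subsequence:
  fixes f :: "nat \<Rightarrow> nat \<Rightarrow> 'a::metric_space"
  assumes "\<And>i. compact (C i)" "\<And>i n. f i n \<in> C i"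
  obtains r where "strict_mono r" "\<And>i. convergent (\<lambda>n. f i (r n))"
proof -
  interpret subseqs "\<lambda>i s. convergent (\<lambda>n. f i (s n))"
  proof
    fix i and s :: "nat \<Rightarrow> nat"
    have "seq_compact (C i)" using assms(1) compact_imp_seq_compact by blast
    then obtain l r where "strict_mono r" "((\<lambda>n. f i (s n)) \<circ> r) \<longlonglongrightarrow> l"
      using assms(2) unfolding seq_compact_def by meson
    then show "\<exists>r'. strict_mono r' \<and> convergent (\<lambda>n. f i ((s \<circ> r') n))"
      by (auto simp: convergent_def o_def)
  qed
  have "convergent (\<lambda>n. f i (diagseq n))" for i
  proof -
    \<comment> \<open>The diagonal sequence is a subsequence of the \<open>i\<close>-th extraction
      only after its first \<open>Suc i\<close> terms, so convergence is shown for the shifted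
      sequence and the shift is removed afterwards.\<close>
    have "convergent (\<lambda>n. f i ((diagseq \<circ> (+) (Suc i)) n))"
    proof (rule diagseq_holds)
      fix r s :: "nat \<Rightarrow> nat" and n assume "strict_mono r" "convergent (\<lambda>k. f n (s k))"
      then show "convergent (\<lambda>k. f n ((s \<circ> r) k))"
        using convergent_subseq_convergent[of "\<lambda>k. f n (s k)" r] by (simp add: o_def)
    qed
    then have "convergent (\<lambda>n. f i (diagseq (n + Suc i)))" by (simp add: o_def add.commute)
    then show ?thesis using convergent_ignore_initial_segment[of "\<lambda>n. f i (diagseq n)"] by blast
  qed
  with that subseq_diagseq show ?thesis by blast
qed

section \<open>Dominated sequences of square integrable functions and their averages\<close>

lemma norm_integral_le_AE:
  fixes f :: "'a \<Rightarrow> 'b::{banach, second_countable_topology}"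
  assumes "f \<in> borel_measurable M" "integrable M g" "AE t in M. norm (f t) \<le> g t"
  shows "integrable M f" "norm (integral\<^sup>L M f) \<le> integral\<^sup>L M g"
proof -
  show f: "integrable M f"
    by (rule Bochner_Integration.integrable_bound[OF assms(2,1)]) (use assms(3) in auto)
  have "norm (integral\<^sup>L M f) \<le> (\<integral>t. norm (f t) \<partial>M)" by (rule integral_norm_bound)
  also have "\<dots> \<le> integral\<^sup>L M g" by (rule integral_mono_AE) (use f assms in auto)
  finally show "norm (integral\<^sup>L M f) \<le> integral\<^sup>L M g" .
qed

lemma AE_norm_sum_le:
  assumes "tail_weights n N c" "\<And>k. AE t in M. norm (z k t :: 'a::real_normed_vector) \<le> \<Psi> t"
  shows "AE t in M. norm (\<Sum>k\<le>N. c k *\<^sub>R z k t) \<le> \<Psi> t"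
proof -
  have "AE t in M. \<forall>k. norm (z k t) \<le> \<Psi> t" using assms(2) by (simp add: AE_all_countable)
  then show ?thesis
  proof eventually_elim
    case (elim t)
    have "(\<Sum>k\<le>N. c k *\<^sub>R z k t) \<in> cball 0 (\<Psi> t)"
      using elim by (intro tail_weights_sum_in_convex[OF assms(1)]) auto
    then show ?case by simp
  qed
qed

text \<open>Almost minimal elements of the convex hulls of the tails are Cauchy by the parallelogram law.\<close>

lemma (in finite_measure) dominated_tail_convex_combinations_converge:
  fixes z :: "nat \<Rightarrow> 'a \<Rightarrow> 'b::{real_inner, banach, second_countable_topology}"
  assumes z[measurable]: "\<And>k. z k \<in> borel_measurable M"
    and \<Psi>: "integrable M (\<lambda>t. (\<Psi> t :: real)\<^sup>2)" "\<And>k. AE t in M. norm (z k t) \<le> \<Psi> t"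
  obtains c N zl where "\<And>n. tail_weights n (N n) (c n)" "zl \<in> borel_measurable M"
    "AE t in M. (\<lambda>n. \<Sum>k\<le>N n. c n k *\<^sub>R z k t) \<longlonglongrightarrow> zl t" "AE t in M. norm (zl t) \<le> \<Psi> t"
proof -
  define v where "v = (\<lambda>N c t. \<Sum>k\<le>N. (c k :: real) *\<^sub>R z k t)"
  have v_meas[measurable]: "v N c \<in> borel_measurable M" for N c
    unfolding v_def by measurable
  define Q where "Q = (\<lambda>f. \<integral>t. (norm (f t :: 'b))\<^sup>2 \<partial>M)"
  have v_le: "AE t in M. norm (v N c t) \<le> \<Psi> t" if "tail_weights n N c" for n N c
    unfolding v_def by (rule AE_norm_sum_le[OF that \<Psi>(2)])
  have sq: "integrable M (\<lambda>t. (norm (f t))\<^sup>2)"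
    if [measurable]: "f \<in> borel_measurable M" and "AE t in M. norm (f t) \<le> \<Psi> t" for f :: "'a \<Rightarrow> 'b"
    by (rule Bochner_Integration.integrable_bound[OF \<Psi>(1)]) (use that(2) in \<open>auto simp: power_mono\<close>)
  define S where "S = (\<lambda>n. {Q (v N c) | N c. tail_weights n N c})"
  have Q_nonneg: "0 \<le> Q f" for f unfolding Q_def by simp
  have bdd: "bdd_below (S n)" for n
    by (rule bdd_belowI[of _ 0]) (auto simp: S_def Q_nonneg)
  have unit: "tail_weights n n (\<lambda>k. if k = n then 1 else 0)" for n
    by (auto simp: tail_weights_def)
  have ne: "S n \<noteq> {}" for n
    using unit[of n] by (auto simp: S_def)
  \<comment> \<open>\<open>d n\<close> is the least squared norm reachable from the tail starting at
    \<open>n\<close>. Tails shrink, so \<open>d\<close> increases; the integral of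
    \<open>\<Psi>\<^sup>2\<close> bounds it, hence it converges.\<close>
  define d where "d = (\<lambda>n. Inf (S n))"
  have d_mono: "d n \<le> d m" if "n \<le> m" for n m
    unfolding d_def
    by (rule cInf_superset_mono[OF ne bdd]) (use that tail_weights_mono in \<open>fastforce simp: S_def\<close>)
  have d_bd: "d n \<le> (\<integral>t. (\<Psi> t)\<^sup>2 \<partial>M)" for n
  proof -
    have "d n \<le> Q (v n (\<lambda>k. if k = n then 1 else 0))"
      unfolding d_def by (rule cInf_lower[OF _ bdd]) (use unit[of n] in \<open>auto simp: S_def\<close>)
    also have "\<dots> \<le> (\<integral>t. (\<Psi> t)\<^sup>2 \<partial>M)"
      unfolding Q_def
      by (rule integral_mono_AE[OF sq[OF v_meas v_le[OF unit]] \<Psi>(1)])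
         (use v_le[OF unit[of n]] in \<open>auto simp: power_mono\<close>)
    finally show ?thesis .
  qed
  have conv_d: "convergent d"
  proof (rule Bseq_mono_convergent)
    show "Bseq d"
    proof (rule BseqI')
      fix n show "norm (d n) \<le> \<bar>d 0\<bar> + \<bar>\<integral>t. (\<Psi> t)\<^sup>2 \<partial>M\<bar>"
        using d_mono[of 0 n] d_bd[of n] unfolding real_norm_def by linarith
    qed
  qed (use d_mono in auto)
  have "\<exists>N c. tail_weights n N c \<and> Q (v N c) < d n + 1 / Suc n" for n
  proof -
    have "\<exists>x\<in>S n. x < d n + 1 / Suc n"
      by (rule cInf_lessD) (use ne in \<open>auto simp: d_def\<close>)
    then show ?thesis by (auto simp: S_def)
  qed
  then obtain N c where c: "\<And>n. tail_weights n (N n) (c n)"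
    and Qc: "\<And>n. Q (v (N n) (c n)) < d n + 1 / Suc n" by metis
  define y where "y = (\<lambda>n. v (N n) (c n))"
  have y_meas[measurable]: "y n \<in> borel_measurable M" for n unfolding y_def by simp
  have y_le: "AE t in M. norm (y n t) \<le> \<Psi> t" for n unfolding y_def by (rule v_le[OF c])
  have y_sq: "integrable M (\<lambda>t. (norm (y n t))\<^sup>2)" for n by (rule sq[OF y_meas y_le])
  have diff_sq: "integrable M (\<lambda>t. (norm (y n t - y m t))\<^sup>2)" for n m
  proof (rule Bochner_Integration.integrable_bound)
    show "integrable M (\<lambda>t. 4 * (\<Psi> t)\<^sup>2)" using \<Psi>(1) by simp
    show "AE t in M. norm ((norm (y n t - y m t))\<^sup>2) \<le> norm (4 * (\<Psi> t)\<^sup>2)"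
      using y_le[of n] y_le[of m]
    proof eventually_elim
      case (elim t)
      then have "norm (y n t - y m t) \<le> 2 * \<Psi> t"
        using norm_triangle_ineq4[of "y n t" "y m t"] by linarith
      then have "(norm (y n t - y m t))\<^sup>2 \<le> (2 * \<Psi> t)\<^sup>2" by (rule power_mono) simp
      then show ?case by (simp add: power_mult_distrib)
    qed
  qed measurable
  have Q_diff: "Q (\<lambda>t. y n t - y m t) \<le> 2 * (d m - d n) + 4 / Suc n" if "n \<le> m" for n m
  proof -
    define e where "e = (\<lambda>k. (c n k + c m k) / 2)"
    define K where "K = max (N n) (N m)"
    have w1: "tail_weights n K (c n)" and w2: "tail_weights n K (c m)"
      using tail_weights_mono[OF c[of n], of n K] tail_weights_mono[OF c[of m], of n K] that
      by (auto simp: K_def)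
    have e: "tail_weights n K e" unfolding e_def by (rule tail_weights_midpoint[OF w1 w2])
    have ve: "v K e t = (1/2) *\<^sub>R (y n t + y m t)" for t
    proof -
      have "v K e t = (1/2) *\<^sub>R ((\<Sum>k\<le>K. c n k *\<^sub>R z k t) + (\<Sum>k\<le>K. c m k *\<^sub>R z k t))"
        by (simp add: v_def e_def scaleR_sum_right scaleR_add_left add_divide_distrib sum.distrib scaleR_add_right)
      then show ?thesis
        using tail_weights_extend_sum[OF c[of n], of K "\<lambda>k. z k t"] tail_weights_extend_sum[OF c[of m], of K "\<lambda>k. z k t"]
        by (simp add: y_def v_def K_def)
    qed
    \<comment> \<open>For \<open>n \<le> m\<close> both \<open>y n\<close> and \<open>y m\<close>
      are averages of the tail from \<open>n\<close>, so their midpoint \<open>v K e\<close>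
      competes in the infimum \<open>d n\<close>; the parallelogram identity turns this lower bound
      into an upper bound for the difference.\<close>
    have "d n \<le> Q (v K e)"
      unfolding d_def by (rule cInf_lower[OF _ bdd]) (use e in \<open>auto simp: S_def\<close>)
    moreover have "Q (\<lambda>t. y n t - y m t) = 2 * Q (y n) + 2 * Q (y m) - 4 * Q (v K e)"
    proof -
      have eq: "(norm (y n t - y m t))\<^sup>2 = 2 * (norm (y n t))\<^sup>2 + 2 * (norm (y m t))\<^sup>2 - 4 * (norm (v K e t))\<^sup>2" for t
        unfolding ve by (simp add: power_divide power2_norm_eq_inner inner_diff_left inner_diff_right inner_add_left inner_add_right inner_commute field_simps)
      have "integrable M (\<lambda>t. (norm (v K e t))\<^sup>2)" by (rule sq[OF v_meas v_le[OF e]])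
      then show ?thesis unfolding Q_def eq using y_sq by simp
    qed
    moreover have "Q (y n) < d n + 1 / Suc n" using Qc[of n] by (simp add: y_def)
    moreover have "Q (y m) < d m + 1 / Suc n"
    proof -
      have "1 / real (Suc m) \<le> 1 / Suc n" using that by (intro divide_left_mono) auto
      then show ?thesis using Qc[of m] by (simp add: y_def)
    qed
    ultimately have "Q (\<lambda>t. y n t - y m t) \<le> 2 * (d m - d n) + 4 * (1 / Suc n)"
      by (smt (verit))
    then show ?thesis by simp
  qed
  have cauchy: "\<exists>n0. \<forall>i\<ge>n0. \<forall>j\<ge>n0. (\<integral>t. norm (y i t - y j t) \<partial>M) < \<epsilon>" if "0 < \<epsilon>" for \<epsilon>
  proof -
    define \<mu> where "\<mu> = measure M (space M) + 1"
    have \<mu>: "0 < \<mu>" by (simp add: \<mu>_def add_nonneg_pos)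
    define \<delta> where "\<delta> = \<epsilon> / (2 * \<mu>)"
    have \<delta>: "0 < \<delta>" using that \<mu> by (simp add: \<delta>_def)
    \<comment> \<open>Pointwise, a norm is either at most \<open>\<delta>\<close> or at most its
      square divided by \<open>\<delta>\<close>. On a finite measure space this passes from
      smallness of the squared norm to smallness in \<open>L^1\<close>, and \<open>\<delta>\<close>
      is chosen so that the constant part contributes at most \<open>\<epsilon> / 2\<close>.\<close>
    have L1: "(\<integral>t. norm (y i t - y j t) \<partial>M) \<le> \<epsilon> / 2 + Q (\<lambda>t. y i t - y j t) / \<delta>" for i j
    proof -
      have "(\<integral>t. norm (y i t - y j t) \<partial>M) \<le> (\<integral>t. \<delta> + (norm (y i t - y j t))\<^sup>2 / \<delta> \<partial>M)"
      proof (rule integral_mono)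
        show i2: "integrable M (\<lambda>t. \<delta> + (norm (y i t - y j t))\<^sup>2 / \<delta>)"
          using diff_sq[of i j] by simp
        show le: "norm (y i t - y j t) \<le> \<delta> + (norm (y i t - y j t))\<^sup>2 / \<delta>" for t
        proof (cases "norm (y i t - y j t) \<le> \<delta>")
          case True then show ?thesis using \<delta> by (simp add: add_increasing2)
        next
          case False
          then have "norm (y i t - y j t) * \<delta> \<le> (norm (y i t - y j t))\<^sup>2"
            unfolding power2_eq_square by (intro mult_left_mono) auto
          then have "norm (y i t - y j t) \<le> (norm (y i t - y j t))\<^sup>2 / \<delta>"
            using \<delta> by (simp add: pos_le_divide_eq)
          then show ?thesis using \<delta> by linarith
        qed
        show "integrable M (\<lambda>t. norm (y i t - y j t))"
          by (rule Bochner_Integration.integrable_bound[OF i2])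
             (use le \<delta> in \<open>auto simp: abs_of_nonneg add_nonneg_nonneg\<close>)
      qed
      also have "\<dots> = measure M (space M) * \<delta> + Q (\<lambda>t. y i t - y j t) / \<delta>"
        unfolding Q_def using diff_sq[of i j] by simp
      also have "measure M (space M) * \<delta> \<le> \<mu> * \<delta>" using \<delta> by (intro mult_right_mono) (auto simp: \<mu>_def)
      also have "\<mu> * \<delta> = \<epsilon> / 2" using \<mu> by (simp add: \<delta>_def field_simps)
      finally show ?thesis by simp
    qed
    have "Cauchy d" using conv_d by (rule convergent_Cauchy)
    then obtain n1 where n1: "\<And>i j. i \<ge> n1 \<Longrightarrow> j \<ge> n1 \<Longrightarrow> dist (d i) (d j) < \<epsilon> * \<delta> / 16"
      using metric_CauchyD[of d "\<epsilon> * \<delta> / 16"] \<open>0 < \<epsilon>\<close> \<delta> mult_pos_pos[of \<epsilon> \<delta>] by auto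
    have "0 < \<epsilon> * \<delta> / 32" using that \<delta> by simp
    then obtain n2' where n2': "inverse (real (Suc n2')) < \<epsilon> * \<delta> / 32"
      using reals_Archimedean by blast
    define n2 where "n2 = Suc n2'"
    have n2: "n2 \<ge> 1" "1 / n2 < \<epsilon> * \<delta> / 32" using n2' by (simp_all add: n2_def inverse_eq_divide)
    have main: "(\<integral>t. norm (y i t - y j t) \<partial>M) < \<epsilon>" if ij: "max n1 n2 \<le> i" "i \<le> j" for i j
    proof -
      have "1 / real (Suc i) \<le> 1 / n2" using ij n2 by (intro divide_left_mono) auto
      then have "4 * (1 / real (Suc i)) < 4 * (\<epsilon> * \<delta> / 32)"
        using n2(2) by (intro mult_strict_left_mono) auto
      then have "4 / real (Suc i) < \<epsilon> * \<delta> / 8" by (simp add: mult.commute)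
      moreover have "2 * (d j - d i) < \<epsilon> * \<delta> / 8"
      proof -
        have "dist (d j) (d i) < \<epsilon> * \<delta> / 16" using n1[of j i] ij by auto
        then have "d j - d i < \<epsilon> * \<delta> / 16" unfolding dist_real_def by (rule le_less_trans[OF abs_ge_self])
        then have "2 * (d j - d i) < 2 * (\<epsilon> * \<delta> / 16)" by (rule mult_strict_left_mono) simp
        then show ?thesis by (simp add: mult.commute)
      qed
      ultimately have "Q (\<lambda>t. y i t - y j t) < \<epsilon> * \<delta> / 4" using Q_diff[OF ij(2)] by linarith
      then have "Q (\<lambda>t. y i t - y j t) / \<delta> < \<epsilon> / 4" using \<delta> by (simp add: field_simps)
      then show ?thesis using L1[of i j] \<open>0 < \<epsilon>\<close> by linarith
    qed
    show ?thesis
    proof (intro exI[of _ "max n1 n2"] allI impI)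
      fix i j assume "max n1 n2 \<le> i" "max n1 n2 \<le> j"
      then show "(\<integral>t. norm (y i t - y j t) \<partial>M) < \<epsilon>"
        using main[of i j] main[of j i] by (cases "i \<le> j") (auto simp: norm_minus_commute)
    qed
  qed
  have y_int: "integrable M (y n)" for n
  proof (rule Bochner_Integration.integrable_bound)
    show "integrable M (\<lambda>t. 1 + (norm (y n t))\<^sup>2)" using y_sq by simp
    have "x \<le> 1 + x\<^sup>2" if "0 \<le> x" for x :: real
      using zero_le_power2[of "x - 1"] that by (simp add: power2_eq_square algebra_simps)
    then show "AE t in M. norm (y n t) \<le> norm (1 + (norm (y n t))\<^sup>2)" by auto
  qed measurable
  \<comment> \<open>A sequence that is Cauchy in \<open>L^1\<close> has a subsequence that is Cauchy
    almost everywhere; its weights are still tail weights because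
    \<open>n \<le> r n\<close>.\<close>
  obtain r where r: "strict_mono r" "AE t in M. Cauchy (\<lambda>i. y (r i) t)"
    using cauchy_L1_AE_cauchy_subseq[OF y_int cauchy] by blast
  define zl where "zl = (\<lambda>t. lim (\<lambda>i. y (r i) t))"
  have lim: "AE t in M. (\<lambda>i. y (r i) t) \<longlonglongrightarrow> zl t"
    using r(2) by eventually_elim (simp add: zl_def Cauchy_convergent_iff convergent_LIMSEQ_iff)
  show ?thesis
  proof (rule that[of "\<lambda>n. N (r n)" "\<lambda>n. c (r n)" zl])
    show "tail_weights n (N (r n)) (c (r n))" for n
      using tail_weights_mono[OF c] seq_suble[OF r(1)] by blast
    show "zl \<in> borel_measurable M" unfolding zl_def by measurable
    show "AE t in M. (\<lambda>n. \<Sum>k\<le>N (r n). c (r n) k *\<^sub>R z k t) \<longlonglongrightarrow> zl t"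
      using lim by (simp add: y_def v_def)
    have "AE t in M. \<forall>n. norm (y n t) \<le> \<Psi> t" using y_le by (simp add: AE_all_countable)
    with lim show "AE t in M. norm (zl t) \<le> \<Psi> t"
    proof eventually_elim
      case (elim t)
      show ?case by (rule LIMSEQ_le_const2[OF tendsto_norm[OF elim(1)]]) (use elim(2) in auto)
    qed
  qed
qed

text \<open>A stand-in for weak convergence of \<open>w\<close> to \<open>wl\<close>. Quantifying
  over the subsequence \<open>s\<close> and over all weights makes it stable under further
  extraction, so one \<open>wl\<close> serves whatever subsequences and averages are chosen
  later.\<close>

definition determines_tail_limits ::
  "'a measure \<Rightarrow> (nat \<Rightarrow> 'a \<Rightarrow> 'b::real_normed_vector) \<Rightarrow> ('a \<Rightarrow> 'b) \<Rightarrow> bool" where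
  "determines_tail_limits M w wl \<longleftrightarrow> (\<forall>s c N w'. strict_mono s \<and> (\<forall>n. tail_weights n (N n) (c n)) \<and>
     w' \<in> borel_measurable M \<and> (AE t in M. (\<lambda>n. \<Sum>k\<le>N n. c n k *\<^sub>R w (s k) t) \<longlonglongrightarrow> w' t) \<longrightarrow>
     (AE t in M. w' t = wl t))"

text \<open>The test functions are the \<open>w m\<close> themselves. A diagonal argument makes all
  inner products with them converge, so any two limits of averages agree when tested against every
  \<open>w m\<close>, hence also against each other, being limits of combinations of the
  \<open>w m\<close>. Their difference is then orthogonal to itself.\<close>

lemma (in finite_measure) dominated_weakly_convergent_subsequence:
  fixes w :: "nat \<Rightarrow> 'a \<Rightarrow> 'b::{real_inner, banach, second_countable_topology}"
  assumes w[measurable]: "\<And>k. w k \<in> borel_measurable M"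
    and \<Psi>: "integrable M (\<lambda>t. (\<Psi> t :: real)\<^sup>2)" "\<And>k. AE t in M. norm (w k t) \<le> \<Psi> t"
  obtains r :: "nat \<Rightarrow> nat" and wl where "strict_mono r" "wl \<in> borel_measurable M" "AE t in M. norm (wl t) \<le> \<Psi> t"
    "determines_tail_limits M (\<lambda>k. w (r k)) wl"
proof -
  define ip where "ip = (\<lambda>f g :: 'a \<Rightarrow> 'b. \<integral>t. inner (f t) (g t) \<partial>M)"
  have bnd: "AE t in M. \<bar>inner (f t) (g t)\<bar> \<le> (\<Psi> t)\<^sup>2"
    if "AE t in M. norm (f t) \<le> \<Psi> t" "AE t in M. norm (g t) \<le> \<Psi> t" for f g :: "'a \<Rightarrow> 'b"
    using that
  proof eventually_elim
    case (elim t)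
    have "\<bar>inner (f t) (g t)\<bar> \<le> norm (f t) * norm (g t)" by (rule Cauchy_Schwarz_ineq2)
    also have "\<dots> \<le> \<Psi> t * \<Psi> t" using elim order_trans[OF norm_ge_zero elim(1)] by (intro mult_mono) auto
    finally show ?case by (simp add: power2_eq_square)
  qed
  have ip_int: "integrable M (\<lambda>t. inner (f t) (g t))"
    if [measurable]: "f \<in> borel_measurable M" "g \<in> borel_measurable M"
      and "AE t in M. norm (f t) \<le> \<Psi> t" "AE t in M. norm (g t) \<le> \<Psi> t" for f g :: "'a \<Rightarrow> 'b"
    by (rule Bochner_Integration.integrable_bound[OF \<Psi>(1)]) (use bnd[OF that(3,4)] in auto)
  have ip_bd: "\<bar>ip (w n) (w m)\<bar> \<le> (\<integral>t. (\<Psi> t)\<^sup>2 \<partial>M)" for n m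
  proof -
    have "norm (ip (w n) (w m)) \<le> (\<integral>t. (\<Psi> t)\<^sup>2 \<partial>M)"
      unfolding ip_def
      by (rule norm_integral_le_AE(2)) (use \<Psi>(1) bnd[OF \<Psi>(2) \<Psi>(2)] in auto)
    then show ?thesis by simp
  qed
  obtain r where r: "strict_mono r" "\<And>m. convergent (\<lambda>n. ip (w (r n)) (w m))"
  proof (rule diagonal_convergent_subsequence[of "\<lambda>_. {- (\<integral>t. (\<Psi> t)\<^sup>2 \<partial>M)..(\<integral>t. (\<Psi> t)\<^sup>2 \<partial>M)}" "\<lambda>m n. ip (w n) (w m)"])
    show "ip (w n) (w m) \<in> {- (\<integral>t. (\<Psi> t)\<^sup>2 \<partial>M)..(\<integral>t. (\<Psi> t)\<^sup>2 \<partial>M)}" for m n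
      using ip_bd[of n m] by (auto simp: abs_le_iff)
  qed auto
  define L where "L = (\<lambda>m. lim (\<lambda>n. ip (w (r n)) (w m)))"
  have L: "(\<lambda>n. ip (w (r n)) (w m)) \<longlonglongrightarrow> L m" for m
    using r(2) by (simp add: L_def convergent_LIMSEQ_iff)
  have ip_limit: "(\<lambda>n. ip (f n) g) \<longlonglongrightarrow> ip f' g"
    if f: "\<And>n. f n \<in> borel_measurable M" "f' \<in> borel_measurable M" "g \<in> borel_measurable M"
      and b: "\<And>n. AE t in M. norm (f n t) \<le> \<Psi> t" "AE t in M. norm (g t) \<le> \<Psi> t"
      and l: "AE t in M. (\<lambda>n. f n t) \<longlonglongrightarrow> f' t" for f f' g
    unfolding ip_def
  proof (rule integral_dominated_convergence[where w = "\<lambda>t. (\<Psi> t)\<^sup>2"])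
    show "AE t in M. (\<lambda>n. inner (f n t) (g t)) \<longlonglongrightarrow> inner (f' t) (g t)"
      using l by eventually_elim (intro tendsto_intros)
    show "AE t in M. norm (inner (f n t) (g t)) \<le> (\<Psi> t)\<^sup>2" for n using bnd[OF b(1,2)] by simp
  qed (use f \<Psi>(1) in auto)
  have ip_sum: "ip (\<lambda>t. \<Sum>k\<in>A. c k *\<^sub>R f k t) g = (\<Sum>k\<in>A. c k *\<^sub>R ip (f k) g)"
    if "\<And>k. f k \<in> borel_measurable M" "g \<in> borel_measurable M"
      and "\<And>k. AE t in M. norm (f k t) \<le> \<Psi> t" "AE t in M. norm (g t) \<le> \<Psi> t"
      and "finite A" for A :: "nat set" and c f g
    using ip_int[OF that(1,2,3,4)] by (simp add: ip_def inner_sum_left)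
  have ip_comm: "ip f g = ip g f" for f g by (simp add: ip_def inner_commute)
  have lim_bd: "AE t in M. norm (w' t) \<le> \<Psi> t"
    if c: "\<And>n. tail_weights n (N n) (c n)"
      and l: "AE t in M. (\<lambda>n. \<Sum>k\<le>N n. c n k *\<^sub>R w (s k) t) \<longlonglongrightarrow> w' t" for s :: "nat \<Rightarrow> nat" and c N w'
  proof -
    have "AE t in M. \<forall>n. norm (\<Sum>k\<le>N n. c n k *\<^sub>R w (s k) t) \<le> \<Psi> t"
      using AE_norm_sum_le[OF c, where z = "\<lambda>k. w (s k)" and \<Psi> = \<Psi> and M = M] \<Psi>(2) by (simp add: AE_all_countable)
    with l show ?thesis
    proof eventually_elim
      case (elim t)
      show ?case by (rule LIMSEQ_le_const2[OF tendsto_norm[OF elim(1)]]) (use elim(2) in auto)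
    qed
  qed
  have ident: "ip w' (w m) = L m"
    if s: "strict_mono s" and c: "\<And>n. tail_weights n (N n) (c n)" and w': "w' \<in> borel_measurable M"
      and l: "AE t in M. (\<lambda>n. \<Sum>k\<le>N n. c n k *\<^sub>R w (r (s k)) t) \<longlonglongrightarrow> w' t" for s c N w' m
  proof -
    have "(\<lambda>n. ip (\<lambda>t. \<Sum>k\<le>N n. c n k *\<^sub>R w (r (s k)) t) (w m)) \<longlonglongrightarrow> ip w' (w m)"
      by (rule ip_limit[OF _ w' w AE_norm_sum_le[OF c \<Psi>(2)] \<Psi>(2) l]) measurable
    then have "(\<lambda>n. \<Sum>k\<le>N n. c n k *\<^sub>R ip (w (r (s k))) (w m)) \<longlonglongrightarrow> ip w' (w m)"
      by (simp add: ip_sum[OF w w \<Psi>(2) \<Psi>(2)])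
    moreover have "(\<lambda>n. \<Sum>k\<le>N n. c n k *\<^sub>R ip (w (r (s k))) (w m)) \<longlonglongrightarrow> L m"
      by (rule tail_weights_sum_tendsto[OF c]) (use LIMSEQ_subseq_LIMSEQ[OF L[of m] s] in \<open>simp add: o_def\<close>)
    ultimately show ?thesis by (rule LIMSEQ_unique)
  qed
  obtain N c wl where c: "\<And>n. tail_weights n (N n) (c n)" and wl: "wl \<in> borel_measurable M"
    and l: "AE t in M. (\<lambda>n. \<Sum>k\<le>N n. c n k *\<^sub>R w (r k) t) \<longlonglongrightarrow> wl t" and wl_bd: "AE t in M. norm (wl t) \<le> \<Psi> t"
    by (rule dominated_tail_convex_combinations_converge[of "\<lambda>k. w (r k)" \<Psi>, OF w \<Psi>]) blast
  have id_wl: "ip wl (w m) = L m" for m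
    using ident[of id N c wl m] c wl l by (simp add: strict_mono_def)
  show ?thesis
  proof (rule that[of r wl])
    show "strict_mono r" "wl \<in> borel_measurable M" "AE t in M. norm (wl t) \<le> \<Psi> t" by fact+
    show "determines_tail_limits M (\<lambda>k. w (r k)) wl"
      unfolding determines_tail_limits_def
    proof (intro allI impI, elim conjE)
      fix s c' N' w'
      assume s: "strict_mono s" and c'': "\<forall>n. tail_weights n (N' n) (c' n)" and w': "w' \<in> borel_measurable M"
        and l': "AE t in M. (\<lambda>n. \<Sum>k\<le>N' n. c' n k *\<^sub>R w (r (s k)) t) \<longlonglongrightarrow> w' t"
      have c': "tail_weights n (N' n) (c' n)" for n using c'' by blast
      have w'_bd: "AE t in M. norm (w' t) \<le> \<Psi> t" by (rule lim_bd[OF c' l'])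
      have eq: "ip w' (w m) = ip wl (w m)" for m using ident[OF s c' w' l'] id_wl by simp
      \<comment> \<open>Used below with \<open>h\<close> equal to \<open>w'\<close> and to
        \<open>wl\<close>, the two functions being compared.\<close>
      have ext: "ip w' h = ip wl h"
        if c: "\<And>n. tail_weights n (N n) (c n)" and h: "h \<in> borel_measurable M"
         and l: "AE t in M. (\<lambda>n. \<Sum>k\<le>N n. c n k *\<^sub>R w (q k) t) \<longlonglongrightarrow> h t" for N c h q
      proof -
        have "(\<lambda>n. ip (\<lambda>t. \<Sum>k\<le>N n. c n k *\<^sub>R w (q k) t) w') \<longlonglongrightarrow> ip h w'"
          by (rule ip_limit[OF _ h w' AE_norm_sum_le[OF c \<Psi>(2)] w'_bd l]) measurable
        moreover have "(\<lambda>n. ip (\<lambda>t. \<Sum>k\<le>N n. c n k *\<^sub>R w (q k) t) wl) \<longlonglongrightarrow> ip h wl"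
          by (rule ip_limit[OF _ h wl AE_norm_sum_le[OF c \<Psi>(2)] wl_bd l]) measurable
        moreover have "ip (\<lambda>t. \<Sum>k\<le>N n. c n k *\<^sub>R w (q k) t) w' = ip (\<lambda>t. \<Sum>k\<le>N n. c n k *\<^sub>R w (q k) t) wl" for n
          using eq unfolding ip_sum[OF w w' \<Psi>(2) w'_bd finite_atMost] ip_sum[OF w wl \<Psi>(2) wl_bd finite_atMost]
          by (intro sum.cong refl arg_cong[where f = "scaleR _"]) (metis ip_comm)
        ultimately have "ip h w' = ip h wl" by (simp add: LIMSEQ_unique)
        then show ?thesis using ip_comm by metis
      qed
      have e1: "ip w' w' = ip wl w'" by (rule ext[OF c' w' l'])
      have e2: "ip w' wl = ip wl wl" by (rule ext[OF c wl l])
      note int = ip_int[OF w' w' w'_bd w'_bd] ip_int[OF w' wl w'_bd wl_bd] ip_int[OF wl wl wl_bd wl_bd]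
        ip_int[OF wl w' wl_bd w'_bd]
      have "(\<integral>t. (norm (w' t - wl t))\<^sup>2 \<partial>M) = ip w' w' - ip wl w' - (ip w' wl - ip wl wl)"
        using int by (simp add: ip_def power2_norm_eq_inner inner_diff_left inner_diff_right)
      also have "\<dots> = 0" using e1 e2 by simp
      finally have "(\<integral>t. (norm (w' t - wl t))\<^sup>2 \<partial>M) = 0" .
      moreover have "integrable M (\<lambda>t. (norm (w' t - wl t))\<^sup>2)"
        using int by (simp add: power2_norm_eq_inner inner_diff_left inner_diff_right)
      ultimately have "AE t in M. (norm (w' t - wl t))\<^sup>2 = 0"
        by (subst (asm) integral_nonneg_eq_0_iff_AE) auto
      then show "AE t in M. w' t = wl t" by simp
    qed
  qed
qed

section \<open>Hilbert spaces and maximal monotone operators\<close>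

text \<open>The parallelogram law, with the norm of the midpoint bounded below by \<open>d\<close>
  because the midpoint lies in the convex set.\<close>

lemma norm_diff_le_of_min_norm:
  fixes x y :: "'a::real_inner"
  assumes "convex S" "x \<in> S" "y \<in> S" "\<And>z. z \<in> S \<Longrightarrow> d \<le> norm z" "0 \<le> d"
  shows "(norm (x - y))\<^sup>2 \<le> 2 * (norm x)\<^sup>2 + 2 * (norm y)\<^sup>2 - 4 * d\<^sup>2"
proof -
  have "(1/2) *\<^sub>R x + (1/2) *\<^sub>R y \<in> S"
    using assms(1-3) by (intro convexD) auto
  then have "d \<le> norm ((1/2) *\<^sub>R x + (1/2) *\<^sub>R y)" by (rule assms(4))
  then have "d\<^sup>2 \<le> (norm ((1/2) *\<^sub>R x + (1/2) *\<^sub>R y))\<^sup>2" using assms(5) by (rule power_mono)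
  moreover have "(norm (x - y))\<^sup>2 = 2 * (norm x)\<^sup>2 + 2 * (norm y)\<^sup>2 - 4 * (norm ((1/2) *\<^sub>R x + (1/2) *\<^sub>R y))\<^sup>2"
    by (simp add: power_divide power2_norm_eq_inner inner_diff_left inner_diff_right inner_add_left inner_add_right inner_commute)
  ultimately show ?thesis by linarith
qed

lemma convex_norm_minimizing_Cauchy:
  fixes w :: "nat \<Rightarrow> 'a::real_inner"
  assumes "convex S" "\<And>n. w n \<in> S" "\<And>z. z \<in> S \<Longrightarrow> d \<le> norm z" "0 \<le> d" "(\<lambda>n. norm (w n)) \<longlonglongrightarrow> d"
  shows "Cauchy w"
proof (rule metric_CauchyI)
  fix e :: real assume e: "0 < e"
  have "(\<lambda>n. (norm (w n))\<^sup>2) \<longlonglongrightarrow> d\<^sup>2" by (intro tendsto_intros assms)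
  then have "eventually (\<lambda>n. (norm (w n))\<^sup>2 < d\<^sup>2 + e\<^sup>2 / 4) sequentially"
    by (rule order_tendstoD) (use e in simp)
  then obtain n0 where n0: "\<And>n. n \<ge> n0 \<Longrightarrow> (norm (w n))\<^sup>2 < d\<^sup>2 + e\<^sup>2 / 4"
    by (auto simp: eventually_sequentially)
  show "\<exists>M. \<forall>m\<ge>M. \<forall>n\<ge>M. dist (w m) (w n) < e"
  proof (intro exI[of _ n0] allI impI)
    fix m n assume "n0 \<le> m" "n0 \<le> n"
    then have "(norm (w m - w n))\<^sup>2 < e\<^sup>2"
      using norm_diff_le_of_min_norm[OF assms(1) assms(2)[of m] assms(2)[of n] assms(3,4)] n0[of m] n0[of n]
      by linarith
    then show "dist (w m) (w n) < e" using e by (simp add: dist_norm power2_less_imp_less)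
  qed
qed

lemma closed_convex_ex1_min_norm:
  fixes S :: "'a::{real_inner, banach} set"
  assumes "closed S" "convex S" "S \<noteq> {}"
  shows "\<exists>!p. p \<in> S \<and> (\<forall>z\<in>S. norm p \<le> norm z)"
proof -
  define d where "d = Inf (norm ` S)"
  have bdd: "bdd_below (norm ` S)" by (rule bdd_belowI[of _ 0]) auto
  have d: "d \<le> norm z" if "z \<in> S" for z unfolding d_def by (rule cInf_lower[OF _ bdd]) (use that in auto)
  have d0: "0 \<le> d" unfolding d_def by (rule cInf_greatest) (use assms(3) in auto)
  have "\<exists>z\<in>S. norm z < d + 1 / Suc n" for n
    using cInf_lessD[of "norm ` S" "d + 1 / Suc n"] assms(3) by (auto simp: d_def)
  then obtain w where w: "\<And>n. w n \<in> S" "\<And>n. norm (w n) < d + 1 / Suc n" by metis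
  have "(\<lambda>n. norm (w n)) \<longlonglongrightarrow> d"
  proof (rule tendsto_sandwich[of "\<lambda>_. d" _ _ "\<lambda>n. d + 1 / Suc n"])
    show "(\<lambda>n. d + 1 / Suc n) \<longlonglongrightarrow> d"
      using tendsto_add[OF tendsto_const[of d] LIMSEQ_inverse_real_of_nat] by (simp add: inverse_eq_divide)
  qed (use w d in \<open>auto intro!: always_eventually less_imp_le\<close>)
  from convex_norm_minimizing_Cauchy[OF assms(2) w(1) d d0 this]
  obtain p where p: "w \<longlonglongrightarrow> p" by (auto simp: Cauchy_convergent_iff convergent_def)
  have pS: "p \<in> S" using closed_sequentially[OF assms(1)] w(1) p by blast
  have "norm p = d"
    using LIMSEQ_unique[OF tendsto_norm[OF p] \<open>(\<lambda>n. norm (w n)) \<longlonglongrightarrow> d\<close>] .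
  show ?thesis
  proof (rule ex1I[of _ p])
    show "p \<in> S \<and> (\<forall>z\<in>S. norm p \<le> norm z)" using pS d \<open>norm p = d\<close> by auto
    fix q assume q: "q \<in> S \<and> (\<forall>z\<in>S. norm q \<le> norm z)"
    then have "norm q = d" using pS \<open>norm p = d\<close> d by force
    then have "(norm (q - p))\<^sup>2 \<le> 0"
      using norm_diff_le_of_min_norm[OF assms(2), of q p d] q pS d d0 \<open>norm p = d\<close> by simp
    then show "q = p" by simp
  qed
qed

text \<open>A pair that is monotonically related to the whole graph can be adjoined without losing
  monotonicity, so maximality says that it belonged to the graph already.\<close>

lemma maximal_monotone_mem_iff:
  assumes "maximal_monotone B"
  shows "y \<in> B x \<longleftrightarrow> (\<forall>x'. \<forall>y'\<in>B x'. 0 \<le> inner (y - y') (x - x'))"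
proof
  assume "y \<in> B x"
  then show "\<forall>x'. \<forall>y'\<in>B x'. 0 \<le> inner (y - y') (x - x')"
    using assms by (auto simp: maximal_monotone_def monotone_operator_def)
next
  assume *: "\<forall>x'. \<forall>y'\<in>B x'. 0 \<le> inner (y - y') (x - x')"
  define C where "C = (\<lambda>v. if v = x then insert y (B x) else B v)"
  have mono: "monotone_operator B" using assms by (simp add: maximal_monotone_def)
  have mono_y: "0 \<le> inner (y' - y) (x' - x)" if "y' \<in> B x'" for x' y'
    using * that by (metis inner_minus_left inner_minus_right minus_diff_eq)
  have "monotone_operator C"
    unfolding monotone_operator_def
  proof (intro allI ballI)
    fix a a' c c' assume "c \<in> C a" "c' \<in> C a'"
    then have "(c \<in> B a \<or> a = x \<and> c = y) \<and> (c' \<in> B a' \<or> a' = x \<and> c' = y)"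
      by (auto simp: C_def split: if_splits)
    then show "0 \<le> inner (c - c') (a - a')"
      using mono * mono_y by (auto simp: monotone_operator_def)
  qed
  moreover have "\<forall>v. B v \<subseteq> C v" by (auto simp: C_def)
  ultimately have "C = B" using assms by (simp add: maximal_monotone_def)
  then show "y \<in> B x" by (metis C_def insertI1)
qed

lemma maximal_monotone_closed_convex:
  assumes "maximal_monotone B"
  shows "closed (B x)" "convex (B x)"
proof -
  have eq: "B x = (\<Inter>x'. \<Inter>y'\<in>B x'. {y. inner (x' - x) y \<le> inner (x' - x) y'})"
  proof -
    have "0 \<le> inner (y - y') (x - x') \<longleftrightarrow> inner (x' - x) y \<le> inner (x' - x) y'" for x' y y'
    proof -
      have "inner (y - y') (x - x') = inner (x' - x) y' - inner (x' - x) y"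
        by (simp add: inner_diff_left inner_diff_right inner_commute)
      then show ?thesis by simp
    qed
    then have "y \<in> B x \<longleftrightarrow> (\<forall>x'. \<forall>y'\<in>B x'. inner (x' - x) y \<le> inner (x' - x) y')" for y
      by (subst maximal_monotone_mem_iff[OF assms, of y x]) simp
    then show ?thesis by blast
  qed
  show "closed (B x)" by (subst eq) (intro closed_INT ballI closed_halfspace_le)
  show "convex (B x)" by (subst eq) (intro convex_INT convex_halfspace_le)
qed

lemma min_section_mem:
  fixes B :: "'a::{real_inner, banach} \<Rightarrow> 'a set"
  assumes "maximal_monotone B" "v \<in> op_dom B"
  shows "min_section B v \<in> B v"
proof -
  have "\<exists>!p. p \<in> B v \<and> (\<forall>z\<in>B v. norm p \<le> norm z)"
    by (rule closed_convex_ex1_min_norm)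
       (use maximal_monotone_closed_convex[OF assms(1)] assms(2) in \<open>auto simp: op_dom_def\<close>)
  from theI'[OF this] show ?thesis by (simp add: min_section_def)
qed

lemma dis_leD:
  assumes "dis B1 B2 \<le> ereal e" "y \<in> B1 x" "y' \<in> B2 x'"
  shows "inner (y - y') (x' - x) \<le> e * (1 + norm y + norm y')"
proof -
  have "ereal (inner (y - y') (x' - x) / (1 + norm y + norm y')) \<le> dis B1 B2"
    unfolding dis_def by (rule SUP_upper2[of "(x, y, x', y')"]) (use assms(2,3) in \<open>auto simp: op_dom_def\<close>)
  then have "ereal (inner (y - y') (x' - x) / (1 + norm y + norm y')) \<le> ereal e"
    using assms(1) by (rule order_trans)
  then have "inner (y - y') (x' - x) / (1 + norm y + norm y') \<le> e" by simp
  moreover have "0 < 1 + norm y + norm y'" by (simp add: add_pos_nonneg)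
  ultimately show ?thesis by (simp add: pos_divide_le_eq)
qed

text \<open>A point \<open>y\<close> of the closure outside \<open>S\<close> is separated from each
  \<open>s\<close> in \<open>S\<close> by the hyperplane through their midpoint, at level
  \<open>m s\<close>. Finitely many of the weakly open half-spaces \<open>U s\<close> cover
  \<open>S\<close>, and the opposite open half-spaces then intersect in a neighbourhood of
  \<open>y\<close> that misses \<open>S\<close>.\<close>

lemma weakly_compact_imp_closed:
  fixes S :: "'a::real_inner set"
  assumes "weakly_compact S"
  shows "closed S"
proof -
  have "y \<in> S" if y: "y \<in> closure S" for y
  proof (rule ccontr)
    assume "y \<notin> S"
    define m where "m = (\<lambda>s. inner ((1/2) *\<^sub>R (y + s)) (y - s))"
    define U where "U = (\<lambda>s. (\<lambda>z. inner z (y - s)) -` {..<m s})"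
    have pos: "0 < inner (y - s) (y - s)" if "s \<in> S" for s using that \<open>y \<notin> S\<close> by auto
    have sm: "inner s (y - s) < m s" if "s \<in> S" for s
    proof -
      have "m s - inner s (y - s) = (1/2) * inner (y - s) (y - s)"
        by (simp add: m_def inner_diff_left inner_add_left inner_diff_right algebra_simps)
      then show ?thesis using pos[OF that] by linarith
    qed
    have ym: "m s < inner y (y - s)" if "s \<in> S" for s
    proof -
      have "inner y (y - s) - m s = (1/2) * inner (y - s) (y - s)"
        by (simp add: m_def inner_diff_left inner_add_left inner_diff_right algebra_simps)
      then show ?thesis using pos[OF that] by linarith
    qed
    have "openin weak_topology (U s)" for s
      unfolding weak_topology_def U_def
      by (rule topology_generated_by_Basis, rule CollectI, rule exI[of _ "\<lambda>z. inner z (y - s)"],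
          rule exI[of _ "{..<m s}"]) (simp add: bounded_linear_inner_left)
    moreover have "S \<subseteq> \<Union>(U ` S)" using sm by (auto simp: U_def)
    ultimately obtain F where F: "finite F" "F \<subseteq> U ` S" "S \<subseteq> \<Union>F"
      using assms unfolding weakly_compact_def compactin_def by (metis (no_types, opaque_lifting) image_iff)
    then obtain A where A: "finite A" "A \<subseteq> S" "F = U ` A" by (meson finite_subset_image)
    define V where "V = (\<Inter>s\<in>A. {z. m s < inner z (y - s)})"
    have "open V"
      unfolding V_def using A(1) by (intro open_INT ballI open_Collect_less continuous_intros) auto
    moreover have "y \<in> V" using ym A(2) by (auto simp: V_def)
    ultimately have "V \<inter> S \<noteq> {}" using y by (metis closure_iff_nhds_not_empty order_refl Int_commute)
    then obtain z where z: "z \<in> V" "z \<in> S" by auto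
    then obtain s where "s \<in> A" "z \<in> U s" using F(3) A(3) by auto
    then show False using z(1) by (auto simp: V_def U_def)
  qed
  then have "closure S \<subseteq> S" by auto
  then show ?thesis using closure_subset_eq by blast
qed

section \<open>Measurable selections\<close>

lemma borel_measurable_of_cball:
  fixes p :: "'a \<Rightarrow> 'b::{metric_space, second_countable_topology}"
  assumes "\<And>y r. {t\<in>space M. p t \<in> cball y r} \<in> sets M"
  shows "p \<in> borel_measurable M"
proof (rule borel_measurableI)
  fix U :: "'b set" assume U: "open U"
  obtain D :: "'b set" where D: "countable D" "\<And>X. open X \<Longrightarrow> X \<noteq> {} \<Longrightarrow> \<exists>d\<in>D. d \<in> X"
    using countable_dense_setE by blast
  have eq: "p -` U \<inter> space M = (\<Union>y\<in>D. \<Union>q\<in>{q. cball y (real_of_rat q) \<subseteq> U}. {t\<in>space M. p t \<in> cball y (real_of_rat q)})"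
  proof (intro equalityI subsetI)
    fix t assume t: "t \<in> p -` U \<inter> space M"
    then obtain e where e: "e > 0" "ball (p t) e \<subseteq> U" using U by (auto simp: open_contains_ball)
    obtain y where y: "y \<in> D" "dist (p t) y < e / 4" using D(2)[of "ball (p t) (e/4)"] e by auto
    obtain q where q: "e / 4 < real_of_rat q" "real_of_rat q < e / 2" using of_rat_dense[of "e/4" "e/2"] e by auto
    have "cball y (real_of_rat q) \<subseteq> ball (p t) e"
    proof
      fix x assume "x \<in> cball y (real_of_rat q)"
      then show "x \<in> ball (p t) e" using dist_triangle[of "p t" x y] y(2) q e(1) by auto
    qed
    then show "t \<in> (\<Union>y\<in>D. \<Union>q\<in>{q. cball y (real_of_rat q) \<subseteq> U}. {t\<in>space M. p t \<in> cball y (real_of_rat q)})"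
      using e(2) y q t by (force simp: dist_commute)
  qed auto
  show "p -` U \<inter> space M \<in> sets M"
    unfolding eq using D(1) assms by (intro sets.countable_UN') auto
qed

text \<open>The selection is the element of least norm. It will supply an admissible control, so
  that the infimum over controls runs over a nonempty set.\<close>

lemma measurable_multifunction_selection:
  fixes W :: "real \<Rightarrow> 'y::{real_inner, banach, second_countable_topology} set"
  assumes W: "measurable_multifunction b W"
    and cc: "\<And>t. t \<in> {0..b} \<Longrightarrow> W t \<noteq> {} \<and> closed (W t) \<and> convex (W t)"
  obtains p where "p \<in> borel_measurable (\<L> b)" "\<And>t. t \<in> {0..b} \<Longrightarrow> p t \<in> W t"
proof -
  define p where "p = (\<lambda>t. THE p. p \<in> W t \<and> (\<forall>z\<in>W t. norm p \<le> norm z))"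
  have p: "p t \<in> W t \<and> (\<forall>z\<in>W t. norm (p t) \<le> norm z)" if "t \<in> {0..b}" for t
    unfolding p_def by (rule theI'[OF closed_convex_ex1_min_norm]) (use cc[OF that] in auto)
  have meas: "{t\<in>{0..b}. W t \<inter> C \<noteq> {}} \<in> sets (\<L> b)" if "closed C" for C
  proof -
    have "{t\<in>{0..b}. W t \<inter> C \<noteq> {}} = space (\<L> b) - {t\<in>{0..b}. W t \<subseteq> - C}" by auto
    also have "\<dots> \<in> sets (\<L> b)"
      using W that unfolding measurable_multifunction_def by (intro sets.compl_sets) auto
    finally show ?thesis .
  qed
  \<comment> \<open>Membership of the minimal element in a closed ball becomes countably many
    conditions on whether \<open>W t\<close> meets certain closed sets, and these are what
    measurability of \<open>W\<close> controls. Rational radii close to the minimal norm give a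
    minimizing sequence inside the ball, and a minimizing sequence in a closed convex set converges
    to the minimal element.\<close>
  have iff: "p t \<in> cball y r \<longleftrightarrow>
      (\<forall>q::rat. W t \<inter> cball 0 (real_of_rat q) \<noteq> {} \<longrightarrow> W t \<inter> (cball 0 (real_of_rat q) \<inter> cball y r) \<noteq> {})"
    if t: "t \<in> {0..b}" for t y r
  proof
    assume "p t \<in> cball y r"
    then show "\<forall>q::rat. W t \<inter> cball 0 (real_of_rat q) \<noteq> {} \<longrightarrow> W t \<inter> (cball 0 (real_of_rat q) \<inter> cball y r) \<noteq> {}"
      using p[OF t] order_trans by (metis IntE IntI empty_iff ex_in_conv mem_cball_0)
  next
    assume *: "\<forall>q::rat. W t \<inter> cball 0 (real_of_rat q) \<noteq> {} \<longrightarrow> W t \<inter> (cball 0 (real_of_rat q) \<inter> cball y r) \<noteq> {}"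
    have "\<exists>w. w \<in> W t \<and> w \<in> cball y r \<and> norm w < norm (p t) + 1 / Suc n" for n
    proof -
      obtain q where q: "norm (p t) < real_of_rat q" "real_of_rat q < norm (p t) + 1 / Suc n"
        using of_rat_dense[of "norm (p t)" "norm (p t) + 1 / Suc n"] by auto
      have "p t \<in> W t \<inter> cball 0 (real_of_rat q)" using p[OF t] q by auto
      then have "W t \<inter> (cball 0 (real_of_rat q) \<inter> cball y r) \<noteq> {}" using * by blast
      then show ?thesis using q by force
    qed
    then obtain w where w: "\<And>n. w n \<in> W t" "\<And>n. w n \<in> cball y r" "\<And>n. norm (w n) < norm (p t) + 1 / Suc n" by metis
    have lim: "(\<lambda>n. norm (w n)) \<longlonglongrightarrow> norm (p t)"
    proof (rule tendsto_sandwich[of "\<lambda>_. norm (p t)" _ _ "\<lambda>n. norm (p t) + 1 / Suc n"])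
      show "(\<lambda>n. norm (p t) + 1 / Suc n) \<longlonglongrightarrow> norm (p t)"
        using tendsto_add[OF tendsto_const[of "norm (p t)"] LIMSEQ_inverse_real_of_nat] by (simp add: inverse_eq_divide)
    qed (use w p[OF t] in \<open>auto intro!: always_eventually less_imp_le\<close>)
    have "Cauchy w"
      by (rule convex_norm_minimizing_Cauchy[OF _ w(1) _ norm_ge_zero lim]) (use cc[OF t] p[OF t] in auto)
    then obtain l where l: "w \<longlonglongrightarrow> l" by (auto simp: Cauchy_convergent_iff convergent_def)
    have "l \<in> W t" using cc[OF t] closed_sequentially[of "W t" w l] w(1) l by blast
    moreover have "norm l = norm (p t)" using LIMSEQ_unique[OF tendsto_norm[OF l] lim] .
    ultimately have "l = p t"
      using closed_convex_ex1_min_norm[of "W t"] cc[OF t] p[OF t] by metis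
    moreover have "l \<in> cball y r" using closed_sequentially[OF closed_cball] w(2) l by blast
    ultimately show "p t \<in> cball y r" by simp
  qed
  have "p \<in> borel_measurable (\<L> b)"
  proof (rule borel_measurable_of_cball)
    fix y :: 'y and r
    let ?A = "\<lambda>C. {t\<in>{0..b}. W t \<inter> C \<noteq> {}}"
    have "{t\<in>space (\<L> b). p t \<in> cball y r} =
      {t\<in>{0..b}. \<forall>q::rat. W t \<inter> cball 0 (real_of_rat q) \<noteq> {} \<longrightarrow> W t \<inter> (cball 0 (real_of_rat q) \<inter> cball y r) \<noteq> {}}"
      using iff[of _ y r] by (intro Collect_cong conj_cong) (simp_all only: space_lebesgue_on)
    also have "\<dots> =
      (\<Inter>q::rat. (space (\<L> b) - ?A (cball 0 (real_of_rat q))) \<union> ?A (cball 0 (real_of_rat q) \<inter> cball y r))"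
      unfolding space_lebesgue_on by blast
    also have "\<dots> \<in> sets (\<L> b)"
      by (intro sets.countable_INT' image_subsetI sets.Un sets.compl_sets meas) auto
    finally show "{t\<in>space (\<L> b). p t \<in> cball y r} \<in> sets (\<L> b)" .
  qed
  with p that show ?thesis by blast
qed

section \<open>Integrals over intervals\<close>

lemma lebesgue_on_subinterval:
  fixes f :: "real \<Rightarrow> 'a::{banach, second_countable_topology}"
  assumes "integrable (lebesgue_on {a..b}) f" "{s..t} \<subseteq> {a..b}"
  shows "integrable (lebesgue_on {s..t}) f"
proof -
  have "set_integrable lebesgue {a..b} f"
    using assms(1) by (simp add: integrable_restrict_space set_integrable_def)
  then have "set_integrable lebesgue {s..t} f" by (rule set_integrable_subset) (use assms(2) in auto)
  then show ?thesis by (simp add: integrable_restrict_space set_integrable_def)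
qed

lemma AE_lebesgue_on_subset:
  assumes "AE x in lebesgue_on S. P x" "T \<subseteq> S" "S \<in> sets lebesgue" "T \<in> sets lebesgue"
  shows "AE x in lebesgue_on T. P x"
  using assms by (auto simp: AE_restrict_space_iff elim!: eventually_mono)

lemma integral_lebesgue_on_split:
  fixes f :: "real \<Rightarrow> 'a::{banach, second_countable_topology}"
  assumes f: "integrable (lebesgue_on {a..t}) f" and "a \<le> s" "s \<le> t"
  shows "integral\<^sup>L (lebesgue_on {a..t}) f = integral\<^sup>L (lebesgue_on {a..s}) f + integral\<^sup>L (lebesgue_on {s..t}) f"
proof -
  have eq: "integral\<^sup>L (lebesgue_on {c..d}) f = (LINT x:{c..d}|lebesgue. f x)" for c d
    by (simp add: integral_restrict_space set_lebesgue_integral_def)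
  have int: "set_integrable lebesgue {a..t} f"
    using f by (simp add: integrable_restrict_space set_integrable_def)
  have "(LINT x:{a..s}|lebesgue. f x) + (LINT x:{s..t}|lebesgue. f x) = (LINT x:({a..s} \<union> {s..t})|lebesgue. f x)"
  proof (rule set_integral_Un_AE[symmetric])
    show "AE x in lebesgue. \<not> (x \<in> {a..s} \<and> x \<in> {s..t})"
      by (rule AE_I'[of "{s}"]) auto
    show "set_integrable lebesgue {a..s} f" "set_integrable lebesgue {s..t} f"
      using assms(2,3) by (auto intro: set_integrable_subset[OF int])
  qed auto
  moreover have "{a..s} \<union> {s..t} = {a..t}" using assms by auto
  ultimately show ?thesis by (simp add: eq)
qed

lemma integral_lebesgue_on_mono_set:
  fixes f :: "real \<Rightarrow> real"
  assumes "integrable (lebesgue_on {a..b}) f" "AE x in lebesgue_on {a..b}. 0 \<le> f x" "{s..t} \<subseteq> {a..b}"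
  shows "integral\<^sup>L (lebesgue_on {s..t}) f \<le> integral\<^sup>L (lebesgue_on {a..b}) f"
proof -
  have *: "set_integrable lebesgue {a..b} f"
    using assms(1) by (simp add: integrable_restrict_space set_integrable_def)
  then have **: "set_integrable lebesgue {s..t} f" by (rule set_integrable_subset) (use assms(3) in auto)
  have "AE x in lebesgue. x \<in> {a..b} \<longrightarrow> 0 \<le> f x" using assms(2) by (simp add: AE_restrict_space_iff)
  then have "AE x in lebesgue. indicator {s..t} x *\<^sub>R f x \<le> indicator {a..b} x *\<^sub>R f x"
  proof eventually_elim
    case (elim x) then show ?case using assms(3) by (auto simp: indicator_def)
  qed
  then show ?thesis
    using * ** by (auto simp: integral_restrict_space set_integrable_def intro!: integral_mono_AE)
qed

section \<open>Absolute continuity of integrals and Gronwall's inequality\<close>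

lemma small_integral_on_short_intervals:
  fixes f :: "real \<Rightarrow> real"
  assumes f: "integrable (\<L> b) f" and "0 < e"
  obtains d where "d > 0" "\<And>s t. 0 \<le> s \<Longrightarrow> s \<le> t \<Longrightarrow> t \<le> b \<Longrightarrow> t - s < d \<Longrightarrow> integral\<^sup>L (lebesgue_on {s..t}) f < e"
proof -
  define \<Phi> where "\<Phi> = (\<lambda>t. integral\<^sup>L (\<L> t) f)"
  have eq: "\<Phi> t = integral {0..t} f" if "t \<in> {0..b}" for t
    unfolding \<Phi>_def by (rule lebesgue_integral_eq_integral) (use that lebesgue_on_subinterval[OF f] in auto)
  have "f integrable_on {0..b}" using f by (intro integrable_on_lebesgue_on) auto
  then have "continuous_on {0..b} (\<lambda>t. integral {0..t} f)" by (rule indefinite_integral_continuous_1)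
  then have "continuous_on {0..b} \<Phi>" using eq by (simp cong: continuous_on_cong_simp)
  then have "uniformly_continuous_on {0..b} \<Phi>" by (intro compact_uniformly_continuous) auto
  then obtain d where d: "d > 0" "\<And>x y. x \<in> {0..b} \<Longrightarrow> y \<in> {0..b} \<Longrightarrow> dist y x < d \<Longrightarrow> dist (\<Phi> y) (\<Phi> x) < e"
    unfolding uniformly_continuous_on_def using assms(2) by metis
  show ?thesis
  proof (rule that[OF d(1)])
    fix s t assume st: "0 \<le> s" "s \<le> t" "t \<le> b" "t - s < d"
    have "\<Phi> t = \<Phi> s + integral\<^sup>L (lebesgue_on {s..t}) f"
      unfolding \<Phi>_def by (rule integral_lebesgue_on_split) (use st lebesgue_on_subinterval[OF f] in auto)
    moreover have "dist (\<Phi> t) (\<Phi> s) < e" using st by (intro d(2)) (auto simp: dist_real_def)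
    ultimately show "integral\<^sup>L (lebesgue_on {s..t}) f < e" by (simp add: dist_real_def)
  qed
qed

text \<open>The maximum \<open>m\<close> of \<open>a s * exp (- 2 * K * s)\<close> is estimated by
  the integral inequality at the point \<open>t0\<close> where it is attained. The rate
  \<open>2 * K\<close> is twice the natural one, so that the integral term contributes at most
  \<open>m / 2\<close> and can be absorbed; this is the origin of both factors 2 in the
  bound.\<close>

lemma gronwall_inequality:
  fixes a :: "real \<Rightarrow> real"
  assumes a: "continuous_on {0..b} a" and K: "0 < K" and C: "0 \<le> C"
    and le: "\<And>t. t \<in> {0..b} \<Longrightarrow> a t \<le> C + K * integral\<^sup>L (\<L> t) a"
    and nn: "\<And>t. t \<in> {0..b} \<Longrightarrow> 0 \<le> a t"
    and t: "t \<in> {0..b}"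
  shows "a t \<le> 2 * C * exp (2 * K * b)"
proof -
  have "\<exists>t0\<in>{0..b}. \<forall>s\<in>{0..b}. a s * exp (- 2 * K * s) \<le> a t0 * exp (- 2 * K * t0)"
    using t by (intro continuous_attains_sup continuous_intros a) auto
  then obtain t0 where t0: "t0 \<in> {0..b}" "\<And>s. s \<in> {0..b} \<Longrightarrow> a s * exp (- 2 * K * s) \<le> a t0 * exp (- 2 * K * t0)" by blast
  define m where "m = a t0 * exp (- 2 * K * t0)"
  have a_le: "a s \<le> m * exp (2 * K * s)" if "s \<in> {0..b}" for s
  proof -
    have "a s * exp (- 2 * K * s) * exp (2 * K * s) \<le> m * exp (2 * K * s)"
      using t0(2)[OF that] by (intro mult_right_mono) (auto simp: m_def)
    then show ?thesis by (simp add: mult.assoc flip: exp_add)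
  qed
  have m0: "0 \<le> m" using nn[OF t0(1)] by (simp add: m_def)
  have i1: "integrable (lebesgue_on {0..t0}) a"
    by (rule continuous_imp_integrable_real) (use t0 in \<open>auto intro: continuous_on_subset[OF a]\<close>)
  have cexp: "continuous_on {0..t0} (\<lambda>s. m * exp (2 * K * s))" by (intro continuous_intros)
  have i2: "integrable (lebesgue_on {0..t0}) (\<lambda>s. m * exp (2 * K * s))"
    by (rule continuous_imp_integrable_real[OF cexp])
  have hi: "((\<lambda>s. m * exp (2 * K * s)) has_integral (m / (2 * K) * exp (2 * K * t0) - m / (2 * K) * exp (2 * K * 0))) {0..t0}"
    by (rule fundamental_theorem_of_calculus)
       (use t0 K in \<open>auto intro!: derivative_eq_intros simp flip: has_real_derivative_iff_has_vector_derivative\<close>)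
  have "integral\<^sup>L (lebesgue_on {0..t0}) a \<le> integral\<^sup>L (lebesgue_on {0..t0}) (\<lambda>s. m * exp (2 * K * s))"
    by (rule integral_mono[OF i1 i2]) (use a_le t0 in auto)
  also have "\<dots> = integral {0..t0} (\<lambda>s. m * exp (2 * K * s))"
    by (rule lebesgue_integral_eq_integral[OF i2]) auto
  also have "\<dots> = m / (2 * K) * exp (2 * K * t0) - m / (2 * K) * exp (2 * K * 0)"
    using hi by (rule integral_unique)
  also have "\<dots> \<le> m / (2 * K) * exp (2 * K * t0)" using m0 K by simp
  finally have "K * integral\<^sup>L (lebesgue_on {0..t0}) a \<le> K * (m / (2 * K) * exp (2 * K * t0))"
    using K by (intro mult_left_mono) auto
  also have "\<dots> = m / 2 * exp (2 * K * t0)" using K by simp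
  finally have "a t0 \<le> C + m / 2 * exp (2 * K * t0)" using le[OF t0(1)] by simp
  then have "m \<le> (C + m / 2 * exp (2 * K * t0)) * exp (- 2 * K * t0)"
    unfolding m_def by (rule mult_right_mono) simp
  also have "\<dots> = C * exp (- 2 * K * t0) + m / 2"
    by (simp add: distrib_right mult.assoc flip: exp_add)
  also have "\<dots> \<le> C * 1 + m / 2" using C K t0 by (intro add_mono mult_left_mono) auto
  finally have m2: "m \<le> 2 * C" by simp
  have "a t \<le> m * exp (2 * K * t)" by (rule a_le[OF t])
  also have "\<dots> \<le> (2 * C) * exp (2 * K * b)" using m2 m0 t K by (intro mult_mono) auto
  finally show ?thesis by simp
qed

text \<open>The reflection taking \<open>s\<close> to \<open>- s\<close> turns intervals that end at
  \<open>t\<close> into intervals that start at \<open>- t\<close>, where the forward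
  differentiation theorem applies. The extension \<open>g0\<close> by 0 makes the function
  integrable on every bounded interval.\<close>

lemma lebesgue_differentiation_backward_real:
  fixes g :: "real \<Rightarrow> real"
  assumes g: "integrable (\<L> b) g"
  shows "AE t in \<L> b. ((\<lambda>h. integral\<^sup>L (lebesgue_on {t - h..t}) g / h) \<longlongrightarrow> g t) (at_right 0)"
proof -
  define g0 where "g0 = (\<lambda>s. if s \<in> {0..b} then g s else 0)"
  have "g absolutely_integrable_on {0..b}"
    using g by (simp add: integrable_restrict_space set_integrable_def)
  then have "g0 absolutely_integrable_on UNIV" unfolding g0_def by (subst absolutely_integrable_restrict_UNIV)
  then have ai: "g0 absolutely_integrable_on {c..d}" for c d
    by (rule set_integrable_subset) auto
  have "(\<lambda>s. g0 (- s)) integrable_on cbox c d" for c d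
  proof -
    have "g0 integrable_on {- d..- c}" using ai by (rule set_lebesgue_integral_eq_integral(1))
    then show ?thesis using Henstock_Kurzweil_Integration.integrable_reflect_real[where f = g0 and a = "- d" and b = "- c"] by simp
  qed
  then obtain N where N: "negligible N" "\<And>x e. x \<notin> N \<Longrightarrow> 0 < e \<Longrightarrow>
      \<exists>d>0. \<forall>h. 0 < h \<and> h < d \<longrightarrow> norm (integral (cbox x (x + h *\<^sub>R One)) (\<lambda>s. g0 (- s)) /\<^sub>R h ^ DIM(real) - g0 (- x)) < e"
    by (rule integrable_ccontinuous_explicit) (rule that)
  have "uminus ` N \<in> null_sets lebesgue"
    using negligible_differentiable_image_negligible[of N uminus] N(1)
    by (simp add: negligible_iff_null_sets differentiable_on_minus differentiable_on_ident)
  then have "{0} \<union> uminus ` N \<in> null_sets lebesgue" by (intro null_sets.Un) auto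
  then have "AE t in lebesgue. t \<notin> {0} \<union> uminus ` N" by (rule AE_not_in)
  then have "AE t in lebesgue. t \<in> {0..b} \<longrightarrow> t \<notin> {0} \<union> uminus ` N" by (rule eventually_mono) simp
  then have "AE t in \<L> b. t \<notin> {0} \<union> uminus ` N" by (subst AE_restrict_space_iff) auto
  moreover have "AE t in \<L> b. t \<in> {0..b}" using AE_space[of "\<L> b"] by simp
  ultimately show ?thesis
  proof eventually_elim
    case (elim t)
    then have t: "0 < t" "t \<le> b" "- t \<notin> N" by (auto simp: image_iff)
    show ?case
    proof (rule tendstoI)
      fix e :: real assume "0 < e"
      then obtain d where d: "d > 0" "\<And>h. 0 < h \<Longrightarrow> h < d \<Longrightarrow>
         norm (integral (cbox (- t) (- t + h *\<^sub>R One)) (\<lambda>s. g0 (- s)) /\<^sub>R h ^ DIM(real) - g0 t) < e"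
        using N(2)[OF t(3) \<open>0 < e\<close>] by auto
      have "dist (integral\<^sup>L (lebesgue_on {t - h..t}) g / h) (g t) < e" if h: "0 < h" "h < min d t" for h
      proof -
        have sub: "{t - h..t} \<subseteq> {0..b}" using h t by auto
        have "integral {- t..- (t - h)} (\<lambda>s. g0 (- s)) = integral {t - h..t} g0"
          by (rule Henstock_Kurzweil_Integration.integral_reflect_real)
        also have "\<dots> = integral {t - h..t} g" by (rule integral_cong) (use sub in \<open>auto simp: g0_def\<close>)
        also have "\<dots> = integral\<^sup>L (lebesgue_on {t - h..t}) g"
          by (rule lebesgue_integral_eq_integral[symmetric, OF lebesgue_on_subinterval[OF g sub]]) auto
        finally have "integral {- t..- t + h} (\<lambda>s. g0 (- s)) = integral\<^sup>L (lebesgue_on {t - h..t}) g" by simp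
        moreover have "g0 t = g t" using t by (simp add: g0_def)
        ultimately show ?thesis using d(2)[of h] h by (simp add: dist_real_def divide_inverse mult.commute)
      qed
      then show "\<forall>\<^sub>F h in at_right 0. dist (integral\<^sup>L (lebesgue_on {t - h..t}) g / h) (g t) < e"
        unfolding eventually_at_right_field using d(1) t(1) by (intro exI[of _ "min d t"]) auto
    qed
  qed
qed

text \<open>The scalar theorem is applied to the distances of \<open>f\<close> from the points
  \<open>c\<close> of a countable dense set. Off one common null set, the averages of
  \<open>f\<close> near \<open>t\<close> are then controlled by choosing \<open>c\<close> close to
  \<open>f t\<close>.\<close>

lemma lebesgue_differentiation_backward:
  fixes f :: "real \<Rightarrow> 'a::{banach, second_countable_topology}"
  assumes f: "integrable (\<L> b) f"
  shows "AE t in \<L> b. ((\<lambda>h. integral\<^sup>L (lebesgue_on {t - h..t}) f /\<^sub>R h) \<longlongrightarrow> f t) (at_right 0)"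
proof -
  obtain D :: "'a set" where D: "countable D" "\<And>X. open X \<Longrightarrow> X \<noteq> {} \<Longrightarrow> \<exists>d\<in>D. d \<in> X"
    using countable_dense_setE by blast
  have fin: "finite_measure (lebesgue_on {s..t})" for s t :: real
    by (rule finite_measure_lebesgue_on) simp
  have intc: "integrable (\<L> b) (\<lambda>s. norm (f s - c))" for c
    using f finite_measure.integrable_const[OF fin] by (intro integrable_norm Bochner_Integration.integrable_diff) auto
  have "AE t in \<L> b. \<forall>c\<in>D.
     ((\<lambda>h. integral\<^sup>L (lebesgue_on {t - h..t}) (\<lambda>s. norm (f s - c)) / h) \<longlongrightarrow> norm (f t - c)) (at_right 0)"
    by (intro AE_ball_countable' D(1) lebesgue_differentiation_backward_real intc)
  moreover have "AE t in \<L> b. t \<in> {0..b}" using AE_space[of "\<L> b"] by simp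
  moreover have "AE t in \<L> b. t \<noteq> 0"
  proof -
    have "AE t in lebesgue. t \<notin> {0::real}" by (rule AE_not_in) simp
    then show ?thesis by (auto simp: AE_restrict_space_iff elim!: eventually_mono)
  qed
  ultimately show ?thesis
  proof eventually_elim
    case (elim t)
    show ?case
    proof (rule tendstoI)
      fix e :: real assume e: "0 < e"
      obtain c where c: "c \<in> D" "dist (f t) c < e / 4" using D(2)[of "ball (f t) (e/4)"] e by auto
      have "\<forall>\<^sub>F h in at_right 0. integral\<^sup>L (lebesgue_on {t - h..t}) (\<lambda>s. norm (f s - c)) / h < e / 2"
        by (rule order_tendstoD(2)[OF elim(1)[rule_format, OF c(1)]]) (use c(2) e in \<open>simp add: dist_norm\<close>)
      moreover have "\<forall>\<^sub>F h in at_right 0. 0 < h \<and> h < t"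
        unfolding eventually_at_right_field using elim by (intro exI[of _ t]) auto
      ultimately show "\<forall>\<^sub>F h in at_right 0. dist (integral\<^sup>L (lebesgue_on {t - h..t}) f /\<^sub>R h) (f t) < e"
      proof eventually_elim
        case (elim h)
        have sub: "{t - h..t} \<subseteq> {0..b}" using elim \<open>t \<in> {0..b}\<close> by auto
        note fi = lebesgue_on_subinterval[OF f sub]
        have ci: "integrable (lebesgue_on {t - h..t}) (\<lambda>s. c)" by (rule finite_measure.integrable_const[OF fin])
        have "integral\<^sup>L (lebesgue_on {t - h..t}) (\<lambda>s. f s - c) = integral\<^sup>L (lebesgue_on {t - h..t}) f - h *\<^sub>R c"
          using fi ci elim by (simp add: measure_restrict_space)
        then have "integral\<^sup>L (lebesgue_on {t - h..t}) f /\<^sub>R h - c = integral\<^sup>L (lebesgue_on {t - h..t}) (\<lambda>s. f s - c) /\<^sub>R h"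
          using elim by (simp add: scaleR_diff_right)
        also have "norm \<dots> \<le> integral\<^sup>L (lebesgue_on {t - h..t}) (\<lambda>s. norm (f s - c)) / h"
          using elim integral_norm_bound[of "lebesgue_on {t - h..t}" "\<lambda>s. f s - c"]
          unfolding norm_scaleR divide_inverse_commute by (intro mult_mono) auto
        finally have "norm (integral\<^sup>L (lebesgue_on {t - h..t}) f /\<^sub>R h - c) < e / 2" using elim by linarith
        then have "dist (integral\<^sup>L (lebesgue_on {t - h..t}) f /\<^sub>R h) c < e / 2" by (simp only: dist_norm)
        moreover have "dist c (f t) < e / 4" using c(2) by (simp only: dist_commute)
        ultimately show ?case
          using e dist_triangle[of "integral\<^sup>L (lebesgue_on {t - h..t}) f /\<^sub>R h" "f t" c] by linarith
      qed
    qed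
  qed
qed

section \<open>The derivative estimate for the evolution inclusion\<close>

lemma AE_lebesgue_on_ex_between:
  fixes b :: real
  assumes "AE t in \<L> b. P t" "0 \<le> c" "c < d" "d \<le> b"
  shows "\<exists>t. c < t \<and> t < d \<and> P t"
proof (rule ccontr)
  assume *: "\<not> ?thesis"
  have "AE t in lebesgue. t \<in> {0..b} \<longrightarrow> P t" using assms(1) by (subst (asm) AE_restrict_space_iff) auto
  then have "AE t in lebesgue. t \<notin> {c<..<d}"
    by (rule eventually_mono) (use * assms(2-4) in auto)
  then have "{c<..<d} \<in> null_sets lebesgue" by (subst AE_iff_null_sets) auto
  then have "emeasure lebesgue {c<..<d} = 0" by (simp add: null_sets_def)
  then show False using assms(3) by (simp add: ennreal_eq_0_iff)
qed

lemma L2_on_integrable: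
  assumes "L2_on b w"
  shows "integrable (\<L> b) (w :: real \<Rightarrow> 'a::{banach, second_countable_topology})"
proof (rule norm_integral_le_AE(1))
  have fin: "finite_measure (\<L> b)" by (rule finite_measure_lebesgue_on) simp
  show "w \<in> borel_measurable (\<L> b)" using assms by (simp add: L2_on_def)
  show "integrable (\<L> b) (\<lambda>t. 1 + (norm (w t))\<^sup>2)"
    using assms finite_measure.integrable_const[OF fin] by (intro Bochner_Integration.integrable_add) (auto simp: L2_on_def)
  have "x \<le> 1 + x\<^sup>2" if "0 \<le> x" for x :: real
    using zero_le_power2[of "x - 1"] that by (simp add: power2_eq_square algebra_simps)
  then show "AE t in \<L> b. norm (w t) \<le> 1 + (norm (w t))\<^sup>2" by auto
qed

lemma has_L2_derivative_increment:
  assumes "has_L2_derivative b u u'" "0 \<le> s" "s \<le> t" "t \<le> b"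
  shows "u t - u s = integral\<^sup>L (lebesgue_on {s..t}) u'"
proof -
  have int: "integrable (\<L> b) u'"
    using assms(1) L2_on_integrable by (auto simp: has_L2_derivative_def)
  have "integral\<^sup>L (\<L> t) u' = integral\<^sup>L (\<L> s) u' + integral\<^sup>L (lebesgue_on {s..t}) u'"
    by (rule integral_lebesgue_on_split[OF lebesgue_on_subinterval[OF int]]) (use assms in auto)
  moreover have "u t = u 0 + integral\<^sup>L (\<L> t) u'" "u s = u 0 + integral\<^sup>L (\<L> s) u'"
    using assms unfolding has_L2_derivative_def by (blast intro: atLeastAtMost_iff[THEN iffD2] order_trans)+
  ultimately show ?thesis by simp
qed

lemma norm_integral_lebesgue_on_le:
  fixes f :: "real \<Rightarrow> 'a::{banach, second_countable_topology}"
  assumes "f \<in> borel_measurable (lebesgue_on {s..t})" "{s..t} \<subseteq> {0..b}"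
    and "integrable (\<L> b) \<psi>" "AE r in lebesgue_on {s..t}. norm (f r) \<le> \<psi> r"
  shows "integrable (lebesgue_on {s..t}) f" "norm (integral\<^sup>L (lebesgue_on {s..t}) f) \<le> integral\<^sup>L (lebesgue_on {s..t}) \<psi>"
  using norm_integral_le_AE[OF assms(1) lebesgue_on_subinterval[OF assms(3,2)] assms(4)] by auto

lemma continuous_on_of_increment_le:
  fixes u :: "real \<Rightarrow> 'a::real_normed_vector"
  assumes \<psi>: "integrable (\<L> b) \<psi>"
    and le: "\<And>s t. 0 \<le> s \<Longrightarrow> s \<le> t \<Longrightarrow> t \<le> b \<Longrightarrow> norm (u t - u s) \<le> integral\<^sup>L (lebesgue_on {s..t}) \<psi>"
  shows "continuous_on {0..b} u"
  unfolding continuous_on_iff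
proof (intro ballI allI impI)
  fix t e :: real assume t: "t \<in> {0..b}" and "0 < e"
  then obtain d where d: "d > 0" "\<And>s t. 0 \<le> s \<Longrightarrow> s \<le> t \<Longrightarrow> t \<le> b \<Longrightarrow> t - s < d \<Longrightarrow> integral\<^sup>L (lebesgue_on {s..t}) \<psi> < e"
    using small_integral_on_short_intervals[OF \<psi>] by metis
  show "\<exists>d>0. \<forall>s\<in>{0..b}. dist s t < d \<longrightarrow> dist (u s) (u t) < e"
  proof (intro exI[of _ d] conjI ballI impI d(1))
    fix s assume s: "s \<in> {0..b}" "dist s t < d"
    show "dist (u s) (u t) < e"
    proof (cases "s \<le> t")
      case True
      then show ?thesis using le[of s t] d(2)[of s t] s t by (auto simp: dist_norm norm_minus_commute)
    next
      case False
      then show ?thesis using le[of t s] d(2)[of t s] s t by (auto simp: dist_norm)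
    qed
  qed
qed

lemma has_L2_derivative_continuous_on:
  assumes "has_L2_derivative b u u'"
  shows "continuous_on {0..b} u"
proof (rule continuous_on_of_increment_le)
  have int: "integrable (\<L> b) u'"
    using assms(1) L2_on_integrable by (auto simp: has_L2_derivative_def)
  then show "integrable (\<L> b) (\<lambda>t. norm (u' t))" by simp
  show "norm (u t - u s) \<le> integral\<^sup>L (lebesgue_on {s..t}) (\<lambda>t. norm (u' t))" if "0 \<le> s" "s \<le> t" "t \<le> b" for s t
    unfolding has_L2_derivative_increment[OF assms that] by (rule integral_norm_bound)
qed

lemma AE_continuous_on_closed:
  fixes u :: "real \<Rightarrow> 'a::metric_space"
  assumes "continuous_on {0..b} u" "closed C" "AE t in \<L> b. u t \<in> C" "t \<in> {0..b}" "0 < b"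
  shows "u t \<in> C"
proof (rule ccontr)
  assume "u t \<notin> C"
  then obtain e where e: "e > 0" "ball (u t) e \<subseteq> - C"
    using assms(2) by (metis ComplI open_Compl openE)
  obtain d where d: "d > 0" "\<And>s. s \<in> {0..b} \<Longrightarrow> dist s t < d \<Longrightarrow> dist (u s) (u t) < e"
    using assms(1,4) e(1) unfolding continuous_on_iff by metis
  have "max 0 (t - d) < min b (t + d)" using d assms(4,5) by auto
  then obtain s where s: "max 0 (t - d) < s" "s < min b (t + d)" "u s \<in> C"
    using AE_lebesgue_on_ex_between[OF assms(3), of "max 0 (t - d)" "min b (t + d)"] by auto
  then have "dist (u s) (u t) < e" by (intro d(2)) (auto simp: dist_real_def)
  then have "u s \<in> - C" using e(2) by (auto simp: dist_commute)
  then show False using s(3) by simp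
qed

text \<open>If \<open>p\<close> exceeded the bound, then \<open>3 * X < \<mu> * p\<close>, so the
  left-hand side would exceed \<open>3 * X * p\<close>. Cancelling \<open>2 * p * X\<close> leaves
  \<open>p < X\<close>, which contradicts the bound being at least \<open>X\<close> for
  \<open>\<mu> \<le> 1\<close>.\<close>

lemma quadratic_inequality_bound:
  fixes p X \<mu> :: real
  assumes "\<mu> * p\<^sup>2 \<le> 2 * p * X + X\<^sup>2" "0 < \<mu>" "\<mu> \<le> 1" "0 \<le> p" "0 < X"
  shows "p \<le> 3 / \<mu> * X"
proof (rule ccontr)
  assume neg: "\<not> ?thesis"
  then have "3 * X < \<mu> * p" using assms(2) by (simp add: field_simps)
  moreover have "0 < p" using assms(4,5) calculation by (cases "p = 0") auto
  ultimately have "3 * X * p < \<mu> * p * p" by (intro mult_strict_right_mono)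
  then have "X * p < X * X" using assms(1) by (simp add: power2_eq_square algebra_simps)
  then have "p < X" using assms(5) by simp
  have "X \<le> 3 / \<mu> * X" using assms(2,3,5) by (simp add: field_simps)
  then show False using neg \<open>p < X\<close> by linarith
qed

text \<open>
  Comparing the inclusion at \<open>t\<close> with the minimal section at \<open>t - h\<close> and letting \<open>h\<close> tend to 0
  bounds \<open>\<parallel>u'\<parallel>\<^sup>2\<close> by \<open>\<lambda> \<parallel>u'\<parallel>\<^sup>2\<close> up to terms of lower order.
\<close>

lemma evolution_derivative_bound:
  fixes u :: "real \<Rightarrow> 'h::{real_inner, banach, second_countable_topology}" and \<theta> :: "real \<Rightarrow> real"
  assumes maxm: "\<And>t v. t \<in> {0..b} \<Longrightarrow> maximal_monotone (B t v)"
    and dis: "\<And>t s v w. t \<in> {0..b} \<Longrightarrow> s \<in> {0..b} \<Longrightarrow> dis (B t v) (B s w) \<le> ereal (\<bar>\<theta> t - \<theta> s\<bar> + lam * norm (v - w))"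
    and lam: "0 \<le> lam" "lam < 1"
    and M: "\<And>t v w. t \<in> {0..b} \<Longrightarrow> w \<in> op_dom (B t v) \<Longrightarrow> norm (min_section (B t v) w) \<le> M * (1 + norm v + norm w)"
    and M0: "0 \<le> M"
    and \<theta>: "has_L2_derivative b \<theta> \<theta>'" and u: "has_L2_derivative b u u'"
    and incl: "AE t in \<L> b. - u' t + g t \<in> B t (u t) (u t)"
  shows "AE t in \<L> b. norm (u' t) \<le> 3 / (1 - lam) * (1 + norm (g t) + M * (1 + 2 * norm (u t)) + \<bar>\<theta>' t\<bar>)"
proof -
  have ui: "integrable (\<L> b) u'" and \<theta>i: "integrable (\<L> b) \<theta>'"
    using u \<theta> L2_on_integrable by (auto simp: has_L2_derivative_def)
  have cu: "continuous_on {0..b} u" by (rule has_L2_derivative_continuous_on[OF u])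
  have "AE t in \<L> b. t \<in> {0..b}" using AE_space[of "\<L> b"] by simp
  moreover have "AE t in \<L> b. t \<noteq> 0"
  proof -
    have "AE t in lebesgue. t \<notin> {0::real}" by (rule AE_not_in) simp
    then show ?thesis by (auto simp: AE_restrict_space_iff elim!: eventually_mono)
  qed
  ultimately show ?thesis
    using lebesgue_differentiation_backward[OF ui] lebesgue_differentiation_backward[OF \<theta>i] incl
  proof eventually_elim
    case (elim t)
    then have t: "0 < t" "t \<le> b" by auto
    \<comment> \<open>The inclusion holds only almost everywhere, so the steps \<open>h\<close> are
      picked to land at times where it does; there \<open>u (t - h)\<close> lies in the domain, and
      the minimal section has a meaning.\<close>
    have "\<exists>h. 0 < h \<and> h < t / Suc n \<and> - u' (t - h) + g (t - h) \<in> B (t - h) (u (t - h)) (u (t - h))" for n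
    proof -
      have tn: "t / Suc n \<le> t" "0 < t / Suc n" using t by (auto simp: divide_le_eq)
      then obtain s where "t - t / Suc n < s" "s < t" "- u' s + g s \<in> B s (u s) (u s)"
        using AE_lebesgue_on_ex_between[OF incl, of "t - t / Suc n" t] t by auto
      then show ?thesis by (intro exI[of _ "t - s"]) auto
    qed
    then obtain h where h: "\<And>n. 0 < h n" "\<And>n. h n < t / Suc n"
      "\<And>n. - u' (t - h n) + g (t - h n) \<in> B (t - h n) (u (t - h n)) (u (t - h n))" by metis
    have h0: "h \<longlonglongrightarrow> 0"
    proof (rule tendsto_sandwich[of "\<lambda>_. 0" _ _ "\<lambda>n. t * inverse (Suc n)"])
      show "(\<lambda>n. t * inverse (real (Suc n))) \<longlonglongrightarrow> 0"
        using tendsto_mult[OF tendsto_const[of t] LIMSEQ_inverse_real_of_nat] by simp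
    qed (use h(1,2) in \<open>auto intro!: always_eventually less_imp_le simp: divide_inverse\<close>)
    have ht: "t - h n \<in> {0..b}" for n
    proof -
      have "t / Suc n \<le> t" using t by (auto simp: divide_le_eq)
      then show ?thesis using h(1,2)[of n] t by auto
    qed
    have fl: "filterlim h (at_right 0) sequentially"
      using h0 h(1) by (auto simp: filterlim_at less_imp_neq[symmetric] intro!: always_eventually)
    define D where "D = (\<lambda>n. (u t - u (t - h n)) /\<^sub>R h n)"
    define E where "E = (\<lambda>n. \<bar>\<theta> t - \<theta> (t - h n)\<bar> / h n)"
    have "D n = integral\<^sup>L (lebesgue_on {t - h n..t}) u' /\<^sub>R h n" for n
      unfolding D_def using has_L2_derivative_increment[OF u, of "t - h n" t] ht[of n] h(1)[of n] t by simp
    then have "D = (\<lambda>n. integral\<^sup>L (lebesgue_on {t - h n..t}) u' /\<^sub>R h n)" by blast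
    then have D: "D \<longlonglongrightarrow> u' t" using filterlim_compose[OF elim(3) fl] by simp
    have "E n = \<bar>integral\<^sup>L (lebesgue_on {t - h n..t}) \<theta>' /\<^sub>R h n\<bar>" for n
      unfolding E_def using has_L2_derivative_increment[OF \<theta>, of "t - h n" t] ht[of n] h(1)[of n] t
      by (simp add: abs_mult divide_inverse_commute)
    then have "E = (\<lambda>n. \<bar>integral\<^sup>L (lebesgue_on {t - h n..t}) \<theta>' /\<^sub>R h n\<bar>)" by blast
    then have E: "E \<longlonglongrightarrow> \<bar>\<theta>' t\<bar>" using tendsto_rabs[OF filterlim_compose[OF elim(4) fl]] by simp
    have "(\<lambda>n. t - h n) \<longlonglongrightarrow> t" using tendsto_diff[OF tendsto_const[of t] h0] by simp
    then have uh: "(\<lambda>n. u (t - h n)) \<longlonglongrightarrow> u t"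
      using continuous_on_tendsto_compose[OF cu, of "\<lambda>n. t - h n" t sequentially] ht elim(1) by auto
    define R where "R = (\<lambda>n. M * (1 + 2 * norm (u (t - h n))))"
    define y where "y = - u' t + g t"
    have R: "R \<longlonglongrightarrow> M * (1 + 2 * norm (u t))" unfolding R_def by (intro tendsto_intros uh)
    have R0: "0 \<le> R n" for n using M0 by (simp add: R_def)
    \<comment> \<open>The defining inequality of \<open>dis\<close>, divided by \<open>h n\<close>.
      At the earlier time the minimal section \<open>y'\<close> replaces the actual value of the
      operator, because it has a bound, \<open>R n\<close>, that converges as \<open>h n\<close>
      tends to 0. Stepping backwards gives \<open>- inner y (D n)\<close>, whose limit contains the
      squared norm of \<open>u' t\<close> with a positive sign.\<close>
    have "- inner y (D n) - R n * norm (D n) \<le> (E n + lam * norm (D n)) * (1 + norm y + R n)" for n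
    proof -
      let ?s = "t - h n"
      define y' where "y' = min_section (B ?s (u ?s)) (u ?s)"
      have dom: "u ?s \<in> op_dom (B ?s (u ?s))" using h(3)[of n] by (auto simp: op_dom_def)
      have y': "y' \<in> B ?s (u ?s) (u ?s)" unfolding y'_def by (rule min_section_mem[OF maxm[OF ht] dom])
      have y'_le: "norm y' \<le> R n" unfolding y'_def R_def using M[OF ht dom] by (simp add: algebra_simps)
      have hn: "0 < h n" by (rule h(1))
      have "inner (y - y') (u ?s - u t) \<le> (\<bar>\<theta> t - \<theta> ?s\<bar> + lam * norm (u t - u ?s)) * (1 + norm y + norm y')"
        by (rule dis_leD[OF dis[OF elim(1) ht]]) (use elim(5) y' in \<open>auto simp: y_def\<close>)
      also have "u ?s - u t = - (h n *\<^sub>R D n)" using hn by (simp add: D_def)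
      also have "\<bar>\<theta> t - \<theta> ?s\<bar> = h n * E n" using hn by (simp add: E_def)
      also have "u t - u ?s = h n *\<^sub>R D n" using hn by (simp add: D_def)
      finally have "h n * (- inner (y - y') (D n)) \<le> h n * ((E n + lam * norm (D n)) * (1 + norm y + norm y'))"
        using hn by (simp add: algebra_simps)
      then have "- inner (y - y') (D n) \<le> (E n + lam * norm (D n)) * (1 + norm y + norm y')"
        using hn by (rule mult_left_le_imp_le)
      also have "\<dots> \<le> (E n + lam * norm (D n)) * (1 + norm y + R n)"
        using y'_le lam hn by (intro mult_left_mono add_nonneg_nonneg) (auto simp: E_def)
      finally have 1: "- inner y (D n) + inner y' (D n) \<le> (E n + lam * norm (D n)) * (1 + norm y + R n)"
        by (simp add: inner_diff_left)
      have "- (R n * norm (D n)) \<le> - (norm y' * norm (D n))" using y'_le by (simp add: mult_right_mono)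
      also have "\<dots> \<le> inner y' (D n)" using Cauchy_Schwarz_ineq2[of y' "D n"] by linarith
      finally show ?thesis using 1 by linarith
    qed
    moreover have "(\<lambda>n. - inner y (D n) - R n * norm (D n)) \<longlonglongrightarrow> - inner y (u' t) - M * (1 + 2 * norm (u t)) * norm (u' t)"
      by (intro tendsto_intros D R)
    moreover have "(\<lambda>n. (E n + lam * norm (D n)) * (1 + norm y + R n)) \<longlonglongrightarrow>
        (\<bar>\<theta>' t\<bar> + lam * norm (u' t)) * (1 + norm y + M * (1 + 2 * norm (u t)))"
      by (intro tendsto_intros D R E)
    ultimately have lim: "- inner y (u' t) - M * (1 + 2 * norm (u t)) * norm (u' t) \<le>
        (\<bar>\<theta>' t\<bar> + lam * norm (u' t)) * (1 + norm y + M * (1 + 2 * norm (u t)))"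
      by (intro LIMSEQ_le) auto
    define p where "p = norm (u' t)"
    define a where "a = norm (g t) + M * (1 + 2 * norm (u t))"
    define \<tau> where "\<tau> = \<bar>\<theta>' t\<bar>"
    have a0: "0 \<le> a" using M0 by (simp add: a_def)
    have p0: "0 \<le> p" and \<tau>0: "0 \<le> \<tau>" by (auto simp: p_def \<tau>_def)
    have "norm y \<le> p + norm (g t)" unfolding y_def p_def by (metis norm_minus_cancel norm_triangle_ineq)
    then have "(\<tau> + lam * p) * (1 + norm y + M * (1 + 2 * norm (u t))) \<le> (\<tau> + lam * p) * (1 + p + a)"
      using lam p0 \<tau>0 by (intro mult_left_mono) (auto simp: a_def)
    moreover have "- inner y (u' t) = p\<^sup>2 - inner (g t) (u' t)"
      by (simp add: y_def p_def inner_diff_left power2_norm_eq_inner)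
    moreover have "inner (g t) (u' t) \<le> norm (g t) * p" unfolding p_def by (rule norm_cauchy_schwarz)
    ultimately have "p\<^sup>2 - a * p \<le> (\<tau> + lam * p) * (1 + p + a)"
      using lim by (simp add: a_def p_def \<tau>_def algebra_simps)
    \<comment> \<open>The quadratic term with factor \<open>lam\<close>, which stems from the state
      dependence of the operator, is moved to the left; \<open>lam < 1\<close> leaves a positive
      coefficient.\<close>
    then have "(1 - lam) * p\<^sup>2 \<le> p * (a + lam * (1 + a) + \<tau>) + (1 + a) * \<tau>"
      by (simp add: algebra_simps power2_eq_square)
    also have "\<dots> \<le> p * (2 * (1 + a + \<tau>)) + (1 + a + \<tau>) * (1 + a + \<tau>)"
    proof -
      have "lam * (1 + a) \<le> 1 * (1 + a)" using lam a0 by (intro mult_right_mono) auto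
      then have "a + lam * (1 + a) + \<tau> \<le> 2 * (1 + a + \<tau>)" using \<tau>0 by auto
      then show ?thesis using p0 a0 \<tau>0 by (intro add_mono[OF mult_left_mono mult_mono]) auto
    qed
    finally have "(1 - lam) * p\<^sup>2 \<le> 2 * p * (1 + a + \<tau>) + (1 + a + \<tau>)\<^sup>2"
      by (simp add: power2_eq_square algebra_simps)
    then have "p \<le> 3 / (1 - lam) * (1 + a + \<tau>)"
      by (rule quadratic_inequality_bound) (use lam p0 a0 \<tau>0 in auto)
    then show ?case by (simp add: p_def a_def \<tau>_def add.assoc)
  qed
qed

section \<open>Mild solutions\<close>

locale bounded_semigroup =
  fixes S :: "real \<Rightarrow> 'e::{real_inner, banach, second_countable_topology} \<Rightarrow>\<^sub>L 'e" and b M :: real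
  assumes C0: "C0_semigroup S" and S_bound: "\<And>t. t \<in> {0..b} \<Longrightarrow> norm (S t) \<le> M" and b_pos: "0 < b"
begin

lemma M_nonneg: "0 \<le> M"
  using order_trans[OF norm_ge_zero S_bound[of 0]] b_pos by auto

lemma S_0 [simp]: "S 0 x = x"
  using C0 by (simp add: C0_semigroup_def)

lemma S_add: "0 \<le> s \<Longrightarrow> 0 \<le> t \<Longrightarrow> S (s + t) x = S s (S t x)"
  using C0 by (simp add: C0_semigroup_def)

lemma norm_S_le: "t \<in> {0..b} \<Longrightarrow> norm (S t x) \<le> M * norm x"
  using norm_blinfun[of "S t" x] S_bound[of t] mult_right_mono[of "norm (S t)" M "norm x"] by force

lemma S_tendsto_0:
  assumes "\<And>n. 0 \<le> h n" "h \<longlonglongrightarrow> 0"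
  shows "(\<lambda>n. S (h n) x) \<longlonglongrightarrow> x"
proof (rule tendstoI)
  fix e :: real assume e: "0 < e"
  have "((\<lambda>t. S t x) \<longlongrightarrow> x) (at_right 0)" using C0 by (simp add: C0_semigroup_def)
  then have "\<forall>\<^sub>F t in at_right 0. dist (S t x) x < e" using e by (rule tendstoD)
  then obtain d where d: "d > 0" "\<And>t. 0 < t \<Longrightarrow> t < d \<Longrightarrow> dist (S t x) x < e"
    by (auto simp: eventually_at_right_field)
  have "\<forall>\<^sub>F n in sequentially. h n < d" using assms(2) d(1) by (rule order_tendstoD)
  then show "\<forall>\<^sub>F n in sequentially. dist (S (h n) x) x < e"
  proof eventually_elim
    case (elim n)
    then show ?case using d(2)[of "h n"] assms(1)[of n] e by (cases "h n = 0") auto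
  qed
qed

lemma S_diff_le:
  assumes "0 \<le> s" "s \<le> t" "t \<le> b"
  shows "norm (S t x - S s x) \<le> M * norm (S (t - s) x - x)"
proof -
  have "S t x = S s (S (t - s) x)"
    using S_add[of s "t - s" x] assms by simp
  then have "S t x - S s x = S s (S (t - s) x - x)"
    by (simp add: blinfun.diff_right)
  then show ?thesis using norm_S_le[of s] assms by simp
qed

lemma S_diff_le_abs:
  assumes "s \<in> {0..b}" "t \<in> {0..b}"
  shows "norm (S t x - S s x) \<le> M * norm (S \<bar>t - s\<bar> x - x)"
proof (cases "s \<le> t")
  case True
  then show ?thesis using S_diff_le[of s t x] assms by auto
next
  case False
  then have "\<bar>t - s\<bar> = s - t" by simp
  then show ?thesis using S_diff_le[of t s x] assms False by (auto simp: norm_minus_commute)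
qed

text \<open>The uniform bound \<open>M\<close> handles the moving vector, and the semigroup law
  reduces the moving time to continuity at 0.\<close>

lemma S_tendsto:
  assumes "\<And>n. t n \<in> {0..b}" "l \<in> {0..b}" "t \<longlonglongrightarrow> l" "x \<longlonglongrightarrow> y"
  shows "(\<lambda>n. S (t n) (x n)) \<longlonglongrightarrow> S l y"
proof -
  have "(\<lambda>n. S \<bar>t n - l\<bar> y) \<longlonglongrightarrow> y"
    by (rule S_tendsto_0) (use tendsto_rabs_zero[OF LIM_zero[OF assms(3)]] in auto)
  then have z: "(\<lambda>n. M * norm (x n - y) + M * norm (S \<bar>t n - l\<bar> y - y)) \<longlonglongrightarrow> M * norm (y - y) + M * norm (y - y)"
    by (intro tendsto_intros assms(4))
  have "(\<lambda>n. S (t n) (x n) - S l y) \<longlonglongrightarrow> 0"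
  proof (rule Lim_null_comparison[OF always_eventually])
    show "(\<lambda>n. M * norm (x n - y) + M * norm (S \<bar>t n - l\<bar> y - y)) \<longlonglongrightarrow> 0" using z by simp
    show "\<forall>n. norm (S (t n) (x n) - S l y) \<le> M * norm (x n - y) + M * norm (S \<bar>t n - l\<bar> y - y)"
    proof
      fix n
      have "S (t n) (x n) - S l y =
          S (t n) (x n - y) + (S (t n) y - S l y)"
        by (simp add: blinfun.diff_right)
      also have "norm \<dots> \<le> norm (S (t n) (x n - y)) + norm (S (t n) y - S l y)"
        by (rule norm_triangle_ineq)
      also have "\<dots> \<le> M * norm (x n - y) + M * norm (S \<bar>t n - l\<bar> y - y)"
        by (intro add_mono norm_S_le S_diff_le_abs assms)
      finally show "norm (S (t n) (x n) - S l y) \<le> M * norm (x n - y) + M * norm (S \<bar>t n - l\<bar> y - y)" .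
    qed
  qed
  then show ?thesis by (rule LIM_zero_cancel)
qed

section \<open>Convolution with the semigroup\<close>

lemma convolution_measurable:
  assumes h: "h \<in> borel_measurable (lebesgue_on {p..q})" and "t - q \<ge> 0" "t - p \<le> b"
  shows "(\<lambda>s. S (t - s) (h s)) \<in> borel_measurable (lebesgue_on {p..q})"
proof -
  \<comment> \<open>Evaluation of the semigroup is jointly continuous on a closed set of times and
    vectors, so its extension by 0 is Borel. The assumptions on \<open>p\<close> and
    \<open>q\<close> keep \<open>t - s\<close> in \<open>{0..b}\<close>, where the extension changes
    nothing.\<close>
  define k where "k = (\<lambda>z. if z \<in> {0..b} \<times> (UNIV :: 'e set) then (\<lambda>z. S (fst z) (snd z)) z else 0)"
  have "continuous_on ({0..b} \<times> UNIV) (\<lambda>z. S (fst z) (snd z))"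
    unfolding continuous_on_sequentially
  proof (intro allI ballI impI)
    fix z a assume "a \<in> {0..b} \<times> UNIV" and z: "(\<forall>n. z n \<in> {0..b} \<times> (UNIV :: 'e set)) \<and> z \<longlonglongrightarrow> a"
    then show "((\<lambda>z. S (fst z) (snd z)) \<circ> z) \<longlonglongrightarrow> S (fst a) (snd a)"
      unfolding o_def by (intro S_tendsto tendsto_fst tendsto_snd) (auto simp: mem_Times_iff)
  qed
  then have "k \<in> borel_measurable borel"
    unfolding k_def by (intro borel_measurable_continuous_on_if) (auto intro!: closed_Times borel_closed)
  moreover have "(\<lambda>s. (t - s, h s)) \<in> borel_measurable (lebesgue_on {p..q})"
    using h by (intro borel_measurable_Pair) (auto intro!: borel_measurable_diff measurable_restrict_space1 measurable_completion)
  ultimately have "(\<lambda>s. k (t - s, h s)) \<in> borel_measurable (lebesgue_on {p..q})"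
    by (rule measurable_compose[rotated])
  then show ?thesis
    by (rule measurable_lebesgue_cong[THEN iffD1, rotated]) (use assms in \<open>auto simp: k_def\<close>)
qed

lemma convolution_bound:
  assumes h: "integrable (\<L> b) h" and \<psi>: "integrable (\<L> b) \<psi>"
    and le: "AE s in \<L> b. norm (h s) \<le> \<psi> s" and "0 \<le> p" "p \<le> q" "q \<le> t" "t \<le> b"
  shows "integrable (lebesgue_on {p..q}) (\<lambda>s. S (t - s) (h s))"
    "norm (integral\<^sup>L (lebesgue_on {p..q}) (\<lambda>s. S (t - s) (h s))) \<le> M * integral\<^sup>L (lebesgue_on {p..q}) \<psi>"
proof -
  have sub: "{p..q} \<subseteq> {0..b}" using assms by auto
  have "integrable (lebesgue_on {p..q}) h" by (rule lebesgue_on_subinterval[OF h sub])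
  then have m: "(\<lambda>s. S (t - s) (h s)) \<in> borel_measurable (lebesgue_on {p..q})"
    using assms by (intro convolution_measurable) auto
  have M\<psi>: "integrable (\<L> b) (\<lambda>s. M * \<psi> s)" using \<psi> by simp
  have "AE s in lebesgue_on {p..q}. norm (h s) \<le> \<psi> s" by (rule AE_lebesgue_on_subset[OF le sub]) auto
  moreover have "AE s in lebesgue_on {p..q}. s \<in> {p..q}" using AE_space[of "lebesgue_on {p..q}"] by simp
  ultimately have ae: "AE s in lebesgue_on {p..q}. norm (S (t - s) (h s)) \<le> M * \<psi> s"
  proof eventually_elim
    case (elim s)
    have "norm (S (t - s) (h s)) \<le> M * norm (h s)" using elim assms by (intro norm_S_le) auto
    also have "\<dots> \<le> M * \<psi> s" using elim M_nonneg by (intro mult_left_mono) auto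
    finally show ?case .
  qed
  show "integrable (lebesgue_on {p..q}) (\<lambda>s. S (t - s) (h s))"
    by (rule norm_integral_lebesgue_on_le(1)[OF m sub M\<psi> ae])
  show "norm (integral\<^sup>L (lebesgue_on {p..q}) (\<lambda>s. S (t - s) (h s))) \<le> M * integral\<^sup>L (lebesgue_on {p..q}) \<psi>"
    using norm_integral_lebesgue_on_le(2)[OF m sub M\<psi> ae] by simp
qed

text \<open>Compactness of the semigroup acts on states only through a positive time lag. Restarting
  from an earlier time \<open>q\<close> exposes the factor \<open>S (t - q)\<close>, and the
  remainder is an integral over the interval from \<open>q\<close> to \<open>t\<close>, which may be
  taken short.\<close>

lemma mild_restart:
  assumes x: "\<And>t. t \<in> {0..b} \<Longrightarrow> x t = S t x0 + integral\<^sup>L (\<L> t) (\<lambda>s. S (t - s) (h s))"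
    and h: "integrable (\<L> b) h" and "0 \<le> q" "q \<le> t" "t \<le> b"
  shows "x t = S (t - q) (x q) + integral\<^sup>L (lebesgue_on {q..t}) (\<lambda>s. S (t - s) (h s))"
proof -
  have hn: "integrable (\<L> b) (\<lambda>s. norm (h s))" using h by simp
  have i: "integrable (lebesgue_on {p..q}) (\<lambda>s. S (t - s) (h s))"
    if "0 \<le> p" "p \<le> q" "q \<le> t" "t \<le> b" for p q t
    by (rule convolution_bound(1)[OF h hn _ that]) simp
  have "integral\<^sup>L (\<L> t) (\<lambda>s. S (t - s) (h s)) =
      integral\<^sup>L (\<L> q) (\<lambda>s. S (t - s) (h s)) + integral\<^sup>L (lebesgue_on {q..t}) (\<lambda>s. S (t - s) (h s))"
    by (rule integral_lebesgue_on_split[OF i]) (use assms in auto)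
  also have "integral\<^sup>L (\<L> q) (\<lambda>s. S (t - s) (h s)) =
      integral\<^sup>L (\<L> q) (\<lambda>s. S (t - q) (S (q - s) (h s)))"
  proof (rule Bochner_Integration.integral_cong[OF refl])
    fix s assume "s \<in> space (\<L> q)"
    then show "S (t - s) (h s) = S (t - q) (S (q - s) (h s))"
      using S_add[of "t - q" "q - s" "h s"] assms by simp
  qed
  also have "\<dots> = S (t - q) (integral\<^sup>L (\<L> q) (\<lambda>s. S (q - s) (h s)))"
    by (rule integral_bounded_linear[OF blinfun.bounded_linear_right i]) (use assms in auto)
  finally have "integral\<^sup>L (\<L> t) (\<lambda>s. S (t - s) (h s)) =
      S (t - q) (integral\<^sup>L (\<L> q) (\<lambda>s. S (q - s) (h s))) +
      integral\<^sup>L (lebesgue_on {q..t}) (\<lambda>s. S (t - s) (h s))" .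
  moreover have "S t x0 = S (t - q) (S q x0)"
    using S_add[of "t - q" q x0] assms by simp
  ultimately show ?thesis using x[of t] x[of q] assms by (simp add: blinfun.add_right)
qed

text \<open>The semigroup law writes \<open>S (t - s) y - S (q - s) y\<close> as
  \<open>S (q - s)\<close> applied to \<open>S (t - q) y - y\<close>, so the modulus
  \<open>Q\<close> depends on \<open>t - q\<close> alone. Dominated convergence makes
  \<open>Q\<close> vanish at 0, and what is left is an integral over a short interval.\<close>

lemma mild_continuous_on:
  assumes x: "\<And>t. t \<in> {0..b} \<Longrightarrow> x t = S t x0 + integral\<^sup>L (\<L> t) (\<lambda>s. S (t - s) (h s))"
    and h: "integrable (\<L> b) h"
  shows "continuous_on {0..b} x"
proof -
  have hn: "integrable (\<L> b) (\<lambda>s. norm (h s))" using h by simp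
  have i: "integrable (lebesgue_on {p..q}) (\<lambda>s. S (t - s) (h s))"
    if "0 \<le> p" "p \<le> q" "q \<le> t" "t \<le> b" for p q t
    by (rule convolution_bound(1)[OF h hn _ that]) simp
  have hm[measurable]: "h \<in> borel_measurable (\<L> b)" using h by simp
  have Sm[measurable]: "(\<lambda>s. S d (h s)) \<in> borel_measurable (\<L> b)" for d
    by (rule measurable_compose[OF hm]) (intro borel_measurable_continuous_onI linear_continuous_on blinfun.bounded_linear_right)
  have dom: "norm (S d (h s) - h s) \<le> (M + 1) * norm (h s)" if "d \<in> {0..b}" for d s
    using norm_S_le[OF that, of "h s"] norm_triangle_ineq4[of "S d (h s)" "h s"] by (simp add: distrib_right)
  have Si: "integrable (\<L> b) (\<lambda>s. norm (S d (h s) - h s))" if "d \<in> {0..b}" for d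
    by (rule norm_integral_le_AE(1)[where g = "\<lambda>s. (M + 1) * norm (h s)"]) (use hn dom[OF that] in auto)
  define Q where "Q = (\<lambda>d. M * norm (S d x0 - x0) + M * integral\<^sup>L (\<L> b) (\<lambda>s. norm (S d (h s) - h s)))"
  have key: "norm (x t - x q) \<le> Q (t - q) + M * integral\<^sup>L (lebesgue_on {q..t}) (\<lambda>s. norm (h s))"
    if q: "0 \<le> q" "q \<le> t" "t \<le> b" for q t
  proof -
    have 1: "integral\<^sup>L (\<L> t) (\<lambda>s. S (t - s) (h s)) =
      integral\<^sup>L (\<L> q) (\<lambda>s. S (t - s) (h s)) + integral\<^sup>L (lebesgue_on {q..t}) (\<lambda>s. S (t - s) (h s))"
      by (rule integral_lebesgue_on_split[OF i]) (use q in auto)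
    have 2: "norm (integral\<^sup>L (\<L> q) (\<lambda>s. S (t - s) (h s)) - integral\<^sup>L (\<L> q) (\<lambda>s. S (q - s) (h s)))
        \<le> M * integral\<^sup>L (\<L> b) (\<lambda>s. norm (S (t - q) (h s) - h s))"
    proof -
      have d: "t - q \<in> {0..b}" using q by auto
      have sub: "{0..q} \<subseteq> {0..b}" using q by auto
      have "integral\<^sup>L (\<L> q) (\<lambda>s. S (t - s) (h s)) - integral\<^sup>L (\<L> q) (\<lambda>s. S (q - s) (h s))
        = integral\<^sup>L (\<L> q) (\<lambda>s. S (t - s) (h s) - S (q - s) (h s))"
        by (rule Bochner_Integration.integral_diff[symmetric]; rule i) (use q in auto)
      also have "norm \<dots> \<le> integral\<^sup>L (\<L> q) (\<lambda>s. M * norm (S (t - q) (h s) - h s))"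
      proof (rule norm_integral_le_AE(2))
        show "(\<lambda>s. S (t - s) (h s) - S (q - s) (h s)) \<in> borel_measurable (\<L> q)"
          using i[of 0 q t] i[of 0 q q] q by (intro borel_measurable_diff) auto
        show "integrable (\<L> q) (\<lambda>s. M * norm (S (t - q) (h s) - h s))"
          using lebesgue_on_subinterval[OF Si[OF d] sub] by simp
        show "AE s in \<L> q. norm (S (t - s) (h s) - S (q - s) (h s)) \<le> M * norm (S (t - q) (h s) - h s)"
        proof (rule AE_I2)
          fix s assume "s \<in> space (\<L> q)"
          then show "norm (S (t - s) (h s) - S (q - s) (h s)) \<le> M * norm (S (t - q) (h s) - h s)"
            using S_diff_le[of "q - s" "t - s" "h s"] q by simp
        qed
      qed
      also have "\<dots> = M * integral\<^sup>L (\<L> q) (\<lambda>s. norm (S (t - q) (h s) - h s))" by simp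
      also have "\<dots> \<le> M * integral\<^sup>L (\<L> b) (\<lambda>s. norm (S (t - q) (h s) - h s))"
        by (intro mult_left_mono integral_lebesgue_on_mono_set Si[OF d] M_nonneg sub) simp
      finally show ?thesis .
    qed
    have 3: "norm (integral\<^sup>L (lebesgue_on {q..t}) (\<lambda>s. S (t - s) (h s))) \<le> M * integral\<^sup>L (lebesgue_on {q..t}) (\<lambda>s. norm (h s))"
      by (rule convolution_bound(2)[OF h hn]) (use q in auto)
    have 4: "norm (S t x0 - S q x0) \<le> M * norm (S (t - q) x0 - x0)"
      by (rule S_diff_le[OF q])
    have "x t - x q = (S t x0 - S q x0) +
       (integral\<^sup>L (\<L> q) (\<lambda>s. S (t - s) (h s)) - integral\<^sup>L (\<L> q) (\<lambda>s. S (q - s) (h s)))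
       + integral\<^sup>L (lebesgue_on {q..t}) (\<lambda>s. S (t - s) (h s))"
      using x[of t] x[of q] q 1 by simp
    also have "norm \<dots> \<le> M * norm (S (t - q) x0 - x0) +
       M * integral\<^sup>L (\<L> b) (\<lambda>s. norm (S (t - q) (h s) - h s))
       + M * integral\<^sup>L (lebesgue_on {q..t}) (\<lambda>s. norm (h s))"
      by (intro norm_triangle_le add_mono 2 3 4)
    finally show ?thesis by (simp add: Q_def)
  qed
  have Q0: "(\<lambda>n. Q (d n)) \<longlonglongrightarrow> 0" if "\<And>n. d n \<in> {0..b}" "d \<longlonglongrightarrow> 0" for d
  proof -
    have s0: "(\<lambda>n. S (d n) y) \<longlonglongrightarrow> y" for y by (rule S_tendsto_0) (use that in auto)
    have "(\<lambda>n. integral\<^sup>L (\<L> b) (\<lambda>s. norm (S (d n) (h s) - h s))) \<longlonglongrightarrow> integral\<^sup>L (\<L> b) (\<lambda>s. norm (h s - h s))"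
    proof (rule integral_dominated_convergence[where w = "\<lambda>s. (M + 1) * norm (h s)"])
      show "AE s in \<L> b. (\<lambda>n. norm (S (d n) (h s) - h s)) \<longlonglongrightarrow> norm (h s - h s)"
        by (intro AE_I2 tendsto_intros s0)
    qed (use hn dom[OF that(1)] in auto)
    then have "(\<lambda>n. Q (d n)) \<longlonglongrightarrow> M * norm (x0 - x0) + M * integral\<^sup>L (\<L> b) (\<lambda>s. norm (h s - h s))"
      unfolding Q_def by (intro tendsto_intros s0)
    then show ?thesis by simp
  qed
  show ?thesis
    unfolding continuous_on_sequentially o_def
  proof (intro allI ballI impI)
    fix t l assume l: "l \<in> {0..b}" and "(\<forall>n. t n \<in> {0..b}) \<and> t \<longlonglongrightarrow> l"
    then have t: "\<And>n. t n \<in> {0..b}" "t \<longlonglongrightarrow> l" by auto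
    have d0: "(\<lambda>n. \<bar>t n - l\<bar>) \<longlonglongrightarrow> 0" using tendsto_rabs_zero[OF LIM_zero[OF t(2)]] .
    have "(\<lambda>n. Q \<bar>t n - l\<bar>) \<longlonglongrightarrow> 0" by (rule Q0[OF _ d0]) (use t(1) l in \<open>auto simp: abs_le_iff; smt (verit) atLeastAtMost_iff\<close>)
    show "(\<lambda>n. x (t n)) \<longlonglongrightarrow> x l"
    proof (rule tendstoI)
      fix e :: real assume e: "0 < e"
      have e': "0 < e / (2 * (M + 1))" using e M_nonneg by simp
      obtain d where d: "d > 0" "\<And>s t. 0 \<le> s \<Longrightarrow> s \<le> t \<Longrightarrow> t \<le> b \<Longrightarrow> t - s < d \<Longrightarrow> integral\<^sup>L (lebesgue_on {s..t}) (\<lambda>s. norm (h s)) < e / (2 * (M + 1))"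
        using small_integral_on_short_intervals[OF hn e'] by metis
      have small: "M * integral\<^sup>L (lebesgue_on {p..q}) (\<lambda>s. norm (h s)) \<le> e / 2" if "0 \<le> p" "p \<le> q" "q \<le> b" "q - p < d" for p q
      proof -
        have "M * integral\<^sup>L (lebesgue_on {p..q}) (\<lambda>s. norm (h s)) \<le> (M + 1) * (e / (2 * (M + 1)))"
          using d(2)[OF that] M_nonneg by (intro mult_mono) auto
        also have "\<dots> = e / 2" using M_nonneg by (simp add: field_simps)
        finally show ?thesis .
      qed
      have "\<forall>\<^sub>F n in sequentially. Q \<bar>t n - l\<bar> < e / 2" using \<open>(\<lambda>n. Q \<bar>t n - l\<bar>) \<longlonglongrightarrow> 0\<close> by (rule order_tendstoD) (use e in simp)
      moreover have "\<forall>\<^sub>F n in sequentially. \<bar>t n - l\<bar> < d" using d0 d(1) by (rule order_tendstoD)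
      ultimately show "\<forall>\<^sub>F n in sequentially. dist (x (t n)) (x l) < e"
      proof eventually_elim
        case (elim n)
        show ?case
        proof (cases "l \<le> t n")
          case True
          then show ?thesis using key[of l "t n"] small[of l "t n"] elim t(1)[of n] l by (auto simp: dist_norm)
        next
          case False
          then have "\<bar>t n - l\<bar> = l - t n" by simp
          then show ?thesis using False key[of "t n" l] small[of "t n" l] elim t(1)[of n] l by (auto simp: dist_norm norm_minus_commute)
        qed
      qed
    qed
  qed
qed

end

section \<open>Limits of convex combinations of selections\<close>

lemma convex_infdist_less:
  fixes A :: "'a::real_normed_vector set"
  assumes "convex A" "A \<noteq> {}"
  shows "convex {z. infdist z A < e}"
proof -
  have "{z. infdist z A < e} = (\<Union>a\<in>A. \<Union>v\<in>ball 0 e. {a + v})"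
  proof (intro equalityI subsetI)
    fix z assume "z \<in> {z. infdist z A < e}"
    then have "(INF a\<in>A. dist z a) < e" using assms(2) by (simp add: infdist_def)
    then obtain a where "a \<in> A" "dist z a < e" using assms(2) by (auto simp: cINF_less_iff)
    then show "z \<in> (\<Union>a\<in>A. \<Union>v\<in>ball 0 e. {a + v})"
      by (intro UN_I[of a] UN_I[of "z - a"]) (auto simp: dist_norm norm_minus_commute)
  next
    fix z assume "z \<in> (\<Union>a\<in>A. \<Union>v\<in>ball 0 e. {a + v})"
    then obtain a v where "a \<in> A" "norm v < e" "z = a + v" by auto
    then show "z \<in> {z. infdist z A < e}" using infdist_le[of a A z] by (simp add: dist_norm)
  qed
  then show ?thesis using convex_sums[OF assms(1) convex_ball[of 0 e]] by simp
qed

lemma Haus_infdist_le: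
  assumes "Haus A A' \<le> ereal e" "a \<in> A"
  shows "infdist a A' \<le> e"
proof -
  have "ereal (infdist a A') \<le> (SUP s\<in>A. ereal (infdist s A'))" using assms(2) by (rule SUP_upper)
  also have "\<dots> \<le> Haus A A'" by (simp add: Haus_def)
  finally show ?thesis using assms(1) by (metis ereal_less_eq(3) order_trans)
qed

lemma set_norm_leD: "set_norm A \<le> ereal c \<Longrightarrow> a \<in> A \<Longrightarrow> norm a \<le> c"
  unfolding set_norm_def by (metis SUP_upper ereal_less_eq(3) order_trans)

lemma tail_weights_limit_in_closure:
  fixes p :: "nat \<Rightarrow> 'a::real_normed_vector"
  assumes c: "\<And>n. tail_weights n (N n) (c n)" and l: "(\<lambda>n. \<Sum>k\<le>N n. c n k *\<^sub>R p k) \<longlonglongrightarrow> l"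
    and A: "convex A" and ev: "eventually (\<lambda>k. p k \<in> A) sequentially"
  shows "l \<in> closure A"
proof -
  obtain m where m: "\<And>k. k \<ge> m \<Longrightarrow> p k \<in> A" using ev by (auto simp: eventually_sequentially)
  have "(\<Sum>k\<le>N n. c n k *\<^sub>R p k) \<in> A" if "n \<ge> m" for n
    using tail_weights_sum_in_convex[OF c A, of n p] m that by auto
  then have "eventually (\<lambda>n. (\<Sum>k\<le>N n. c n k *\<^sub>R p k) \<in> closure A) sequentially"
    using closure_subset by (auto simp: eventually_sequentially)
  then show ?thesis by (rule Lim_in_closed_set[OF closed_closure _ _ l]) simp
qed

text \<open>The neighbourhood of radius \<open>e\<close> around a convex set is convex. The sequence
  enters it eventually, so the averages stay in it from then on and their limit lies in its
  closure.\<close>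

lemma tail_weights_limit_in_closed_convex:
  fixes p :: "nat \<Rightarrow> 'a::real_normed_vector"
  assumes c: "\<And>n. tail_weights n (N n) (c n)" and l: "(\<lambda>n. \<Sum>k\<le>N n. c n k *\<^sub>R p k) \<longlonglongrightarrow> l"
    and A: "convex A" "closed A" "A \<noteq> {}" and d: "(\<lambda>k. infdist (p k) A) \<longlonglongrightarrow> 0"
  shows "l \<in> A"
proof -
  have "infdist l A \<le> e" if "0 < e" for e
  proof -
    have "eventually (\<lambda>k. p k \<in> {z. infdist z A < e}) sequentially"
      using order_tendstoD(2)[OF d that] by simp
    then have "l \<in> closure {z. infdist z A < e}"
      by (rule tail_weights_limit_in_closure[OF c l convex_infdist_less[OF A(1,3)]])
    moreover have "closure {z. infdist z A < e} \<subseteq> {z. infdist z A \<le> e}"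
      by (rule closure_minimal) (auto intro!: closed_Collect_le continuous_intros)
    ultimately show ?thesis by auto
  qed
  then have "infdist l A = 0" by (metis dense_ge infdist_nonneg order_antisym)
  then show ?thesis using A in_closed_iff_infdist_zero by blast
qed

lemma tail_weights_limit_in_Lipschitz_multifunction:
  fixes p :: "nat \<Rightarrow> 'a::real_normed_vector" and x :: "nat \<Rightarrow> 'e::real_normed_vector" and u :: "nat \<Rightarrow> 'h::real_normed_vector"
  assumes c: "\<And>n. tail_weights n (N n) (c n)" and l: "(\<lambda>n. \<Sum>k\<le>N n. c n k *\<^sub>R p k) \<longlonglongrightarrow> l"
    and A: "convex (A xl ul)" "closed (A xl ul)" "A xl ul \<noteq> {}"
    and lip: "\<And>x u. Haus (A x u) (A xl ul) \<le> ereal (L * (norm (x - xl) + norm (u - ul)))"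
    and p: "\<And>k. p k \<in> A (x k) (u k)" and "x \<longlonglongrightarrow> xl" "u \<longlonglongrightarrow> ul"
  shows "l \<in> A xl ul"
proof (rule tail_weights_limit_in_closed_convex[OF c l A])
  have "(\<lambda>k. L * (norm (x k - xl) + norm (u k - ul))) \<longlonglongrightarrow> L * (norm (xl - xl) + norm (ul - ul))"
    by (intro tendsto_intros assms)
  then have z: "(\<lambda>k. L * (norm (x k - xl) + norm (u k - ul))) \<longlonglongrightarrow> 0" by simp
  show "(\<lambda>k. infdist (p k) (A xl ul)) \<longlonglongrightarrow> 0"
    by (rule tendsto_sandwich[OF _ _ tendsto_const z])
       (auto intro!: always_eventually infdist_nonneg Haus_infdist_le[OF lip p])
qed

text \<open>Against a fixed pair \<open>(v, y')\<close> of the graph of \<open>B ul\<close>, the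
  values \<open>y k\<close> violate monotonicity by at most two errors: the pseudo-distance of
  \<open>B (u k)\<close> and \<open>B ul\<close>, and the cost of replacing \<open>u k\<close> by
  \<open>ul\<close>. Both vanish because the \<open>y k\<close> are bounded by \<open>R\<close>.
  Hence the \<open>y k\<close> eventually enter each slightly enlarged half-space, and this survives
  averaging.\<close>

lemma tail_weights_limit_in_maximal_monotone:
  fixes y :: "nat \<Rightarrow> 'h::{real_inner, banach}"
  assumes c: "\<And>n. tail_weights n (N n) (c n)" and l: "(\<lambda>n. \<Sum>k\<le>N n. c n k *\<^sub>R y k) \<longlonglongrightarrow> l"
    and maxm: "maximal_monotone (B ul)"
    and dis: "\<And>v. dis (B v) (B ul) \<le> ereal (lam * norm (v - ul))"
    and y: "\<And>k. y k \<in> B (u k) (u k)" and bd: "\<And>k. norm (y k) \<le> R" and u: "u \<longlonglongrightarrow> ul"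
  shows "l \<in> B ul ul"
  unfolding maximal_monotone_mem_iff[OF maxm]
proof (intro allI ballI)
  fix v y' assume y': "y' \<in> B ul v"
  have "inner (v - ul) l \<le> inner (v - ul) y' + e" if e: "0 < e" for e
  proof -
    have le: "inner (v - ul) (y k) - inner (v - ul) y' \<le>
        lam * norm (u k - ul) * (1 + norm (y k) + norm y') + norm (u k - ul) * (R + norm y')" for k
    proof -
      have "inner (y k - y') (v - u k) \<le> lam * norm (u k - ul) * (1 + norm (y k) + norm y')"
        by (rule dis_leD[OF dis y y'])
      moreover have "inner (y k - y') (u k - ul) \<le> norm (u k - ul) * (R + norm y')"
      proof -
        have "inner (y k - y') (u k - ul) \<le> norm (y k - y') * norm (u k - ul)" by (rule norm_cauchy_schwarz)
        also have "\<dots> \<le> (R + norm y') * norm (u k - ul)"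
          using bd[of k] norm_triangle_ineq4[of "y k" y'] by (intro mult_right_mono) auto
        finally show ?thesis by (simp add: mult.commute)
      qed
      moreover have "inner (v - ul) (y k) - inner (v - ul) y' = inner (y k - y') (v - u k) + inner (y k - y') (u k - ul)"
        by (simp add: inner_diff_left inner_diff_right inner_commute)
      ultimately show ?thesis by linarith
    qed
    have "eventually (\<lambda>k. y k \<in> {z. inner (v - ul) z \<le> inner (v - ul) y' + e}) sequentially"
    proof -
      have "(\<lambda>k. \<bar>lam\<bar> * norm (u k - ul) * (1 + R + norm y') + norm (u k - ul) * (R + norm y')) \<longlonglongrightarrow>
          \<bar>lam\<bar> * norm (ul - ul) * (1 + R + norm y') + norm (ul - ul) * (R + norm y')"
        by (intro tendsto_intros u)
      then have "(\<lambda>k. \<bar>lam\<bar> * norm (u k - ul) * (1 + R + norm y') + norm (u k - ul) * (R + norm y')) \<longlonglongrightarrow> 0" by simp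
      from order_tendstoD(2)[OF this e] show ?thesis
      proof eventually_elim
        case (elim k)
        have "lam * norm (u k - ul) * (1 + norm (y k) + norm y') \<le> \<bar>lam\<bar> * norm (u k - ul) * (1 + R + norm y')"
          using bd[of k] by (intro mult_mono) (auto intro: mult_right_mono)
        then show ?case using le[of k] elim by simp
      qed
    qed
    from tail_weights_limit_in_closure[OF c l convex_halfspace_le this]
    show ?thesis using closure_closed[OF closed_halfspace_le] by auto
  qed
  then have "inner (v - ul) l \<le> inner (v - ul) y'" by (rule field_le_epsilon)
  then show "0 \<le> inner (l - y') (ul - v)"
    by (simp add: inner_diff_left inner_diff_right inner_commute)
qed

text \<open>The averages of the integrals have two limits that must agree: dominated convergence
  gives the integral of \<open>pl\<close>, and averages of tails of a convergent sequence tend to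
  \<open>L\<close>. This is how the integral equations pass to the limit.\<close>

lemma integral_of_tail_convex_combination_limit:
  fixes p :: "nat \<Rightarrow> 'a \<Rightarrow> 'b::{banach, second_countable_topology}"
  assumes c: "\<And>n. tail_weights n (N n) (c n)"
    and p: "\<And>k. p k \<in> borel_measurable M" "pl \<in> borel_measurable M"
    and \<Psi>: "integrable M \<Psi>" "\<And>k. AE t in M. norm (p k t) \<le> \<Psi> t"
    and l: "AE t in M. (\<lambda>n. \<Sum>k\<le>N n. c n k *\<^sub>R p k t) \<longlonglongrightarrow> pl t"
    and L: "(\<lambda>k. integral\<^sup>L M (p k)) \<longlonglongrightarrow> L"
  shows "integral\<^sup>L M pl = L"
proof -
  have pi: "integrable M (p k)" for k by (rule norm_integral_le_AE(1)[OF p(1) \<Psi>])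
  have "(\<lambda>n. \<integral>t. (\<Sum>k\<le>N n. c n k *\<^sub>R p k t) \<partial>M) \<longlonglongrightarrow> integral\<^sup>L M pl"
    by (rule integral_dominated_convergence[OF p(2) _ \<Psi>(1) l AE_norm_sum_le[OF c \<Psi>(2)]])
       (use p(1) in measurable)
  then have "(\<lambda>n. \<Sum>k\<le>N n. c n k *\<^sub>R integral\<^sup>L M (p k)) \<longlonglongrightarrow> integral\<^sup>L M pl"
    using pi by simp
  moreover have "(\<lambda>n. \<Sum>k\<le>N n. c n k *\<^sub>R integral\<^sup>L M (p k)) \<longlonglongrightarrow> L"
    by (rule tail_weights_sum_tendsto[OF c L])
  ultimately show ?thesis by (rule LIMSEQ_unique)
qed

lemma Cauchy_of_approximations:
  fixes s :: "nat \<Rightarrow> 'a::metric_space"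
  assumes "\<And>e. 0 < e \<Longrightarrow> \<exists>y. Cauchy y \<and> (\<forall>n. dist (s n) (y n) \<le> e)"
  shows "Cauchy s"
proof (rule metric_CauchyI)
  fix e :: real assume e: "0 < e"
  then obtain y where y: "Cauchy y" "\<And>n. dist (s n) (y n) \<le> e / 4" using assms[of "e / 4"] by auto
  obtain m where m: "\<And>i j. i \<ge> m \<Longrightarrow> j \<ge> m \<Longrightarrow> dist (y i) (y j) < e / 4"
    using metric_CauchyD[OF y(1), of "e / 4"] e by auto
  have "dist (s i) (s j) < e" if "i \<ge> m" "j \<ge> m" for i j
  proof -
    have "dist (s i) (s j) \<le> dist (s i) (y i) + dist (y i) (s j)" by (rule dist_triangle)
    also have "dist (y i) (s j) \<le> dist (y i) (y j) + dist (s j) (y j)" by (rule dist_triangle2)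
    finally show ?thesis using y(2)[of i] y(2)[of j] m[OF that] e by linarith
  qed
  then show "\<exists>M. \<forall>m\<ge>M. \<forall>n\<ge>M. dist (s m) (s n) < e" by blast
qed

section \<open>Square integrable functions\<close>

lemma L2_on_add:
  fixes f g :: "real \<Rightarrow> 'a::{real_inner, second_countable_topology}"
  assumes "L2_on b f" "L2_on b g"
  shows "L2_on b (\<lambda>t. f t + g t)"
proof -
  have m[measurable]: "f \<in> borel_measurable (\<L> b)" "g \<in> borel_measurable (\<L> b)"
    using assms by (auto simp: L2_on_def)
  have "integrable (\<L> b) (\<lambda>t. (norm (f t + g t))\<^sup>2)"
  proof (rule norm_integral_le_AE(1))
    show "integrable (\<L> b) (\<lambda>t. 2 * (norm (f t))\<^sup>2 + 2 * (norm (g t))\<^sup>2)"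
      using assms by (simp add: L2_on_def)
    have "(norm (x + y))\<^sup>2 + (norm (x - y))\<^sup>2 = 2 * (norm x)\<^sup>2 + 2 * (norm y)\<^sup>2" for x y :: 'a
      by (simp add: power2_norm_eq_inner inner_diff_left inner_diff_right inner_add_left inner_add_right)
    then have "(norm (x + y))\<^sup>2 \<le> 2 * (norm x)\<^sup>2 + 2 * (norm y)\<^sup>2" for x y :: 'a
      by (smt (verit) zero_le_power2)
    then show "AE t in \<L> b. norm ((norm (f t + g t))\<^sup>2) \<le> 2 * (norm (f t))\<^sup>2 + 2 * (norm (g t))\<^sup>2"
      by simp
  qed measurable
  then show ?thesis by (simp add: L2_on_def)
qed

lemma L2_on_const: "L2_on b (\<lambda>t. c :: real)"
proof -
  have "finite_measure (\<L> b)" by (rule finite_measure_lebesgue_on) simp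
  then show ?thesis by (simp add: L2_on_def finite_measure.integrable_const)
qed

lemma L2_on_abs_mult: "L2_on b f \<Longrightarrow> L2_on b (\<lambda>t. (c::real) * \<bar>f t :: real\<bar>)"
  by (auto simp: L2_on_def power_mult_distrib)

lemma L2_on_dominated:
  fixes f :: "real \<Rightarrow> 'a::{real_inner, banach, second_countable_topology}"
  assumes "f \<in> borel_measurable (\<L> b)" "L2_on b (\<psi> :: real \<Rightarrow> real)" "AE t in \<L> b. norm (f t) \<le> \<psi> t"
  shows "L2_on b f"
proof -
  note [measurable] = assms(1)
  have "integrable (\<L> b) (\<lambda>t. (norm (f t))\<^sup>2)"
  proof (rule norm_integral_le_AE(1))
    show "integrable (\<L> b) (\<lambda>t. (\<psi> t)\<^sup>2)" using assms(2) by (simp add: L2_on_def)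
    show "AE t in \<L> b. norm ((norm (f t))\<^sup>2) \<le> (\<psi> t)\<^sup>2"
      using assms(3) by eventually_elim (simp add: power_mono)
  qed measurable
  then show ?thesis using assms(1) by (simp add: L2_on_def)
qed

section \<open>A priori bounds and compactness\<close>

text \<open>One parameter pair is frozen, and the constants that the hypotheses provide for it are
  named. Here \<open>\<phi>\<close> is the common bound of the controls, not the terminal
  cost.\<close>

locale controlled_evolution = bounded_semigroup S b M
  for S :: "real \<Rightarrow> 'e::{real_inner, banach, second_countable_topology} \<Rightarrow>\<^sub>L 'e" and b M :: real +
  fixes B :: "real \<Rightarrow> 'h::{real_inner, banach, second_countable_topology} \<Rightarrow> 'h \<Rightarrow> 'h set"
    and F :: "real \<Rightarrow> 'e \<Rightarrow> 'h \<Rightarrow> 'e set" and G :: "real \<Rightarrow> 'e \<Rightarrow> 'h \<Rightarrow> 'h set"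
    and K :: "'y::{real_inner, banach, second_countable_topology} \<Rightarrow>\<^sub>L 'e"
    and x0 :: 'e and u0 :: 'h
    and \<theta> \<theta>' \<phi> kF kG :: "real \<Rightarrow> real" and lam MB MF MG :: real
  assumes S_compact: "\<And>t. 0 < t \<Longrightarrow> compact_operator (S t)"
    and maxm: "\<And>t v. t \<in> {0..b} \<Longrightarrow> maximal_monotone (B t v)"
    and dis: "\<And>t s v w. t \<in> {0..b} \<Longrightarrow> s \<in> {0..b} \<Longrightarrow> dis (B t v) (B s w) \<le> ereal (\<bar>\<theta> t - \<theta> s\<bar> + lam * norm (v - w))"
    and lam: "0 \<le> lam" "lam < 1"
    and MB: "\<And>t v w. t \<in> {0..b} \<Longrightarrow> w \<in> op_dom (B t v) \<Longrightarrow> norm (min_section (B t v) w) \<le> MB * (1 + norm v + norm w)"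
    and MB0: "0 \<le> MB"
    and \<theta>: "has_L2_derivative b \<theta> \<theta>'"
    and dom_compact: "\<And>R. ball_relatively_compact (\<Union>t\<in>{0..b}. \<Union>v\<in>cball 0 R. op_dom (B t v))"
    and F_cc: "\<And>t x u. t \<in> {0..b} \<Longrightarrow> F t x u \<noteq> {} \<and> closed (F t x u) \<and> convex (F t x u)"
    and F_lip: "AE t in \<L> b. \<forall>x u y v. Haus (F t x u) (F t y v) \<le> ereal (kF t * (norm (x - y) + norm (u - v)))"
    and F_growth: "AE t in \<L> b. \<forall>x u. set_norm (F t x u) \<le> ereal (MF * (1 + norm x + norm u))"
    and MF0: "0 \<le> MF"
    and G_cc: "\<And>t x u. t \<in> {0..b} \<Longrightarrow> G t x u \<noteq> {} \<and> closed (G t x u) \<and> convex (G t x u)"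
    and G_lip: "AE t in \<L> b. \<forall>x u y v. Haus (G t x u) (G t y v) \<le> ereal (kG t * (norm (x - y) + norm (u - v)))"
    and G_growth: "AE t in \<L> b. \<forall>x u. set_norm (G t x u) \<le> ereal (MG * (1 + norm x + norm u))"
    and MG0: "0 \<le> MG"
    and \<phi>: "L2_on b \<phi>" "\<And>t. t \<in> {0..b} \<Longrightarrow> 0 \<le> \<phi> t"
begin

text \<open>The witnesses that \<open>mild_solutions\<close> hides behind existential quantifiers
  are arguments here, because limits of the witnesses themselves will be taken.\<close>

definition solves :: "(real \<Rightarrow> 'e) \<Rightarrow> (real \<Rightarrow> 'h) \<Rightarrow> (real \<Rightarrow> 'h) \<Rightarrow> (real \<Rightarrow> 'e) \<Rightarrow> (real \<Rightarrow> 'h) \<Rightarrow> (real \<Rightarrow> 'y) \<Rightarrow> bool" where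
  "solves x u u' f g w \<longleftrightarrow> continuous_on {0..b} x \<and> u 0 = u0 \<and> has_L2_derivative b u u' \<and>
     integrable (\<L> b) f \<and> integrable (\<L> b) g \<and>
     (AE t in \<L> b. f t \<in> F t (x t) (u t) \<and> g t \<in> G t (x t) (u t) \<and> - u' t + g t \<in> B t (u t) (u t)) \<and>
     (\<forall>t\<in>{0..b}. x t = S t x0 +
        integral\<^sup>L (\<L> t) (\<lambda>s. S (t - s) (f s + K (w s))))"

definition dominated_control :: "(real \<Rightarrow> 'y) \<Rightarrow> bool" where
  "dominated_control w \<longleftrightarrow> w \<in> borel_measurable (\<L> b) \<and> (AE t in \<L> b. norm (w t) \<le> \<phi> t)"

lemma fin: "finite_measure (\<L> b)" by (rule finite_measure_lebesgue_on) simp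

lemma \<phi>_int: "integrable (\<L> b) \<phi>" by (rule L2_on_integrable[OF \<phi>(1)])

lemma \<theta>'_int: "integrable (\<L> b) \<theta>'"
  by (rule L2_on_integrable) (use \<theta> in \<open>simp add: has_L2_derivative_def\<close>)

lemma K_measurable:
  assumes "w \<in> borel_measurable (\<L> b)"
  shows "(\<lambda>s. K (w s)) \<in> borel_measurable (\<L> b)"
  by (rule measurable_compose[OF assms]) (intro borel_measurable_continuous_onI linear_continuous_on blinfun.bounded_linear_right)

lemma dominated_control_integrable:
  assumes "dominated_control w"
  shows "integrable (\<L> b) (\<lambda>s. K (w s))"
proof (rule norm_integral_le_AE(1)[where g = "\<lambda>s. norm K * \<phi> s"])
  show "AE s in \<L> b. norm (K (w s)) \<le> norm K * \<phi> s"
    using assms[unfolded dominated_control_def, THEN conjunct2]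
  proof eventually_elim
    case (elim s)
    then show ?case using norm_blinfun[of K "w s"] mult_left_mono[of "norm (w s)" "\<phi> s" "norm K"] by force
  qed
qed (use assms \<phi>_int K_measurable in \<open>auto simp: dominated_control_def\<close>)

lemma AE_on_b: "AE t in \<L> b. t \<in> {0..b}"
  using AE_space[of "\<L> b"] by simp

lemma solves_pointwise_bounds:
  assumes "solves x u u' f g w"
  shows "AE t in \<L> b. norm (f t) \<le> MF * (1 + norm (x t) + norm (u t))"
    "AE t in \<L> b. norm (g t) \<le> MG * (1 + norm (x t) + norm (u t))"
    "AE t in \<L> b. norm (u' t) \<le> 3 / (1 - lam) * (1 + norm (g t) + MB * (1 + 2 * norm (u t)) + \<bar>\<theta>' t\<bar>)"
proof -
  have ae: "AE t in \<L> b. f t \<in> F t (x t) (u t) \<and> g t \<in> G t (x t) (u t) \<and> - u' t + g t \<in> B t (u t) (u t)"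
    and u: "has_L2_derivative b u u'" using assms by (auto simp: solves_def)
  show "AE t in \<L> b. norm (f t) \<le> MF * (1 + norm (x t) + norm (u t))"
    using ae F_growth by eventually_elim (blast intro: set_norm_leD)
  show "AE t in \<L> b. norm (g t) \<le> MG * (1 + norm (x t) + norm (u t))"
    using ae G_growth by eventually_elim (blast intro: set_norm_leD)
  show "AE t in \<L> b. norm (u' t) \<le> 3 / (1 - lam) * (1 + norm (g t) + MB * (1 + 2 * norm (u t)) + \<bar>\<theta>' t\<bar>)"
    by (rule evolution_derivative_bound[OF maxm dis lam MB MB0 \<theta> u]) (use ae in \<open>auto elim: eventually_mono\<close>)
qed

text \<open>The sum of the norms of \<open>x\<close> and \<open>u\<close> satisfies an integral
  inequality whose data depend on the control only through \<open>\<phi>\<close>, so one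
  \<open>R\<close> serves all solutions and all dominated controls.\<close>

lemma a_priori_bound:
  obtains R where "0 \<le> R" "\<And>x u u' f g w t. solves x u u' f g w \<Longrightarrow> dominated_control w \<Longrightarrow> t \<in> {0..b} \<Longrightarrow>
    norm (x t) \<le> R \<and> norm (u t) \<le> R"
proof -
  define C where "C = 3 / (1 - lam)"
  have C0: "0 \<le> C" using lam by (simp add: C_def)
  \<comment> \<open>\<open>C1\<close> collects the coefficients of the unknown sum of norms in the
    bounds for \<open>x\<close> and for the derivative of \<open>u\<close>, and \<open>\<xi>\<close>
    the remaining terms. The extra 1 makes \<open>C1\<close> positive, as
    \<open>gronwall_inequality\<close> requires.\<close>
  define C1 where "C1 = M * MF + C * MG + 2 * C * MB + 1"
  define \<xi> where "\<xi> = (\<lambda>t. M * MF + M * norm K * \<phi> t + C + C * MG + C * MB + C * \<bar>\<theta>' t\<bar>)"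
  have C1: "0 < C1" using M_nonneg C0 MF0 MG0 MB0 by (simp add: C1_def add_nonneg_pos)
  have \<xi>_int: "integrable (\<L> b) \<xi>"
    unfolding \<xi>_def using \<phi>_int \<theta>'_int finite_measure.integrable_const[OF fin]
    by (intro Bochner_Integration.integrable_add integrable_mult_right integrable_abs) auto
  have \<xi>0: "0 \<le> \<xi> t" if "t \<in> {0..b}" for t
    using M_nonneg C0 MF0 MG0 MB0 \<phi>(2)[OF that] by (simp add: \<xi>_def)
  define D where "D = M * norm x0 + norm u0 + integral\<^sup>L (\<L> b) \<xi>"
  have D0: "0 \<le> D"
    unfolding D_def using M_nonneg \<xi>0 by (intro add_nonneg_nonneg Bochner_Integration.integral_nonneg) auto
  show ?thesis
  proof (rule that[of "2 * D * exp (2 * C1 * b)"])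
    show "0 \<le> 2 * D * exp (2 * C1 * b)" using D0 by simp
    fix x :: "real \<Rightarrow> 'e" and u u' :: "real \<Rightarrow> 'h" and f :: "real \<Rightarrow> 'e" and g :: "real \<Rightarrow> 'h" and w :: "real \<Rightarrow> 'y" and t
    assume sol: "solves x u u' f g w" and w: "dominated_control w" and t: "t \<in> {0..b}"
    have x: "continuous_on {0..b} x" and ud: "has_L2_derivative b u u'" and u_init: "u 0 = u0"
      and fi: "integrable (\<L> b) f"
      and mild: "\<And>t. t \<in> {0..b} \<Longrightarrow> x t = S t x0 +
        integral\<^sup>L (\<L> t) (\<lambda>s. S (t - s) (f s + K (w s)))"
      using sol by (auto simp: solves_def)
    have u: "continuous_on {0..b} u" by (rule has_L2_derivative_continuous_on[OF ud])
    define a where "a = (\<lambda>t. norm (x t) + norm (u t))"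
    have a: "continuous_on {0..b} a" unfolding a_def by (intro continuous_intros x u)
    have ai: "integrable (\<L> b) a" by (rule continuous_imp_integrable_real[OF a])
    define \<psi> where "\<psi> = (\<lambda>s. MF * (1 + a s) + norm K * \<phi> s)"
    define \<upsilon> where "\<upsilon> = (\<lambda>s. C * (1 + MG * (1 + a s) + MB * (1 + 2 * a s) + \<bar>\<theta>' s\<bar>))"
    have \<psi>i: "integrable (\<L> b) \<psi>"
      unfolding \<psi>_def using ai \<phi>_int finite_measure.integrable_const[OF fin]
      by (intro Bochner_Integration.integrable_add integrable_mult_right) auto
    have \<upsilon>i: "integrable (\<L> b) \<upsilon>"
      unfolding \<upsilon>_def using ai \<theta>'_int finite_measure.integrable_const[OF fin]
      by (intro Bochner_Integration.integrable_add integrable_mult_right integrable_abs) auto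
    have h\<psi>: "AE s in \<L> b. norm (f s + K (w s)) \<le> \<psi> s"
      using solves_pointwise_bounds(1)[OF sol] w[unfolded dominated_control_def, THEN conjunct2]
    proof eventually_elim
      case (elim s)
      have "norm (K (w s)) \<le> norm K * \<phi> s"
        using norm_blinfun[of K "w s"] mult_left_mono[OF elim(2), of "norm K"] by simp
      then show ?case using elim(1) norm_triangle_ineq[of "f s" "K (w s)"] by (simp add: \<psi>_def a_def add.assoc)
    qed
    have u\<upsilon>: "AE s in \<L> b. norm (u' s) \<le> \<upsilon> s"
      using solves_pointwise_bounds(2,3)[OF sol]
    proof eventually_elim
      case (elim s)
      have "1 + norm (g s) + MB * (1 + 2 * norm (u s)) + \<bar>\<theta>' s\<bar> \<le> 1 + MG * (1 + a s) + MB * (1 + 2 * a s) + \<bar>\<theta>' s\<bar>"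
        using elim(1) MB0 by (intro add_mono mult_left_mono order_refl) (auto simp: a_def add.assoc)
      then show ?case using elim(2) mult_left_mono[OF _ C0] unfolding \<upsilon>_def C_def by (meson order_trans)
    qed
    have "a t \<le> 2 * D * exp (2 * C1 * b)"
    proof (rule gronwall_inequality[OF a C1 D0 _ _ t])
      fix r assume r: "r \<in> {0..b}"
      show "0 \<le> a r" by (simp add: a_def)
      have sub: "{0..r} \<subseteq> {0..b}" using r by auto
      have "norm (x r) \<le> norm (S r x0) + norm (integral\<^sup>L (\<L> r) (\<lambda>s. S (r - s) (f s + K (w s))))"
        unfolding mild[OF r] by (rule norm_triangle_ineq)
      also have "\<dots> \<le> M * norm x0 + M * integral\<^sup>L (\<L> r) \<psi>"
        by (intro add_mono norm_S_le r convolution_bound(2)[OF _ \<psi>i h\<psi>] Bochner_Integration.integrable_add fi dominated_control_integrable w)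
           (use r in auto)
      finally have 1: "norm (x r) \<le> M * norm x0 + M * integral\<^sup>L (\<L> r) \<psi>" .
      have "u r = u0 + integral\<^sup>L (\<L> r) u'"
        using has_L2_derivative_increment[OF ud, of 0 r] r u_init by (simp add: algebra_simps)
      then have "norm (u r) \<le> norm u0 + norm (integral\<^sup>L (\<L> r) u')"
        by (simp add: norm_triangle_ineq)
      also have "norm (integral\<^sup>L (\<L> r) u') \<le> integral\<^sup>L (\<L> r) \<upsilon>"
      proof (rule norm_integral_lebesgue_on_le(2)[OF _ sub \<upsilon>i])
        have "integrable (\<L> b) u'" using ud L2_on_integrable by (auto simp: has_L2_derivative_def)
        from lebesgue_on_subinterval[OF this sub] show "u' \<in> borel_measurable (\<L> r)" by simp
        show "AE s in \<L> r. norm (u' s) \<le> \<upsilon> s" by (rule AE_lebesgue_on_subset[OF u\<upsilon> sub]) auto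
      qed
      finally have 2: "norm (u r) \<le> norm u0 + integral\<^sup>L (\<L> r) \<upsilon>" by simp
      have i: "integrable (\<L> r) \<psi>" "integrable (\<L> r) \<upsilon>" "integrable (\<L> r) \<xi>" "integrable (\<L> r) a"
        by (rule lebesgue_on_subinterval[OF _ sub]; fact)+
      have "M * integral\<^sup>L (\<L> r) \<psi> + integral\<^sup>L (\<L> r) \<upsilon> = integral\<^sup>L (\<L> r) (\<lambda>s. M * \<psi> s + \<upsilon> s)"
        using i by simp
      also have "\<dots> \<le> integral\<^sup>L (\<L> r) (\<lambda>s. \<xi> s + C1 * a s)"
      proof (rule integral_mono)
        show "M * \<psi> s + \<upsilon> s \<le> \<xi> s + C1 * a s" for s
          by (simp add: \<psi>_def \<upsilon>_def \<xi>_def C1_def a_def algebra_simps)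
      qed (use i in auto)
      also have "\<dots> = integral\<^sup>L (\<L> r) \<xi> + C1 * integral\<^sup>L (\<L> r) a" using i by simp
      also have "integral\<^sup>L (\<L> r) \<xi> \<le> integral\<^sup>L (\<L> b) \<xi>"
        by (rule integral_lebesgue_on_mono_set[OF \<xi>_int _ sub]) (use \<xi>0 in \<open>auto intro!: AE_I2\<close>)
      finally show "a r \<le> D + C1 * integral\<^sup>L (\<L> r) a"
        using 1 2 by (simp add: a_def D_def)
    qed
    then show "norm (x t) \<le> 2 * D * exp (2 * C1 * b) \<and> norm (u t) \<le> 2 * D * exp (2 * C1 * b)"
      using norm_ge_zero[of "x t"] norm_ge_zero[of "u t"] unfolding a_def by linarith
  qed
qed

text \<open>
  Since \<open>x\<^sub>n(t) = S(t - q) x\<^sub>n(q) + o(1)\<close> as \<open>q\<close> increases to \<open>t\<close>, uniformly in \<open>n\<close>, and \<open>S(t - q)\<close> factors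
  through a compact \<open>S(1/m)\<close>, convergence of countably many sequences in compact sets suffices.
\<close>

lemma pointwise_convergent_subsequence:
  fixes x :: "nat \<Rightarrow> real \<Rightarrow> 'e" and u u' :: "nat \<Rightarrow> real \<Rightarrow> 'h" and f :: "nat \<Rightarrow> real \<Rightarrow> 'e" and g :: "nat \<Rightarrow> real \<Rightarrow> 'h"
    and w :: "nat \<Rightarrow> real \<Rightarrow> 'y"
  assumes sol: "\<And>n. solves (x n) (u n) (u' n) (f n) (g n) (w n)" and w: "\<And>n. dominated_control (w n)"
    and R: "\<And>n t. t \<in> {0..b} \<Longrightarrow> norm (x n t) \<le> R \<and> norm (u n t) \<le> R"
    and \<Psi>: "integrable (\<L> b) \<Psi>"
    and le: "\<And>n. AE t in \<L> b. norm (f n t + K (w n t)) \<le> \<Psi> t"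
      "\<And>n. AE t in \<L> b. norm (u' n t) \<le> \<Psi> t"
  obtains r where "strict_mono r" "\<And>t. t \<in> {0..b} \<Longrightarrow> convergent (\<lambda>n. x (r n) t)"
    "\<And>t. t \<in> {0..b} \<Longrightarrow> convergent (\<lambda>n. u (r n) t)"
proof -
  define A where "A = closure ((\<Union>t\<in>{0..b}. \<Union>v\<in>cball 0 R. op_dom (B t v)) \<inter> cball 0 R)"
  have A: "compact A" using dom_compact[of R] by (auto simp: A_def ball_relatively_compact_def relatively_compact_def)
  have x: "continuous_on {0..b} (x n)" and ud: "has_L2_derivative b (u n) (u' n)" and u_init: "u n 0 = u0"
    and fi: "integrable (\<L> b) (f n)"
    and mild: "\<And>t. t \<in> {0..b} \<Longrightarrow> x n t = S t x0 +
      integral\<^sup>L (\<L> t) (\<lambda>s. S (t - s) (f n s + K (w n s)))" for n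
    using sol[of n] by (auto simp: solves_def)
  have hi: "integrable (\<L> b) (\<lambda>s. f n s + K (w n s))" for n
    by (intro Bochner_Integration.integrable_add fi dominated_control_integrable w)
  \<comment> \<open>The inclusion places \<open>u n t\<close> in a domain for almost every
    \<open>t\<close> only; passing to the closure \<open>A\<close> and using continuity covers every
    \<open>t\<close>, in particular each rational time.\<close>
  have uA: "u n t \<in> A" if "t \<in> {0..b}" for n t
  proof (rule AE_continuous_on_closed[OF has_L2_derivative_continuous_on[OF ud] _ _ that b_pos])
    show "closed A" by (simp add: A_def)
    have "AE t in \<L> b. - u' n t + g n t \<in> B t (u n t) (u n t)"
      using sol[of n] by (auto simp: solves_def elim: eventually_mono)
    then show "AE t in \<L> b. u n t \<in> A"
      using AE_on_b
    proof eventually_elim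
      case (elim t)
      then have "u n t \<in> op_dom (B t (u n t))" by (auto simp: op_dom_def)
      moreover have "u n t \<in> cball 0 R" using R[of t n] elim by auto
      ultimately have "u n t \<in> (\<Union>t\<in>{0..b}. \<Union>v\<in>cball 0 R. op_dom (B t v)) \<inter> cball 0 R"
        using elim by (intro IntI UN_I[of t] UN_I[of "u n t"]) auto
      then show ?case unfolding A_def by (rule subsetD[OF closure_subset])
    qed
  qed
  define E where "E = (\<lambda>m::nat. closure (blinfun_apply (S (1 / real (Suc m))) ` cball 0 R))"
  have E: "compact (E m)" for m
    using S_compact[of "1 / real (Suc m)"] by (simp add: E_def compact_operator_def relatively_compact_def)
  \<comment> \<open>One index \<open>i\<close> codes a rational time and a lag
    \<open>1 / Suc m\<close>. Times outside \<open>{0..b}\<close> get the default value 0, which is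
    why 0 is inserted into the compact sets below.\<close>
  define \<Phi> where "\<Phi> = (\<lambda>i n. case from_nat i :: rat \<times> nat of (q, m) \<Rightarrow>
     if real_of_rat q \<in> {0..b} then (S (1 / real (Suc m)) (x n (real_of_rat q)), u n (real_of_rat q)) else 0)"
  obtain r where r: "strict_mono r" "\<And>i. convergent (\<lambda>n. \<Phi> i (r n))"
  proof (rule diagonal_convergent_subsequence[of "\<lambda>i. insert 0 (E (snd (from_nat i :: rat \<times> nat)) \<times> A)" \<Phi>])
    show "compact (insert 0 (E (snd (from_nat i :: rat \<times> nat)) \<times> A))" for i
      by (intro compact_insert compact_Times E A)
    show "\<Phi> i n \<in> insert 0 (E (snd (from_nat i :: rat \<times> nat)) \<times> A)" for i n
    proof -
      obtain q m where qm: "from_nat i = (q :: rat, m :: nat)" by (cases "from_nat i :: rat \<times> nat")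
      have "S (1 / real (Suc m)) (x n (real_of_rat q)) \<in> E m" if "real_of_rat q \<in> {0..b}"
        unfolding E_def by (rule subsetD[OF closure_subset]) (use R[OF that, of n] in auto)
      then show ?thesis using uA by (auto simp: \<Phi>_def qm)
    qed
  qed (rule that)
  have conv: "convergent (\<lambda>n. S (1 / real (Suc m)) (x (r n) (real_of_rat q)))" "convergent (\<lambda>n. u (r n) (real_of_rat q))"
    if q: "real_of_rat q \<in> {0..b}" for q m
  proof -
    have "\<Phi> (to_nat (q, m)) n = (S (1 / real (Suc m)) (x n (real_of_rat q)), u n (real_of_rat q))" for n
      using q by (simp add: \<Phi>_def)
    then have *: "convergent (\<lambda>n. (S (1 / real (Suc m)) (x (r n) (real_of_rat q)), u (r n) (real_of_rat q)))"
      using r(2)[of "to_nat (q, m)"] by simp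
    then obtain L where "(\<lambda>n. (S (1 / real (Suc m)) (x (r n) (real_of_rat q)), u (r n) (real_of_rat q))) \<longlonglongrightarrow> L"
      unfolding convergent_def by blast
    from tendsto_fst[OF this] tendsto_snd[OF this]
    show "convergent (\<lambda>n. S (1 / real (Suc m)) (x (r n) (real_of_rat q)))" "convergent (\<lambda>n. u (r n) (real_of_rat q))"
      unfolding fst_conv snd_conv convergent_def by blast+
  qed
  \<comment> \<open>One rational time works for all \<open>n\<close>, since the smallness comes from
    the common majorant \<open>\<Psi>\<close> on a short interval.\<close>
  have pick: "\<exists>q. real_of_rat q \<in> {0..b} \<and> real_of_rat q < t \<and> (\<forall>n. dist (u n t) (u n (real_of_rat q)) \<le> e \<and>
      dist (x n t) (S (t - real_of_rat q) (x n (real_of_rat q))) \<le> e)"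
    if t: "t \<in> {0..b}" "0 < t" and e: "0 < e" for t e
  proof -
    have e': "0 < e / (M + 1)" using e M_nonneg by simp
    obtain d where d: "d > 0" "\<And>s t. 0 \<le> s \<Longrightarrow> s \<le> t \<Longrightarrow> t \<le> b \<Longrightarrow> t - s < d \<Longrightarrow> integral\<^sup>L (lebesgue_on {s..t}) \<Psi> < e / (M + 1)"
      using small_integral_on_short_intervals[OF \<Psi> e'] by metis
    obtain q where q: "max 0 (t - d) < real_of_rat q" "real_of_rat q < t"
      using of_rat_dense[of "max 0 (t - d)" t] t d(1) by auto
    let ?q = "real_of_rat q"
    have sub: "{?q..t} \<subseteq> {0..b}" using q t by auto
    have small: "integral\<^sup>L (lebesgue_on {?q..t}) \<Psi> < e / (M + 1)" by (rule d(2)) (use q t in auto)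
    have le1: "e / (M + 1) \<le> e" using e M_nonneg by (simp add: field_simps)
    have u_near: "dist (u n t) (u n ?q) \<le> e" for n
    proof -
      have "integrable (\<L> b) (u' n)" using ud L2_on_integrable by (auto simp: has_L2_derivative_def)
      from lebesgue_on_subinterval[OF this sub]
      have "norm (integral\<^sup>L (lebesgue_on {?q..t}) (u' n)) \<le> integral\<^sup>L (lebesgue_on {?q..t}) \<Psi>"
        by (intro norm_integral_lebesgue_on_le(2)[OF _ sub \<Psi>] AE_lebesgue_on_subset[OF le(2) sub]) auto
      then show ?thesis
        using has_L2_derivative_increment[OF ud[of n], of ?q t] q t small le1 by (simp add: dist_norm)
    qed
    have x_near: "dist (x n t) (S (t - ?q) (x n ?q)) \<le> e" for n
    proof -
      have "x n t - S (t - ?q) (x n ?q) =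
          integral\<^sup>L (lebesgue_on {?q..t}) (\<lambda>s. S (t - s) (f n s + K (w n s)))"
        using mild_restart[where x = "x n" and h = "\<lambda>s. f n s + K (w n s)" and q = ?q and t = t, OF mild hi] q t by simp
      also have "norm \<dots> \<le> M * integral\<^sup>L (lebesgue_on {?q..t}) \<Psi>"
        by (rule convolution_bound(2)[OF hi \<Psi> le(1)]) (use q t in auto)
      also have "\<dots> \<le> M * (e / (M + 1))" using small M_nonneg by (intro mult_left_mono) auto
      also have "\<dots> \<le> e" using e M_nonneg by (simp add: field_simps)
      finally show ?thesis by (simp add: dist_norm)
    qed
    show ?thesis using q t u_near x_near by (intro exI[of _ q]) auto
  qed
  have S_conv: "convergent (\<lambda>n. S s (x (r n) (real_of_rat q)))" if q: "real_of_rat q \<in> {0..b}" and s: "0 < s" for q s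
  proof -
    obtain m where m: "inverse (real (Suc m)) < s" using reals_Archimedean[OF s] by blast
    have eq: "S s z = S (s - 1 / real (Suc m)) (S (1 / real (Suc m)) z)" for z
      using S_add[of "s - 1 / real (Suc m)" "1 / real (Suc m)" z] m by (simp add: inverse_eq_divide)
    obtain l where "(\<lambda>n. S (1 / real (Suc m)) (x (r n) (real_of_rat q))) \<longlonglongrightarrow> l"
      using conv(1)[OF q] by (auto simp: convergent_def)
    then have "(\<lambda>n. S (s - 1 / real (Suc m)) (S (1 / real (Suc m)) (x (r n) (real_of_rat q)))) \<longlonglongrightarrow> S (s - 1 / real (Suc m)) l"
      by (intro tendsto_intros)
    then show ?thesis unfolding eq convergent_def by blast
  qed
  show ?thesis
  proof (rule that[OF r(1)])
    fix t assume t: "t \<in> {0..b}"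
    show "convergent (\<lambda>n. x (r n) t)"
    proof (cases "t = 0")
      case True
      \<comment> \<open>At time 0 no positive lag is available for compactness, but all solutions
        start from the same point.\<close>
      have "x n 0 = x 0 0" for n
      proof -
        have "integral\<^sup>L (lebesgue_on {0..0}) h = 0" for h :: "real \<Rightarrow> 'e"
        proof (rule integral_eq_zero_AE)
          have "AE t in lebesgue. t \<in> {0..0::real} \<longrightarrow> h t = 0" by (rule AE_I'[of "{0}"]) auto
          then show "AE t in lebesgue_on {0..0}. h t = 0" by (subst AE_restrict_space_iff) auto
        qed
        then show ?thesis using mild[of 0 n] mild[of 0 0] b_pos by simp
      qed
      then have "(\<lambda>n. x (r n) 0) = (\<lambda>n. x 0 0)" by blast
      then show ?thesis unfolding True by (simp add: convergent_const)
    next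
      case False
      have "Cauchy (\<lambda>n. x (r n) t)"
      proof (rule Cauchy_of_approximations)
        fix e :: real assume "0 < e"
        then obtain q where q: "real_of_rat q \<in> {0..b}" "real_of_rat q < t"
          "\<And>n. dist (x n t) (S (t - real_of_rat q) (x n (real_of_rat q))) \<le> e"
          using pick[OF t, of e] t False by auto
        then show "\<exists>y. Cauchy y \<and> (\<forall>n. dist (x (r n) t) (y n) \<le> e)"
          using S_conv[OF q(1), of "t - real_of_rat q"]
          by (intro exI[of _ "\<lambda>n. S (t - real_of_rat q) (x (r n) (real_of_rat q))"]) (auto intro: convergent_Cauchy)
      qed
      then show ?thesis by (rule Cauchy_convergent)
    qed
    show "convergent (\<lambda>n. u (r n) t)"
    proof (cases "t = 0")
      case True
      then show ?thesis using u_init by (simp add: convergent_const)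
    next
      case False
      have "Cauchy (\<lambda>n. u (r n) t)"
      proof (rule Cauchy_of_approximations)
        fix e :: real assume "0 < e"
        then obtain q where q: "real_of_rat q \<in> {0..b}" "\<And>n. dist (u n t) (u n (real_of_rat q)) \<le> e"
          using pick[OF t, of e] t False by auto
        then show "\<exists>y. Cauchy y \<and> (\<forall>n. dist (u (r n) t) (y n) \<le> e)"
          using conv(2)[OF q(1)] by (intro exI[of _ "\<lambda>n. u (r n) (real_of_rat q)"]) (auto intro: convergent_Cauchy)
      qed
      then show ?thesis by (rule Cauchy_convergent)
    qed
  qed
qed

text \<open>The control \<open>wl\<close> of the limit solution is returned together with the
  averages that produce it, so that it can later be identified with a limit control fixed in
  advance.\<close>

lemma solution_sequence_limit:
  fixes x :: "nat \<Rightarrow> real \<Rightarrow> 'e" and u u' :: "nat \<Rightarrow> real \<Rightarrow> 'h" and f :: "nat \<Rightarrow> real \<Rightarrow> 'e" and g :: "nat \<Rightarrow> real \<Rightarrow> 'h"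
    and w :: "nat \<Rightarrow> real \<Rightarrow> 'y"
  assumes sol: "\<And>n. solves (x n) (u n) (u' n) (f n) (g n) (w n)" and w: "\<And>n. dominated_control (w n)"
  obtains r xl ul ul' fl gl wl N c R where "strict_mono r"
    "\<And>n. tail_weights n (N n) (c n)"
    "wl \<in> borel_measurable (\<L> b)"
    "AE t in \<L> b. (\<lambda>n. \<Sum>k\<le>N n. c n k *\<^sub>R w (r k) t) \<longlonglongrightarrow> wl t"
    "solves xl ul ul' fl gl wl"
    "\<And>t. t \<in> {0..b} \<Longrightarrow> (\<lambda>n. x (r n) t) \<longlonglongrightarrow> xl t" "\<And>t. t \<in> {0..b} \<Longrightarrow> (\<lambda>n. u (r n) t) \<longlonglongrightarrow> ul t"
    "0 \<le> R" "\<And>n t. t \<in> {0..b} \<Longrightarrow> norm (x n t) \<le> R \<and> norm (u n t) \<le> R"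
proof -
  obtain R where R0: "0 \<le> R" and R': "\<And>x u u' f g w t. solves x u u' f g w \<Longrightarrow> dominated_control w \<Longrightarrow> t \<in> {0..b} \<Longrightarrow>
    norm (x t) \<le> R \<and> norm (u t) \<le> R" using a_priori_bound by blast
  have R: "norm (x n t) \<le> R \<and> norm (u n t) \<le> R" if "t \<in> {0..b}" for n t using R'[OF sol w that] .
  have x: "continuous_on {0..b} (x n)" and ud: "has_L2_derivative b (u n) (u' n)" and u_init: "u n 0 = u0"
    and fi: "integrable (\<L> b) (f n)" and gi: "integrable (\<L> b) (g n)"
    and incl: "AE t in \<L> b. f n t \<in> F t (x n t) (u n t) \<and> g n t \<in> G t (x n t) (u n t) \<and> - u' n t + g n t \<in> B t (u n t) (u n t)"
    and mild: "\<And>t. t \<in> {0..b} \<Longrightarrow> x n t = S t x0 +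
      integral\<^sup>L (\<L> t) (\<lambda>s. S (t - s) (f n s + K (w n s)))" for n
    using sol[of n] by (auto simp: solves_def)
  have wm: "w n \<in> borel_measurable (\<L> b)" and wb: "AE t in \<L> b. norm (w n t) \<le> \<phi> t" for n
    using w[of n] by (auto simp: dominated_control_def)
  have u'm: "u' n \<in> borel_measurable (\<L> b)" for n using ud by (auto simp: has_L2_derivative_def L2_on_def)
  define Cf where "Cf = MF * (1 + R + R)"
  define Cg where "Cg = MG * (1 + R + R)"
  define C where "C = 3 / (1 - lam)"
  have pos: "0 \<le> Cf" "0 \<le> Cg" "0 \<le> C" using MF0 MG0 R0 lam by (auto simp: Cf_def Cg_def C_def)
  define c1 where "c1 = Cf + Cg + C * (1 + Cg + MB * (1 + 2 * R))"
  have c1: "Cf + Cg \<le> c1" "0 \<le> c1" using pos MB0 R0 by (auto simp: c1_def)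
  \<comment> \<open>A single square integrable majorant for the control, both selections and the
    derivative together, as well as for \<open>f + K w\<close>. The 1 in \<open>1 + norm K\<close>
    accounts for the control itself.\<close>
  define \<Psi> where "\<Psi> = (\<lambda>t. (c1 + (1 + norm K) * \<bar>\<phi> t\<bar>) + C * \<bar>\<theta>' t\<bar>)"
  have \<Psi>2: "L2_on b \<Psi>"
    unfolding \<Psi>_def by (intro L2_on_add L2_on_const L2_on_abs_mult \<phi>(1)) (use \<theta> in \<open>simp add: has_L2_derivative_def\<close>)
  have \<Psi>i: "integrable (\<L> b) \<Psi>" by (rule L2_on_integrable[OF \<Psi>2])
  have fb: "AE t in \<L> b. norm (f n t) \<le> Cf" for n
    using solves_pointwise_bounds(1)[OF sol[of n]] AE_on_b
  proof eventually_elim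
    case (elim t)
    have "MF * (1 + norm (x n t) + norm (u n t)) \<le> Cf"
      unfolding Cf_def using R[OF elim(2), of n] MF0 by (intro mult_left_mono) auto
    then show ?case using elim(1) by linarith
  qed
  have gb: "AE t in \<L> b. norm (g n t) \<le> Cg" for n
    using solves_pointwise_bounds(2)[OF sol[of n]] AE_on_b
  proof eventually_elim
    case (elim t)
    have "MG * (1 + norm (x n t) + norm (u n t)) \<le> Cg"
      unfolding Cg_def using R[OF elim(2), of n] MG0 by (intro mult_left_mono) auto
    then show ?case using elim(1) by linarith
  qed
  have ub: "AE t in \<L> b. norm (u' n t) \<le> C * (1 + Cg + MB * (1 + 2 * R)) + C * \<bar>\<theta>' t\<bar>" for n
    using solves_pointwise_bounds(3)[OF sol[of n]] gb[of n] AE_on_b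
  proof eventually_elim
    case (elim t)
    have "1 + norm (g n t) + MB * (1 + 2 * norm (u n t)) + \<bar>\<theta>' t\<bar> \<le> 1 + Cg + MB * (1 + 2 * R) + \<bar>\<theta>' t\<bar>"
      using elim(2) R[OF elim(3), of n] MB0 by (intro add_mono mult_left_mono) auto
    then have "C * (1 + norm (g n t) + MB * (1 + 2 * norm (u n t)) + \<bar>\<theta>' t\<bar>) \<le> C * (1 + Cg + MB * (1 + 2 * R) + \<bar>\<theta>' t\<bar>)"
      using pos(3) by (rule mult_left_mono)
    then show ?case using elim(1) by (simp add: C_def distrib_left)
  qed
  have Kb: "norm (K y) \<le> norm K * \<bar>\<phi> t\<bar>" if "norm y \<le> \<phi> t" for y t
    by (rule order_trans[OF norm_blinfun mult_left_mono]) (use that in auto)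
  have hb: "AE t in \<L> b. norm (f n t + K (w n t)) \<le> \<Psi> t" for n
    using fb[of n] wb[of n]
  proof eventually_elim
    case (elim t)
    have "norm (f n t + K (w n t)) \<le> Cf + norm K * \<bar>\<phi> t\<bar>"
      using elim(1) Kb[OF elim(2)] by (intro norm_triangle_le add_mono)
    moreover have "0 \<le> C * \<bar>\<theta>' t\<bar>" using pos by simp
    moreover have "(1 + norm K) * \<bar>\<phi> t\<bar> = \<bar>\<phi> t\<bar> + norm K * \<bar>\<phi> t\<bar>" by (simp add: distrib_right)
    ultimately show ?case using c1 pos abs_ge_zero[of "\<phi> t"] unfolding \<Psi>_def by linarith
  qed
  have ub': "AE t in \<L> b. norm (u' n t) \<le> \<Psi> t" for n
    using ub[of n]
  proof eventually_elim
    case (elim t)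
    have "0 \<le> (1 + norm K) * \<bar>\<phi> t\<bar>" by simp
    then show ?case using elim pos unfolding \<Psi>_def c1_def by linarith
  qed
  have zb: "AE t in \<L> b. norm (w n t, f n t, g n t, u' n t) \<le> \<Psi> t" for n
    using fb[of n] gb[of n] ub[of n] wb[of n]
  proof eventually_elim
    case (elim t)
    have "norm (w n t, f n t, g n t, u' n t) \<le> norm (w n t) + (norm (f n t) + (norm (g n t) + norm (u' n t)))"
      by (intro order_trans[OF norm_Pair_le] add_left_mono order_refl)
    also have "\<dots> \<le> \<bar>\<phi> t\<bar> + (Cf + (Cg + (C * (1 + Cg + MB * (1 + 2 * R)) + C * \<bar>\<theta>' t\<bar>)))"
      using elim by (intro add_mono) auto
    also have "\<dots> \<le> \<Psi> t" unfolding \<Psi>_def c1_def by (simp add: distrib_right)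
    finally show ?case .
  qed
  obtain r where r: "strict_mono r" "\<And>t. t \<in> {0..b} \<Longrightarrow> convergent (\<lambda>n. x (r n) t)"
    "\<And>t. t \<in> {0..b} \<Longrightarrow> convergent (\<lambda>n. u (r n) t)"
  proof (rule pointwise_convergent_subsequence[where x = x and u = u and R = R, OF sol w _ \<Psi>i hb ub'])
    show "norm (x n t) \<le> R \<and> norm (u n t) \<le> R" if "t \<in> {0..b}" for n t using that by (rule R)
  qed (rule that)
  define xl where "xl = (\<lambda>t. lim (\<lambda>n. x (r n) t))"
  define ul where "ul = (\<lambda>t. lim (\<lambda>n. u (r n) t))"
  have xl: "(\<lambda>n. x (r n) t) \<longlonglongrightarrow> xl t" and ul: "(\<lambda>n. u (r n) t) \<longlonglongrightarrow> ul t" if "t \<in> {0..b}" for t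
    using r(2,3)[OF that] by (auto simp: xl_def ul_def convergent_LIMSEQ_iff)
  have zm: "(\<lambda>t. (w n t, f n t, g n t, u' n t)) \<in> borel_measurable (\<L> b)" for n
    using wm[of n] fi[of n] gi[of n] u'm[of n] by (intro borel_measurable_Pair) auto
  have \<Psi>sq: "integrable (\<L> b) (\<lambda>t. (\<Psi> t)\<^sup>2)" using \<Psi>2 by (simp add: L2_on_def)
  \<comment> \<open>Averaging the quadruple as one sequence in a product Hilbert space yields the
    same weights for all four components, so that combinations such as \<open>f + K w\<close> and
    \<open>- u' + g\<close> converge as well.\<close>
  obtain N c zl where c: "\<And>n. tail_weights n (N n) (c n)" and zl: "zl \<in> borel_measurable (\<L> b)"
    and lim: "AE t in \<L> b. (\<lambda>n. \<Sum>k\<le>N n. c n k *\<^sub>R (w (r k) t, f (r k) t, g (r k) t, u' (r k) t)) \<longlonglongrightarrow> zl t"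
    and zl_b: "AE t in \<L> b. norm (zl t) \<le> \<Psi> t"
    by (rule finite_measure.dominated_tail_convex_combinations_converge[OF fin, of "\<lambda>n t. (w (r n) t, f (r n) t, g (r n) t, u' (r n) t)" \<Psi>, OF zm \<Psi>sq zb]) blast
  define wl where "wl = (\<lambda>t. fst (zl t))"
  define fl where "fl = (\<lambda>t. fst (snd (zl t)))"
  define gl where "gl = (\<lambda>t. fst (snd (snd (zl t))))"
  define ul' where "ul' = (\<lambda>t. snd (snd (snd (zl t))))"
  have m: "wl \<in> borel_measurable (\<L> b)" "fl \<in> borel_measurable (\<L> b)"
    "gl \<in> borel_measurable (\<L> b)" "ul' \<in> borel_measurable (\<L> b)"
    unfolding wl_def fl_def gl_def ul'_def
    by (rule measurable_compose[OF zl], intro borel_measurable_continuous_onI continuous_intros)+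
  have "AE t in \<L> b. ((\<lambda>n. \<Sum>k\<le>N n. c n k *\<^sub>R w (r k) t) \<longlonglongrightarrow> wl t) \<and>
      ((\<lambda>n. \<Sum>k\<le>N n. c n k *\<^sub>R f (r k) t) \<longlonglongrightarrow> fl t) \<and>
      ((\<lambda>n. \<Sum>k\<le>N n. c n k *\<^sub>R g (r k) t) \<longlonglongrightarrow> gl t) \<and>
      ((\<lambda>n. \<Sum>k\<le>N n. c n k *\<^sub>R u' (r k) t) \<longlonglongrightarrow> ul' t)"
    using lim
  proof eventually_elim
    case (elim t)
    note 1 = tendsto_snd[OF elim] and 2 = tendsto_snd[OF tendsto_snd[OF elim]]
    show ?case
      using tendsto_fst[OF elim] tendsto_fst[OF 1] tendsto_fst[OF 2] tendsto_snd[OF 2]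
      by (simp add: wl_def fl_def gl_def ul'_def fst_sum snd_sum)
  qed
  then have lims: "AE t in \<L> b. (\<lambda>n. \<Sum>k\<le>N n. c n k *\<^sub>R w (r k) t) \<longlonglongrightarrow> wl t"
    "AE t in \<L> b. (\<lambda>n. \<Sum>k\<le>N n. c n k *\<^sub>R f (r k) t) \<longlonglongrightarrow> fl t"
    "AE t in \<L> b. (\<lambda>n. \<Sum>k\<le>N n. c n k *\<^sub>R g (r k) t) \<longlonglongrightarrow> gl t"
    "AE t in \<L> b. (\<lambda>n. \<Sum>k\<le>N n. c n k *\<^sub>R u' (r k) t) \<longlonglongrightarrow> ul' t"
    by (auto elim: eventually_mono)
  have bds: "AE t in \<L> b. norm (fl t) \<le> \<Psi> t \<and> norm (gl t) \<le> \<Psi> t \<and> norm (ul' t) \<le> \<Psi> t"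
    using zl_b
  proof eventually_elim
    case (elim t)
    have 1: "norm (snd (zl t)) \<le> norm (zl t)" by (metis norm_snd_le prod.collapse)
    have 2: "norm (snd (snd (zl t))) \<le> norm (snd (zl t))" by (metis norm_snd_le prod.collapse)
    have "norm (fl t) \<le> norm (snd (zl t))" unfolding fl_def by (metis norm_fst_le prod.collapse)
    moreover have "norm (gl t) \<le> norm (snd (snd (zl t)))" unfolding gl_def by (metis norm_fst_le prod.collapse)
    moreover have "norm (ul' t) \<le> norm (snd (snd (zl t)))" unfolding ul'_def by (metis norm_snd_le prod.collapse)
    ultimately show ?case using 1 2 elim by linarith
  qed
  have "AE t in \<L> b. norm (ul' t) \<le> \<Psi> t" using bds by eventually_elim simp
  then have ul'2: "L2_on b ul'" by (rule L2_on_dominated[OF m(4) \<Psi>2])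
  have fl_int: "integrable (\<L> b) fl" "integrable (\<L> b) gl"
    using bds by (auto intro!: norm_integral_le_AE(1)[OF _ \<Psi>i] m elim: eventually_mono)
  have wl_int: "integrable (\<L> b) (\<lambda>t. K (wl t))"
  proof -
    have "AE t in \<L> b. \<forall>k. norm (w k t) \<le> \<phi> t" using wb by (simp add: AE_all_countable)
    with lims(1) have "AE t in \<L> b. norm (wl t) \<le> \<phi> t"
    proof eventually_elim
      case (elim t)
      have "norm (\<Sum>k\<le>N n. c n k *\<^sub>R w (r k) t) \<le> \<phi> t" for n
        using tail_weights_sum_in_convex[OF c convex_cball[of 0 "\<phi> t"], of n "\<lambda>k. w (r k) t"] elim(2) by auto
      then show ?case by (intro LIMSEQ_le_const2[OF tendsto_norm[OF elim(1)]]) auto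
    qed
    then show ?thesis using dominated_control_integrable m(1) by (simp add: dominated_control_def)
  qed
  have ul_eq: "ul t = u0 + integral\<^sup>L (\<L> t) ul'" if t: "t \<in> {0..b}" for t
  proof -
    have sub: "{0..t} \<subseteq> {0..b}" using t by auto
    have sm: "p \<in> borel_measurable (\<L> b) \<Longrightarrow> p \<in> borel_measurable (\<L> t)" for p :: "real \<Rightarrow> 'h"
      using measurable_restrict_mono[OF _ sub] by blast
    have "integral\<^sup>L (\<L> t) ul' = ul t - u0"
    proof (rule integral_of_tail_convex_combination_limit[OF c, of "\<lambda>k. u' (r k)"])
      show "u' (r k) \<in> borel_measurable (\<L> t)" for k by (rule sm[OF u'm])
      show "ul' \<in> borel_measurable (\<L> t)" by (rule sm[OF m(4)])
      show "integrable (\<L> t) \<Psi>" by (rule lebesgue_on_subinterval[OF \<Psi>i sub])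
      show "AE s in \<L> t. norm (u' (r k) s) \<le> \<Psi> s" for k by (rule AE_lebesgue_on_subset[OF ub' sub]) auto
      show "AE s in \<L> t. (\<lambda>n. \<Sum>k\<le>N n. c n k *\<^sub>R u' (r k) s) \<longlonglongrightarrow> ul' s"
        by (rule AE_lebesgue_on_subset[OF lims(4) sub]) auto
      have "integral\<^sup>L (\<L> t) (u' (r k)) = u (r k) t - u0" for k
        using has_L2_derivative_increment[OF ud[of "r k"], of 0 t] t u_init by simp
      then show "(\<lambda>k. integral\<^sup>L (\<L> t) (u' (r k))) \<longlonglongrightarrow> ul t - u0"
        using tendsto_diff[OF ul[OF t] tendsto_const[of u0]] by simp
    qed
    then show ?thesis by simp
  qed
  have ul0: "ul 0 = u0" using ul[of 0] u_init b_pos by (simp add: LIMSEQ_const_iff)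
  have xl_eq: "xl t = S t x0 + integral\<^sup>L (\<L> t) (\<lambda>s. S (t - s) (fl s + K (wl s)))"
    if t: "t \<in> {0..b}" for t
  proof -
    have sub: "{0..t} \<subseteq> {0..b}" using t by auto
    have hm: "(\<lambda>s. p s + K (v s)) \<in> borel_measurable (\<L> t)"
      if "p \<in> borel_measurable (\<L> b)" "v \<in> borel_measurable (\<L> b)" for p v
      using measurable_restrict_mono[OF borel_measurable_add[OF that(1) K_measurable[OF that(2)]] sub] .
    have "integral\<^sup>L (\<L> t) (\<lambda>s. S (t - s) (fl s + K (wl s))) = xl t - S t x0"
    proof (rule integral_of_tail_convex_combination_limit[OF c, of "\<lambda>k s. S (t - s) (f (r k) s + K (w (r k) s))"])
      show "(\<lambda>s. S (t - s) (f (r k) s + K (w (r k) s))) \<in> borel_measurable (\<L> t)" for k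
        by (rule convolution_measurable[OF hm]) (use fi wm t in auto)
      show "(\<lambda>s. S (t - s) (fl s + K (wl s))) \<in> borel_measurable (\<L> t)"
        by (rule convolution_measurable[OF hm]) (use m t in auto)
      show "integrable (\<L> t) (\<lambda>s. M * \<Psi> s)" using lebesgue_on_subinterval[OF \<Psi>i sub] by simp
      have on: "AE s in \<L> t. s \<in> {0..t}" using AE_space[of "\<L> t"] by simp
      have hb': "AE s in \<L> t. norm (f (r k) s + K (w (r k) s)) \<le> \<Psi> s" for k
        by (rule AE_lebesgue_on_subset[OF hb sub]) auto
      show "AE s in \<L> t. norm (S (t - s) (f (r k) s + K (w (r k) s))) \<le> M * \<Psi> s" for k
        using hb'[of k] on
      proof eventually_elim
        case (elim s)
        have "norm (S (t - s) (f (r k) s + K (w (r k) s))) \<le> M * norm (f (r k) s + K (w (r k) s))"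
          using elim t by (intro norm_S_le) auto
        also have "\<dots> \<le> M * \<Psi> s" using elim M_nonneg by (intro mult_left_mono) auto
        finally show ?case .
      qed
      have l2: "AE s in \<L> t. (\<lambda>n. \<Sum>k\<le>N n. c n k *\<^sub>R f (r k) s) \<longlonglongrightarrow> fl s"
        "AE s in \<L> t. (\<lambda>n. \<Sum>k\<le>N n. c n k *\<^sub>R w (r k) s) \<longlonglongrightarrow> wl s"
        by (rule AE_lebesgue_on_subset[OF lims(2) sub] AE_lebesgue_on_subset[OF lims(1) sub]; simp)+
      show "AE s in \<L> t. (\<lambda>n. \<Sum>k\<le>N n. c n k *\<^sub>R S (t - s) (f (r k) s + K (w (r k) s))) \<longlonglongrightarrow>
          S (t - s) (fl s + K (wl s))"
        using l2
      proof eventually_elim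
        case (elim s)
        have "(\<lambda>n. S (t - s) ((\<Sum>k\<le>N n. c n k *\<^sub>R f (r k) s) + K (\<Sum>k\<le>N n. c n k *\<^sub>R w (r k) s))) \<longlonglongrightarrow>
           S (t - s) (fl s + K (wl s))"
          using elim by (intro tendsto_intros)
        then show ?case
          by (simp add: blinfun.sum_right blinfun.scaleR_right blinfun.add_right sum.distrib scaleR_add_right)
      qed
      have "integral\<^sup>L (\<L> t) (\<lambda>s. S (t - s) (f (r k) s + K (w (r k) s))) = x (r k) t - S t x0" for k
        using mild[OF t, of "r k"] by simp
      then show "(\<lambda>k. integral\<^sup>L (\<L> t) (\<lambda>s. S (t - s) (f (r k) s + K (w (r k) s)))) \<longlonglongrightarrow> xl t - S t x0"
        using tendsto_diff[OF xl[OF t] tendsto_const[of "S t x0"]] by simp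
    qed
    then show ?thesis by simp
  qed
  have incl_l: "AE t in \<L> b. fl t \<in> F t (xl t) (ul t) \<and> gl t \<in> G t (xl t) (ul t) \<and> - ul' t + gl t \<in> B t (ul t) (ul t)"
  proof -
    have all: "AE t in \<L> b. \<forall>k. (f k t \<in> F t (x k t) (u k t) \<and> g k t \<in> G t (x k t) (u k t) \<and> - u' k t + g k t \<in> B t (u k t) (u k t))
        \<and> norm (g k t) \<le> Cg \<and> norm (u' k t) \<le> \<Psi> t"
      using incl gb ub' by (simp add: AE_all_countable)
    show ?thesis
      using all F_lip G_lip AE_on_b lims
    proof eventually_elim
      case (elim t)
      note xt = xl[OF elim(4)] and ut = ul[OF elim(4)]
      have "fl t \<in> F t (xl t) (ul t)"
        by (rule tail_weights_limit_in_Lipschitz_multifunction[OF c elim(6), where A = "F t" and x = "\<lambda>k. x (r k) t" and u = "\<lambda>k. u (r k) t" and L = "kF t"])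
           (use F_cc[OF elim(4)] elim(1,2) xt ut in auto)
      moreover have "gl t \<in> G t (xl t) (ul t)"
        by (rule tail_weights_limit_in_Lipschitz_multifunction[OF c elim(7), where A = "G t" and x = "\<lambda>k. x (r k) t" and u = "\<lambda>k. u (r k) t" and L = "kG t"])
           (use G_cc[OF elim(4)] elim(1,3) xt ut in auto)
      \<comment> \<open>At a fixed \<open>t\<close> a bound uniform in \<open>k\<close> suffices,
        here \<open>\<Psi> t + Cg\<close>. With equal times the \<open>\<theta>\<close> term in the
        estimate of the pseudo-distance vanishes, which leaves the dependence on the state.\<close>
      moreover have "- ul' t + gl t \<in> B t (ul t) (ul t)"
      proof (rule tail_weights_limit_in_maximal_monotone[OF c, where y = "\<lambda>k. - u' (r k) t + g (r k) t" and u = "\<lambda>k. u (r k) t" and R = "\<Psi> t + Cg" and lam = lam and B = "B t" and ul = "ul t"])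
        show "(\<lambda>n. \<Sum>k\<le>N n. c n k *\<^sub>R (- u' (r k) t + g (r k) t)) \<longlonglongrightarrow> - ul' t + gl t"
          using tendsto_add[OF tendsto_minus[OF elim(8)] elim(7)] by (simp add: scaleR_diff_right sum_subtractf algebra_simps)
        show "maximal_monotone (B t (ul t))" by (rule maxm[OF elim(4)])
        show "dis (B t v) (B t (ul t)) \<le> ereal (lam * norm (v - ul t))" for v using dis[OF elim(4) elim(4), of v "ul t"] by simp
        show "- u' (r k) t + g (r k) t \<in> B t (u (r k) t) (u (r k) t)" for k using elim(1) by blast
        show "norm (- u' (r k) t + g (r k) t) \<le> \<Psi> t + Cg" for k
          using elim(1) by (intro norm_triangle_le add_mono) auto
        show "(\<lambda>k. u (r k) t) \<longlonglongrightarrow> ul t" by (rule ut)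
      qed
      ultimately show ?case by blast
    qed
  qed
  have "continuous_on {0..b} xl"
    by (rule mild_continuous_on[OF xl_eq Bochner_Integration.integrable_add[OF fl_int(1) wl_int]])
  then have "solves xl ul ul' fl gl wl"
    unfolding solves_def has_L2_derivative_def
    using ul0 ul'2 ul_eq fl_int incl_l xl_eq by auto
  then show ?thesis using that r(1) c m(1) lims(1) xl ul R0 R by blast
qed

end

section \<open>Lower semicontinuity and existence of a robust optimal control\<close>

lemma borel_measurable_lebesgue_on_AE:
  fixes f g :: "real \<Rightarrow> real"
  assumes "f \<in> borel_measurable (lebesgue_on A)" "AE t in lebesgue_on A. f t = g t" "A \<in> sets lebesgue"
  shows "g \<in> borel_measurable (lebesgue_on A)"
proof -
  have "(\<lambda>t. if t \<in> A then f t else 0) \<in> borel_measurable lebesgue"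
    using assms(1,3) by (simp add: borel_measurable_if)
  moreover have "AE t in lebesgue. (if t \<in> A then f t else 0) = (if t \<in> A then g t else 0)"
    using assms(2,3) by (auto simp: AE_restrict_space_iff elim: eventually_mono)
  ultimately have "(\<lambda>t. if t \<in> A then g t else 0) \<in> borel_measurable lebesgue" by (rule borel_measurable_AE)
  then show ?thesis using assms(3) by (simp add: borel_measurable_if)
qed

text \<open>The paths are sampled at the multiple of \<open>1 / Suc n\<close> just below
  \<open>t\<close>. Composition with a countably valued path is measurable, and the samples converge
  by continuity. Rounding down keeps the sampled times in \<open>{0..b}\<close>.\<close>

lemma caratheodory_composition_measurable:
  fixes l :: "real \<Rightarrow> 'e::real_normed_vector \<Rightarrow> 'h::real_normed_vector \<Rightarrow> real"
  assumes meas: "\<And>x u. (\<lambda>t. l t x u) \<in> borel_measurable (\<L> b)"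
    and cont: "AE t in \<L> b. continuous_on UNIV (\<lambda>(x, u). l t x u)"
    and x: "continuous_on {0..b} x" and u: "continuous_on {0..b} u"
  shows "(\<lambda>t. l t (x t) (u t)) \<in> borel_measurable (\<L> b)"
proof -
  define \<tau> where "\<tau> = (\<lambda>(n::nat) (i::int). real_of_int i / Suc n)"
  define p where "p = (\<lambda>n t. l t (x (\<tau> n \<lfloor>t * Suc n\<rfloor>)) (u (\<tau> n \<lfloor>t * Suc n\<rfloor>)))"
  have pm: "p n \<in> borel_measurable (\<L> b)" for n
    unfolding p_def
  proof (rule measurable_compose_countable[where f = "\<lambda>i t. l t (x (\<tau> n i)) (u (\<tau> n i))"])
    show "(\<lambda>t. \<lfloor>t * Suc n\<rfloor>) \<in> \<L> b \<rightarrow>\<^sub>M count_space UNIV"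
      by (intro measurable_restrict_space1 measurable_completion) measurable
  qed (rule meas)
  have lim: "AE t in \<L> b. (\<lambda>n. p n t) \<longlonglongrightarrow> l t (x t) (u t)"
    using cont AE_space[of "\<L> b"]
  proof eventually_elim
    case (elim t)
    then have t: "t \<in> {0..b}" by simp
    have mem: "\<tau> n \<lfloor>t * Suc n\<rfloor> \<in> {0..b}" for n
    proof -
      have "\<tau> n \<lfloor>t * Suc n\<rfloor> \<le> t * Suc n / Suc n" unfolding \<tau>_def by (intro divide_right_mono) auto
      moreover have "0 \<le> \<tau> n \<lfloor>t * Suc n\<rfloor>" using t by (simp add: \<tau>_def)
      ultimately show ?thesis using t by simp
    qed
    have "(\<lambda>n. \<tau> n \<lfloor>t * Suc n\<rfloor>) \<longlonglongrightarrow> t"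
    proof (rule tendsto_sandwich[of "\<lambda>n. t - 1 / Suc n" _ _ "\<lambda>_. t"])
      show "(\<lambda>n. t - 1 / Suc n) \<longlonglongrightarrow> t"
        using tendsto_diff[OF tendsto_const[of t] LIMSEQ_inverse_real_of_nat] by (simp add: inverse_eq_divide)
      show "\<forall>\<^sub>F n in sequentially. t - 1 / Suc n \<le> \<tau> n \<lfloor>t * Suc n\<rfloor>"
      proof (rule always_eventually, rule allI)
        fix n
        have "(t * Suc n - 1) / Suc n \<le> \<tau> n \<lfloor>t * Suc n\<rfloor>" unfolding \<tau>_def by (intro divide_right_mono) linarith+
        then show "t - 1 / Suc n \<le> \<tau> n \<lfloor>t * Suc n\<rfloor>" by (simp add: diff_divide_distrib)
      qed
      show "\<forall>\<^sub>F n in sequentially. \<tau> n \<lfloor>t * Suc n\<rfloor> \<le> t"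
      proof (rule always_eventually, rule allI)
        fix n
        have "\<tau> n \<lfloor>t * Suc n\<rfloor> \<le> t * Suc n / Suc n" unfolding \<tau>_def by (intro divide_right_mono) auto
        then show "\<tau> n \<lfloor>t * Suc n\<rfloor> \<le> t" by simp
      qed
    qed simp
    then have "(\<lambda>n. (x (\<tau> n \<lfloor>t * Suc n\<rfloor>), u (\<tau> n \<lfloor>t * Suc n\<rfloor>))) \<longlonglongrightarrow> (x t, u t)"
      using mem t by (intro tendsto_Pair continuous_on_tendsto_compose[OF x] continuous_on_tendsto_compose[OF u]) auto
    from continuous_on_tendsto_compose[OF elim(1) this] show ?case by (simp add: p_def)
  qed
  have "(\<lambda>t. lim (\<lambda>n. p n t)) \<in> borel_measurable (\<L> b)"
    by (rule borel_measurable_lim_metric) (rule pm)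
  moreover have "AE t in \<L> b. lim (\<lambda>n. p n t) = l t (x t) (u t)"
    using lim by eventually_elim (rule limI)
  ultimately show ?thesis by (rule borel_measurable_lebesgue_on_AE) simp
qed

text \<open>The weighted variance of the \<open>v k\<close> around their mean is nonnegative; this
  is Jensen's inequality for the squared norm.\<close>

lemma tail_weights_norm_sum_sq_le:
  fixes v :: "nat \<Rightarrow> 'a::real_inner"
  assumes "tail_weights n N c"
  shows "(norm (\<Sum>k\<le>N. c k *\<^sub>R v k))\<^sup>2 \<le> (\<Sum>k\<le>N. c k * (norm (v k))\<^sup>2)"
proof -
  define V where "V = (\<Sum>k\<le>N. c k *\<^sub>R v k)"
  have c: "0 \<le> c k" "sum c {..N} = 1" for k using assms by (auto simp: tail_weights_def)
  have "0 \<le> (\<Sum>k\<le>N. c k * (norm (v k - V))\<^sup>2)" using c by (intro sum_nonneg mult_nonneg_nonneg) auto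
  also have "(\<Sum>k\<le>N. c k * (norm (v k - V))\<^sup>2) = (\<Sum>k\<le>N. c k * (norm (v k))\<^sup>2 - 2 * inner (c k *\<^sub>R v k) V + c k * inner V V)"
    by (intro sum.cong refl) (simp add: power2_norm_eq_inner inner_diff_left inner_diff_right inner_commute algebra_simps)
  also have "\<dots> = (\<Sum>k\<le>N. c k * (norm (v k))\<^sup>2) - 2 * inner V V + inner V V"
  proof -
    have "(\<Sum>k\<le>N. inner (c k *\<^sub>R v k) V) = inner V V" unfolding V_def by (rule inner_sum_left[symmetric])
    then show ?thesis using c(2) by (simp only: sum.distrib sum_subtractf flip: sum_distrib_left sum_distrib_right)
  qed
  finally show ?thesis by (simp add: V_def power2_norm_eq_inner)
qed

text \<open>Jensen's inequality bounds the squared norms of the averages by averages of the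
  \<open>L k\<close>, which tend to \<open>Ll\<close>. The bounds vary with \<open>k\<close> because
  they will be what a total cost bound leaves over after subtracting the state cost.\<close>

lemma integral_norm_sq_le_of_tail_limit:
  fixes w :: "nat \<Rightarrow> 'a \<Rightarrow> 'b::{real_inner, banach, second_countable_topology}"
  assumes c: "\<And>n. tail_weights n (N n) (c n)"
    and w: "\<And>k. w k \<in> borel_measurable M" "wl \<in> borel_measurable M"
    and \<phi>: "integrable M (\<lambda>t. (\<phi> t :: real)\<^sup>2)" "\<And>k. AE t in M. norm (w k t) \<le> \<phi> t"
    and l: "AE t in M. (\<lambda>n. \<Sum>k\<le>N n. c n k *\<^sub>R w k t) \<longlonglongrightarrow> wl t"
    and L: "\<And>k. (\<integral>t. (norm (w k t))\<^sup>2 \<partial>M) \<le> L k" "L \<longlonglongrightarrow> Ll"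
  shows "(\<integral>t. (norm (wl t))\<^sup>2 \<partial>M) \<le> Ll"
proof -
  note [measurable] = w
  have sq: "integrable M (\<lambda>t. (norm (v t))\<^sup>2)" if [measurable]: "v \<in> borel_measurable M" and "AE t in M. norm (v t) \<le> \<phi> t" for v :: "'a \<Rightarrow> 'b"
    by (rule norm_integral_le_AE(1)[OF _ \<phi>(1)]) (use that(2) in \<open>auto simp: power_mono\<close>)
  have b: "AE t in M. norm (\<Sum>k\<le>N n. c n k *\<^sub>R w k t) \<le> \<phi> t" for n by (rule AE_norm_sum_le[OF c \<phi>(2)])
  have "(\<lambda>n. \<integral>t. (norm (\<Sum>k\<le>N n. c n k *\<^sub>R w k t))\<^sup>2 \<partial>M) \<longlonglongrightarrow> (\<integral>t. (norm (wl t))\<^sup>2 \<partial>M)"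
  proof (rule integral_dominated_convergence[OF _ _ \<phi>(1)])
    show "AE t in M. (\<lambda>n. (norm (\<Sum>k\<le>N n. c n k *\<^sub>R w k t))\<^sup>2) \<longlonglongrightarrow> (norm (wl t))\<^sup>2"
      using l by eventually_elim (intro tendsto_intros)
    show "AE t in M. norm ((norm (\<Sum>k\<le>N n. c n k *\<^sub>R w k t))\<^sup>2) \<le> (\<phi> t)\<^sup>2" for n
      using b[of n] by eventually_elim (simp add: power_mono)
  qed measurable
  moreover have "(\<integral>t. (norm (\<Sum>k\<le>N n. c n k *\<^sub>R w k t))\<^sup>2 \<partial>M) \<le> (\<Sum>k\<le>N n. c n k *\<^sub>R L k)" for n
  proof -
    have "(\<integral>t. (norm (\<Sum>k\<le>N n. c n k *\<^sub>R w k t))\<^sup>2 \<partial>M) \<le> (\<integral>t. (\<Sum>k\<le>N n. c n k * (norm (w k t))\<^sup>2) \<partial>M)"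
      by (rule integral_mono[OF sq[OF _ b]])
         (use sq[OF w(1) \<phi>(2)] tail_weights_norm_sum_sq_le[OF c] in auto)
    also have "\<dots> = (\<Sum>k\<le>N n. c n k * (\<integral>t. (norm (w k t))\<^sup>2 \<partial>M))" using sq[OF w(1) \<phi>(2)] by simp
    also have "\<dots> \<le> (\<Sum>k\<le>N n. c n k *\<^sub>R L k)"
      using c[of n] L(1) by (auto simp: tail_weights_def intro!: sum_mono mult_left_mono)
    finally show ?thesis .
  qed
  ultimately show ?thesis
    by (intro LIMSEQ_le[OF _ tail_weights_sum_tendsto[OF c L(2)]]) auto
qed

lemma cost_integral_tendsto:
  fixes l :: "real \<Rightarrow> 'e::real_normed_vector \<Rightarrow> 'h::real_normed_vector \<Rightarrow> real"
  assumes meas: "\<And>x u. (\<lambda>t. l t x u) \<in> borel_measurable (\<L> b)"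
    and cont: "AE t in \<L> b. continuous_on UNIV (\<lambda>(x, u). l t x u)"
    and \<beta>: "integrable (\<L> b) \<beta>"
      "AE t in \<L> b. \<forall>x u. norm x \<le> R \<and> norm u \<le> R \<longrightarrow> \<bar>l t x u\<bar> \<le> \<beta> t"
    and c: "\<And>n. continuous_on {0..b} (x n)" "\<And>n. continuous_on {0..b} (u n)" "continuous_on {0..b} xl" "continuous_on {0..b} ul"
    and R: "\<And>n t. t \<in> {0..b} \<Longrightarrow> norm (x n t) \<le> R \<and> norm (u n t) \<le> R"
    and lim: "\<And>t. t \<in> {0..b} \<Longrightarrow> (\<lambda>n. x n t) \<longlonglongrightarrow> xl t" "\<And>t. t \<in> {0..b} \<Longrightarrow> (\<lambda>n. u n t) \<longlonglongrightarrow> ul t"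
  shows "(\<lambda>n. integral\<^sup>L (\<L> b) (\<lambda>t. l t (x n t) (u n t))) \<longlonglongrightarrow> integral\<^sup>L (\<L> b) (\<lambda>t. l t (xl t) (ul t))"
proof (rule integral_dominated_convergence[OF _ _ \<beta>(1)])
  have on: "AE t in \<L> b. t \<in> {0..b}" using AE_space[of "\<L> b"] by simp
  show "(\<lambda>t. l t (xl t) (ul t)) \<in> borel_measurable (\<L> b)" "\<And>n. (\<lambda>t. l t (x n t) (u n t)) \<in> borel_measurable (\<L> b)"
    by (intro caratheodory_composition_measurable[OF meas cont] c)+
  show "AE t in \<L> b. (\<lambda>n. l t (x n t) (u n t)) \<longlonglongrightarrow> l t (xl t) (ul t)"
    using cont on
  proof eventually_elim
    case (elim t)
    from continuous_on_tendsto_compose[OF elim(1) tendsto_Pair[OF lim(1)[OF elim(2)] lim(2)[OF elim(2)]]]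
    show ?case by simp
  qed
  show "AE t in \<L> b. norm (l t (x n t) (u n t)) \<le> \<beta> t" for n
    using \<beta>(2) on by eventually_elim (use R in auto)
qed

text \<open>A sum strictly below the real number \<open>C\<close> means that the infimum is undercut
  by an actual solution. Along a subsequence these solutions converge to a solution for
  \<open>wl\<close> and their state costs converge too, while the bound on the control cost persists
  for the limit.\<close>

lemma min_cost_lower_semicontinuous:
  fixes b :: real
    and DA :: "'p::metric_space \<Rightarrow> 'e::{real_inner, banach, second_countable_topology} set"
    and A :: "'p \<Rightarrow> 'e \<Rightarrow> 'e"
    and T :: "'p \<Rightarrow> real \<Rightarrow> 'e \<Rightarrow>\<^sub>L 'e"
    and B :: "real \<Rightarrow> 'h::{real_inner, banach, second_countable_topology} \<Rightarrow> 'q::metric_space \<Rightarrow> 'h \<Rightarrow> 'h set"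
    and F :: "real \<Rightarrow> 'e \<Rightarrow> 'h \<Rightarrow> 'p \<Rightarrow> 'e set"
    and G :: "real \<Rightarrow> 'e \<Rightarrow> 'h \<Rightarrow> 'q \<Rightarrow> 'h set"
    and K :: "'y::{real_inner, banach, second_countable_topology} \<Rightarrow>\<^sub>L 'e"
    and l :: "real \<Rightarrow> 'e \<Rightarrow> 'h \<Rightarrow> 'p \<Rightarrow> 'q \<Rightarrow> real" and \<phi> :: "'e \<Rightarrow> 'h \<Rightarrow> 'p \<Rightarrow> 'q \<Rightarrow> real"
    and w :: "nat \<Rightarrow> real \<Rightarrow> 'y" and \<phi>\<^sub>W :: "real \<Rightarrow> real"
  assumes b_pos: "0 < b"
    and B_maximal: "\<And>t u \<eta>. t \<in> {0..b} \<Longrightarrow> maximal_monotone (B t u \<eta>)"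
    and hA: "hyp_A b DA A T" and hB: "hyp_B b B" and hF: "hyp_multifunction b F" and hG: "hyp_multifunction b G"
    and hl: "hyp_l b l" and h\<phi>: "hyp_phi \<phi>"
    and \<phi>\<^sub>W: "L2_on b \<phi>\<^sub>W" "\<And>t. t \<in> {0..b} \<Longrightarrow> 0 \<le> \<phi>\<^sub>W t"
    and w: "\<And>n. w n \<in> borel_measurable (\<L> b)" "\<And>n. AE t in \<L> b. norm (w n t) \<le> \<phi>\<^sub>W t"
    and wl: "wl \<in> borel_measurable (\<L> b)"
    and weak: "determines_tail_limits (\<L> b) w wl"
    and le: "\<And>n. min_cost b T B F G K x\<^sub>0 u\<^sub>0 l \<phi> \<zeta> \<eta> (w n) + ereal (control_cost b (w n)) < ereal C"
  shows "min_cost b T B F G K x\<^sub>0 u\<^sub>0 l \<phi> \<zeta> \<eta> wl + ereal (control_cost b wl) \<le> ereal C"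
proof -
  from hA have gen: "C0_semigroup (T \<zeta>)" and comp: "\<And>t. 0 < t \<Longrightarrow> compact_operator (T \<zeta> t)"
    and bdT: "\<And>D. bounded D \<Longrightarrow> \<exists>M>0. \<forall>\<zeta>\<in>D. \<forall>t\<in>{0..b}. norm (T \<zeta> t) \<le> M"
    by (auto simp: hyp_A_def generates_C0_semigroup_def)
  obtain M where M: "\<And>t. t \<in> {0..b} \<Longrightarrow> norm (T \<zeta> t) \<le> M" using bdT[of "{\<zeta>}"] by (meson bounded_insert bounded_empty singletonI)
  note hB' = hB[unfolded hyp_B_def]
  obtain \<theta> lam lam' where H: "W12 b \<theta> \<and> 0 \<le> lam \<and> lam < 1 \<and> 0 < lam' \<and>
        (\<forall>t\<in>{0..b}. \<forall>s\<in>{0..b}. \<forall>u v \<eta>\<^sub>1 \<eta>\<^sub>2.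
           dis (B t u \<eta>\<^sub>1) (B s v \<eta>\<^sub>2) \<le> ereal (\<bar>\<theta> t - \<theta> s\<bar> + lam * norm (u - v) + lam' * dist \<eta>\<^sub>1 \<eta>\<^sub>2))"
    using hB'[THEN conjunct1] by blast
  then have \<theta>W: "W12 b \<theta>" and lam: "0 \<le> lam" "lam < 1" by simp_all
  have dis': "dis (B t u \<eta>\<^sub>1) (B s v \<eta>\<^sub>2) \<le> ereal (\<bar>\<theta> t - \<theta> s\<bar> + lam * norm (u - v) + lam' * dist \<eta>\<^sub>1 \<eta>\<^sub>2)"
    if "t \<in> {0..b}" "s \<in> {0..b}" for t s u v \<eta>\<^sub>1 \<eta>\<^sub>2
    using H that by blast
  obtain \<theta>' where \<theta>: "has_L2_derivative b \<theta> \<theta>'" using \<theta>W by (auto simp: W12_def)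
  obtain MB where MB: "0 < MB" "\<And>t u \<eta> v. t \<in> {0..b} \<Longrightarrow> v \<in> op_dom (B t u \<eta>) \<Longrightarrow> norm (min_section (B t u \<eta>) v) \<le> MB * (1 + norm u + norm v)"
    using hB'[THEN conjunct2, THEN conjunct1] by blast
  have dom: "ball_relatively_compact (\<Union>t\<in>{0..b}. \<Union>v\<in>cball 0 R. op_dom (B t v \<eta>))" for R
  proof -
    have "bounded (cball 0 R \<times> {\<eta>} :: ('h \<times> 'q) set)" by (intro bounded_Times) auto
    then have "ball_relatively_compact (\<Union>t\<in>{0..b}. \<Union>(u, \<eta>')\<in>cball 0 R \<times> {\<eta>}. op_dom (B t u \<eta>'))"
      using hB'[THEN conjunct2, THEN conjunct2, THEN conjunct1] by blast
    moreover have "(\<Union>(u, \<eta>')\<in>cball 0 R \<times> {\<eta>}. op_dom (B t u \<eta>')) = (\<Union>v\<in>cball 0 R. op_dom (B t v \<eta>))" for t by auto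
    ultimately show ?thesis by simp
  qed
  have bs: "bounded {\<zeta>}" "bounded {\<eta>}" "bounded {(\<zeta>, \<eta>)}" by auto
  note hF' = hF[unfolded hyp_multifunction_def, THEN conjunct2, THEN conjunct2]
  obtain kF where "AE t in \<L> b. \<forall>x u y v. \<forall>z\<in>{\<zeta>}. Haus (F t x u z) (F t y v z) \<le> ereal (kF t * (norm (x - y) + norm (u - v)))"
    using hF'[THEN conjunct1, rule_format, OF bs(1)] by blast
  then have kF: "AE t in \<L> b. \<forall>x u y v. Haus (F t x u \<zeta>) (F t y v \<zeta>) \<le> ereal (kF t * (norm (x - y) + norm (u - v)))"
    by simp
  obtain MF where Fpos: "0 < MF" and "AE t in \<L> b. \<forall>x u. \<forall>z\<in>{\<zeta>}. set_norm (F t x u z) \<le> ereal (MF * (1 + norm x + norm u))"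
    using hF'[THEN conjunct2, rule_format, OF bs(1)] by blast
  then have MF: "AE t in \<L> b. \<forall>x u. set_norm (F t x u \<zeta>) \<le> ereal (MF * (1 + norm x + norm u))"
    by simp
  note hG' = hG[unfolded hyp_multifunction_def, THEN conjunct2, THEN conjunct2]
  obtain kG where "AE t in \<L> b. \<forall>x u y v. \<forall>z\<in>{\<eta>}. Haus (G t x u z) (G t y v z) \<le> ereal (kG t * (norm (x - y) + norm (u - v)))"
    using hG'[THEN conjunct1, rule_format, OF bs(2)] by blast
  then have kG: "AE t in \<L> b. \<forall>x u y v. Haus (G t x u \<eta>) (G t y v \<eta>) \<le> ereal (kG t * (norm (x - y) + norm (u - v)))"
    by simp
  obtain MG where Gpos: "0 < MG" and "AE t in \<L> b. \<forall>x u. \<forall>z\<in>{\<eta>}. set_norm (G t x u z) \<le> ereal (MG * (1 + norm x + norm u))"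
    using hG'[THEN conjunct2, rule_format, OF bs(2)] by blast
  then have MG: "AE t in \<L> b. \<forall>x u. set_norm (G t x u \<eta>) \<le> ereal (MG * (1 + norm x + norm u))"
    by simp
  interpret controlled_evolution "T \<zeta>" b M "\<lambda>t v. B t v \<eta>" "\<lambda>t x u. F t x u \<zeta>" "\<lambda>t x u. G t x u \<eta>" K "x\<^sub>0 \<zeta>" "u\<^sub>0 \<eta>"
    \<theta> \<theta>' \<phi>\<^sub>W kF kG lam MB MF MG
  proof
    show "C0_semigroup (T \<zeta>)" by (rule gen)
    show "norm (T \<zeta> t) \<le> M" if "t \<in> {0..b}" for t using that by (rule M)
    show "0 < b" by (rule b_pos)
    show "compact_operator (T \<zeta> t)" if "0 < t" for t using that by (rule comp)
    show "maximal_monotone (B t v \<eta>)" if "t \<in> {0..b}" for t v using that by (rule B_maximal)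
    show "dis (B t v \<eta>) (B s w \<eta>) \<le> ereal (\<bar>\<theta> t - \<theta> s\<bar> + lam * norm (v - w))" if "t \<in> {0..b}" "s \<in> {0..b}" for t s v w
      using dis'[OF that, of v \<eta> w \<eta>] by simp
    show "norm (min_section (B t v \<eta>) w) \<le> MB * (1 + norm v + norm w)" if "t \<in> {0..b}" "w \<in> op_dom (B t v \<eta>)" for t v w
      using that by (rule MB(2))
    show "F t x u \<zeta> \<noteq> {} \<and> closed (F t x u \<zeta>) \<and> convex (F t x u \<zeta>)" if "t \<in> {0..b}" for t x u
      using bspec[OF hF[unfolded hyp_multifunction_def, THEN conjunct1] that] weakly_compact_imp_closed by blast
    show "G t x u \<eta> \<noteq> {} \<and> closed (G t x u \<eta>) \<and> convex (G t x u \<eta>)" if "t \<in> {0..b}" for t x u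
      using bspec[OF hG[unfolded hyp_multifunction_def, THEN conjunct1] that] weakly_compact_imp_closed by blast
  qed (use lam MB Fpos Gpos MF MG kF kG \<theta> dom \<phi>\<^sub>W in auto)
  have dc: "dominated_control (w n)" for n using w by (simp add: dominated_control_def)
  have "\<exists>x u u' f g. solves x u u' f g (w n) \<and> cost b l \<phi> \<zeta> \<eta> (x, u) + control_cost b (w n) < C" for n
  proof -
    have "min_cost b T B F G K x\<^sub>0 u\<^sub>0 l \<phi> \<zeta> \<eta> (w n) < ereal (C - control_cost b (w n))"
      using le[of n] by (cases "min_cost b T B F G K x\<^sub>0 u\<^sub>0 l \<phi> \<zeta> \<eta> (w n)") auto
    then obtain z where z: "z \<in> mild_solutions b T B F G K x\<^sub>0 u\<^sub>0 \<zeta> \<eta> (w n)" "cost b l \<phi> \<zeta> \<eta> z < C - control_cost b (w n)"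
      unfolding min_cost_def by (auto simp: INF_less_iff)
    obtain x u where xu: "z = (x, u)" by (cases z)
    obtain u' f g where "solves x u u' f g (w n)"
      using z(1) unfolding xu mild_solutions_def solves_def by auto
    moreover have "cost b l \<phi> \<zeta> \<eta> (x, u) + control_cost b (w n) < C" using z(2) xu by simp
    ultimately show ?thesis by blast
  qed
  then obtain x u u' f g where sol: "\<And>n. solves (x n) (u n) (u' n) (f n) (g n) (w n)"
    and cl: "\<And>n. cost b l \<phi> \<zeta> \<eta> (x n, u n) + control_cost b (w n) < C" by metis
  obtain r xl ul ul' fl gl w' N c R where r: "strict_mono r"
    and c: "\<And>n. tail_weights n (N n) (c n)"
    and w': "w' \<in> borel_measurable (\<L> b)"
      "AE t in \<L> b. (\<lambda>n. \<Sum>k\<le>N n. c n k *\<^sub>R w (r k) t) \<longlonglongrightarrow> w' t"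
    and sl: "solves xl ul ul' fl gl w'"
    and xl: "\<And>t. t \<in> {0..b} \<Longrightarrow> (\<lambda>n. x (r n) t) \<longlonglongrightarrow> xl t" and ul: "\<And>t. t \<in> {0..b} \<Longrightarrow> (\<lambda>n. u (r n) t) \<longlonglongrightarrow> ul t"
    and R: "0 \<le> R" "\<And>n t. t \<in> {0..b} \<Longrightarrow> norm (x n t) \<le> R \<and> norm (u n t) \<le> R"
    by (rule solution_sequence_limit[where x = x and u = u and u' = u' and f = f and g = g and w = w, OF sol dc]) (rule that)
  \<comment> \<open>The limit solution belongs to the control \<open>w'\<close> obtained by
    averaging; the characterising property of \<open>wl\<close> identifies the two almost
    everywhere.\<close>
  have ww: "AE t in \<L> b. w' t = wl t" using weak r c w' unfolding determines_tail_limits_def by blast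
  have sol_l: "(xl, ul) \<in> mild_solutions b T B F G K x\<^sub>0 u\<^sub>0 \<zeta> \<eta> wl"
  proof -
    have "integral\<^sup>L (\<L> t) (\<lambda>s. T \<zeta> (t - s) (fl s + K (w' s))) =
        integral\<^sup>L (\<L> t) (\<lambda>s. T \<zeta> (t - s) (fl s + K (wl s)))" if t: "t \<in> {0..b}" for t
    proof (rule Bochner_Integration.integral_cong_AE)
      have sub: "{0..t} \<subseteq> {0..b}" using t by auto
      have fm: "fl \<in> borel_measurable (\<L> b)" using sl by (auto simp: solves_def)
      show "(\<lambda>s. T \<zeta> (t - s) (fl s + K (w' s))) \<in> borel_measurable (\<L> t)"
        by (rule convolution_measurable[OF measurable_restrict_mono[OF borel_measurable_add[OF fm K_measurable[OF w'(1)]] sub]]) (use t in auto)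
      show "(\<lambda>s. T \<zeta> (t - s) (fl s + K (wl s))) \<in> borel_measurable (\<L> t)"
        by (rule convolution_measurable[OF measurable_restrict_mono[OF borel_measurable_add[OF fm K_measurable[OF wl]] sub]]) (use t in auto)
      have "AE s in \<L> t. w' s = wl s" by (rule AE_lebesgue_on_subset[OF ww sub]) auto
      then show "AE s in \<L> t. T \<zeta> (t - s) (fl s + K (w' s)) = T \<zeta> (t - s) (fl s + K (wl s))"
        by eventually_elim simp
    qed
    then have "solves xl ul ul' fl gl wl" using sl unfolding solves_def by simp
    then show ?thesis unfolding mild_solutions_def solves_def by blast
  qed
  have cost_lim: "(\<lambda>n. cost b l \<phi> \<zeta> \<eta> (x (r n), u (r n))) \<longlonglongrightarrow> cost b l \<phi> \<zeta> \<eta> (xl, ul)"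
  proof -
    obtain \<kappa> where \<kappa>: "AE t in \<L> b. \<forall>x y u \<zeta> \<eta>. \<bar>l t x u \<zeta> \<eta> - l t y u \<zeta> \<eta>\<bar> \<le> (1 + max (norm x) (norm y)) * \<kappa> t (norm (x - y))"
      "\<forall>R>0. \<exists>\<beta>. L1_nonneg b \<beta> \<and> (AE t in \<L> b. \<forall>r\<in>{0..R}. \<kappa> t r \<le> \<beta> t)"
      using hl unfolding hyp_l_def by blast
    obtain \<beta> where \<beta>: "L1_nonneg b \<beta>" "AE t in \<L> b. \<forall>r\<in>{0..R + 1}. \<kappa> t r \<le> \<beta> t"
      using \<kappa>(2)[rule_format, of "R + 1"] R(1) by auto
    have "\<exists>\<theta>. L1_nonneg b \<theta> \<and> (AE t in \<L> b. \<forall>u. \<forall>(\<zeta>, \<eta>)\<in>{(\<zeta>, \<eta>)}. \<bar>l t 0 u \<zeta> \<eta>\<bar> \<le> \<theta> t * (1 + norm u))"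
      using hl bs(3) unfolding hyp_l_def by blast
    then obtain \<rho> where \<rho>: "L1_nonneg b \<rho>" "AE t in \<L> b. \<forall>u. \<bar>l t 0 u \<zeta> \<eta>\<bar> \<le> \<rho> t * (1 + norm u)"
      by auto
    have cont: "AE t in \<L> b. continuous_on UNIV (\<lambda>(x, u, \<zeta>, \<eta>). l t x u \<zeta> \<eta>)"
      and meas: "\<And>x u. (\<lambda>t. l t x u \<zeta> \<eta>) \<in> borel_measurable (\<L> b)"
      using hl unfolding hyp_l_def by blast+
    have "(\<lambda>n. integral\<^sup>L (\<L> b) (\<lambda>t. l t (x (r n) t) (u (r n) t) \<zeta> \<eta>)) \<longlonglongrightarrow> integral\<^sup>L (\<L> b) (\<lambda>t. l t (xl t) (ul t) \<zeta> \<eta>)"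
    \<comment> \<open>The majorant comes from comparing \<open>x\<close> with 0: the modulus
      \<open>\<kappa>\<close> contributes \<open>(1 + R) * \<beta> t\<close>, and the growth in
      \<open>u\<close> at \<open>x = 0\<close> contributes
      \<open>\<rho> t * (1 + R)\<close>.\<close>
    proof (rule cost_integral_tendsto[where l = "\<lambda>t x u. l t x u \<zeta> \<eta>" and R = R and \<beta> = "\<lambda>t. \<rho> t * (1 + R) + (1 + R) * \<beta> t"])
      show "AE t in \<L> b. continuous_on UNIV (\<lambda>(x, u). l t x u \<zeta> \<eta>)"
        using cont
      proof eventually_elim
        case (elim t)
        have "continuous_on UNIV (\<lambda>z. (\<lambda>(x, u, \<zeta>, \<eta>). l t x u \<zeta> \<eta>) (fst z, snd z, \<zeta>, \<eta>))"
          by (rule continuous_on_compose2[OF elim]) (auto intro!: continuous_intros)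
        then show ?case by (simp add: case_prod_beta')
      qed
      show "integrable (\<L> b) (\<lambda>t. \<rho> t * (1 + R) + (1 + R) * \<beta> t)"
        using \<beta>(1) \<rho>(1) by (simp add: L1_nonneg_def)
      show "AE t in \<L> b. \<forall>x u. norm x \<le> R \<and> norm u \<le> R \<longrightarrow> \<bar>l t x u \<zeta> \<eta>\<bar> \<le> \<rho> t * (1 + R) + (1 + R) * \<beta> t"
        using \<kappa>(1) \<beta>(2) \<rho>(2) AE_on_b
      proof eventually_elim
        case (elim t)
        show ?case
        proof (intro allI impI)
          fix x :: 'e and u :: 'h assume xu: "norm x \<le> R \<and> norm u \<le> R"
          have nn: "0 \<le> \<beta> t" "0 \<le> \<rho> t" using \<beta>(1) \<rho>(1) elim(4) by (auto simp: L1_nonneg_def)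
          have "\<bar>l t x u \<zeta> \<eta> - l t 0 u \<zeta> \<eta>\<bar> \<le> (1 + max (norm x) (norm (0::'e))) * \<kappa> t (norm (x - 0))"
            using elim(1) by blast
          also have "\<dots> = (1 + norm x) * \<kappa> t (norm x)" by simp
          also have "\<dots> \<le> (1 + norm x) * \<beta> t" using elim(2) xu by (intro mult_left_mono) auto
          also have "\<dots> \<le> (1 + R) * \<beta> t" using xu nn by (intro mult_right_mono) auto
          finally have 1: "\<bar>l t x u \<zeta> \<eta> - l t 0 u \<zeta> \<eta>\<bar> \<le> (1 + R) * \<beta> t" .
          have "\<bar>l t 0 u \<zeta> \<eta>\<bar> \<le> \<rho> t * (1 + norm u)" using elim(3) by blast
          also have "\<dots> \<le> \<rho> t * (1 + R)" using xu nn by (intro mult_left_mono) auto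
          finally show "\<bar>l t x u \<zeta> \<eta>\<bar> \<le> \<rho> t * (1 + R) + (1 + R) * \<beta> t" using 1 by linarith
        qed
      qed
      show "continuous_on {0..b} (x (r n))" "continuous_on {0..b} (u (r n))" for n
        using sol[of "r n"] has_L2_derivative_continuous_on by (auto simp: solves_def)
      show "continuous_on {0..b} xl" "continuous_on {0..b} ul"
        using sl has_L2_derivative_continuous_on by (auto simp: solves_def)
    qed (use meas R xl ul in auto)
    moreover have "(\<lambda>n. \<phi> (x (r n) b) (u (r n) b) \<zeta> \<eta>) \<longlonglongrightarrow> \<phi> (xl b) (ul b) \<zeta> \<eta>"
    proof -
      have "(\<lambda>n. (x (r n) b, u (r n) b, \<zeta>, \<eta>)) \<longlonglongrightarrow> (xl b, ul b, \<zeta>, \<eta>)"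
        using b_pos by (intro tendsto_Pair xl ul tendsto_const) auto
      from continuous_on_tendsto_compose[OF h\<phi>[unfolded hyp_phi_def] this] show ?thesis by simp
    qed
    ultimately show ?thesis unfolding cost_def by (simp add: tendsto_add)
  qed
  \<comment> \<open>Subtracting the state cost from \<open>C\<close> leaves upper bounds for the
    control cost that converge; the factor 2 undoes the \<open>1 / 2\<close> in
    \<open>control_cost\<close>.\<close>
  have "integral\<^sup>L (\<L> b) (\<lambda>t. (norm (w' t))\<^sup>2) \<le> 2 * (C - cost b l \<phi> \<zeta> \<eta> (xl, ul))"
  proof (rule integral_norm_sq_le_of_tail_limit[OF c, where w = "\<lambda>k. w (r k)" and \<phi> = \<phi>\<^sub>W])
    show "(\<lambda>k. 2 * (C - cost b l \<phi> \<zeta> \<eta> (x (r k), u (r k)))) \<longlonglongrightarrow> 2 * (C - cost b l \<phi> \<zeta> \<eta> (xl, ul))"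
      by (intro tendsto_intros cost_lim)
    show "integral\<^sup>L (\<L> b) (\<lambda>t. (norm (w (r k) t))\<^sup>2) \<le> 2 * (C - cost b l \<phi> \<zeta> \<eta> (x (r k), u (r k)))" for k
      using cl[of "r k"] by (simp add: control_cost_def)
  qed (use w w' \<phi>\<^sub>W in \<open>auto simp: L2_on_def\<close>)
  moreover have "integral\<^sup>L (\<L> b) (\<lambda>t. (norm (w' t))\<^sup>2) = integral\<^sup>L (\<L> b) (\<lambda>t. (norm (wl t))\<^sup>2)"
    by (rule Bochner_Integration.integral_cong_AE) (use ww w'(1) wl in \<open>auto elim: eventually_mono\<close>)
  ultimately have "cost b l \<phi> \<zeta> \<eta> (xl, ul) + control_cost b wl \<le> C" by (simp add: control_cost_def)
  have "min_cost b T B F G K x\<^sub>0 u\<^sub>0 l \<phi> \<zeta> \<eta> wl + ereal (control_cost b wl) \<le> ereal (cost b l \<phi> \<zeta> \<eta> (xl, ul)) + ereal (control_cost b wl)"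
    unfolding min_cost_def by (intro add_right_mono INF_lower sol_l)
  also have "\<dots> \<le> ereal C" using \<open>cost b l \<phi> \<zeta> \<eta> (xl, ul) + control_cost b wl \<le> C\<close> by simp
  finally show ?thesis .
qed

theorem theorem5p3:
  fixes b :: real
    and DA :: "'p::metric_space \<Rightarrow> 'e::{real_inner, banach, second_countable_topology} set"
    and A :: "'p \<Rightarrow> 'e \<Rightarrow> 'e"
    and T :: "'p \<Rightarrow> real \<Rightarrow> 'e \<Rightarrow>\<^sub>L 'e"
    and B :: "real \<Rightarrow> 'h::{real_inner, banach, second_countable_topology} \<Rightarrow> 'q::metric_space \<Rightarrow> 'h \<Rightarrow> 'h set"
    and F :: "real \<Rightarrow> 'e \<Rightarrow> 'h \<Rightarrow> 'p \<Rightarrow> 'e set"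
    and G :: "real \<Rightarrow> 'e \<Rightarrow> 'h \<Rightarrow> 'q \<Rightarrow> 'h set"
    and W :: "real \<Rightarrow> 'y::{real_inner, banach, second_countable_topology} set"
    and K :: "'y \<Rightarrow>\<^sub>L 'e"
    and x\<^sub>0 :: "'p \<Rightarrow> 'e" and u\<^sub>0 :: "'q \<Rightarrow> 'h"
    and l :: "real \<Rightarrow> 'e \<Rightarrow> 'h \<Rightarrow> 'p \<Rightarrow> 'q \<Rightarrow> real"
    and \<phi> :: "'e \<Rightarrow> 'h \<Rightarrow> 'p \<Rightarrow> 'q \<Rightarrow> real"
    and P :: "('p \<times> 'q) set"
  assumes b_pos: "0 < b"
    and A_linear: "\<And>\<zeta>. linear_operator (DA \<zeta>) (A \<zeta>)"
    and B_maximal: "\<And>t u \<eta>. t \<in> {0..b} \<Longrightarrow> maximal_monotone (B t u \<eta>)"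
    and u0_dom: "\<And>\<eta>. u\<^sub>0 \<eta> \<in> op_dom (B 0 (u\<^sub>0 \<eta>) \<eta>)"
    and "hyp_A b DA A T"
    and "hyp_B b B"
    and "hyp_F b F"
    and "hyp_G b G"
    and "hyp_0 x\<^sub>0 u\<^sub>0"
    and "hyp_W b W"
    and "hyp_l b l"
    and "hyp_phi \<phi>"
    and P_compact: "compact P" and P_nonempty: "P \<noteq> {}"
  shows "\<exists>w\<in>admissible_controls b W.
           robust_cost b T B F G K x\<^sub>0 u\<^sub>0 l \<phi> P w =
           (INF w'\<in>admissible_controls b W. robust_cost b T B F G K x\<^sub>0 u\<^sub>0 l \<phi> P w')"
proof -
  let ?J = "robust_cost b T B F G K x\<^sub>0 u\<^sub>0 l \<phi> P"
  interpret finite_measure "\<L> b" by (rule finite_measure_lebesgue_on) simp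
  have on: "AE t in \<L> b. t \<in> {0..b}" using AE_space[of "\<L> b"] by simp
  obtain \<phi>\<^sub>W where \<phi>\<^sub>W: "L2_on b \<phi>\<^sub>W" "\<And>t. t \<in> {0..b} \<Longrightarrow> 0 \<le> \<phi>\<^sub>W t" "AE t in \<L> b. set_norm (W t) \<le> ereal (\<phi>\<^sub>W t)"
    and Wm: "measurable_multifunction b W" and Wc: "\<And>t. t \<in> {0..b} \<Longrightarrow> W t \<noteq> {} \<and> closed (W t) \<and> convex (W t)"
    using \<open>hyp_W b W\<close> unfolding hyp_W_def by blast
  have \<phi>sq: "integrable (\<L> b) (\<lambda>t. (\<phi>\<^sub>W t)\<^sup>2)" using \<phi>\<^sub>W(1) by (simp add: L2_on_def)
  have dom: "AE t in \<L> b. norm (w t) \<le> \<phi>\<^sub>W t" if "AE t in \<L> b. w t \<in> W t" for w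
    using that \<phi>\<^sub>W(3) by eventually_elim (rule set_norm_leD)
  have adm: "w \<in> admissible_controls b W" if "w \<in> borel_measurable (\<L> b)" "AE t in \<L> b. w t \<in> W t" for w
    using that L2_on_dominated[OF that(1) \<phi>\<^sub>W(1) dom[OF that(2)]] by (simp add: admissible_controls_def)
  have admD: "w \<in> borel_measurable (\<L> b)" "AE t in \<L> b. w t \<in> W t" if "w \<in> admissible_controls b W" for w
    using that by (auto simp: admissible_controls_def L2_on_def)
  obtain p where p: "p \<in> borel_measurable (\<L> b)" "\<And>t. t \<in> {0..b} \<Longrightarrow> p t \<in> W t"
    using measurable_multifunction_selection[OF Wm Wc] by metis
  have "AE t in \<L> b. p t \<in> W t" using on by eventually_elim (rule p(2))
  then have "p \<in> admissible_controls b W" by (rule adm[OF p(1)])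
  then have "?J ` admissible_controls b W \<noteq> {}" by blast
  then obtain j where j: "\<And>n. j n \<in> ?J ` admissible_controls b W" "j \<longlonglongrightarrow> (INF w'\<in>admissible_controls b W. ?J w')"
    using Inf_as_limit by metis
  have "\<forall>n. \<exists>v. v \<in> admissible_controls b W \<and> j n = ?J v" using j(1) by blast
  from choice[OF this] obtain w where w: "\<And>n. w n \<in> admissible_controls b W" "\<And>n. j n = ?J (w n)" by blast
  have lim: "(\<lambda>n. ?J (w n)) \<longlonglongrightarrow> (INF w'\<in>admissible_controls b W. ?J w')"
    using j(2) ext[of j "\<lambda>n. ?J (w n)", OF w(2)] by simp
  note wm = admD(1)[OF w(1)] and wW = admD(2)[OF w(1)]
  obtain r wl where r: "strict_mono r" and wl: "wl \<in> borel_measurable (\<L> b)"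
    and "AE t in \<L> b. norm (wl t) \<le> \<phi>\<^sub>W t"
    and weak: "determines_tail_limits (\<L> b) (\<lambda>k. w (r k)) wl"
    by (rule dominated_weakly_convergent_subsequence[of w \<phi>\<^sub>W, OF wm \<phi>sq dom[OF wW]]) (rule that)
  have "AE t in \<L> b. wl t \<in> W t"
  proof -
    \<comment> \<open>The limit control inherits the constraint from averages that converge almost
      everywhere, because each \<open>W t\<close> is closed and convex.\<close>
    obtain N c w' where c: "\<And>n. tail_weights n (N n) (c n)" and w': "w' \<in> borel_measurable (\<L> b)"
      "AE t in \<L> b. (\<lambda>n. \<Sum>k\<le>N n. c n k *\<^sub>R w (r k) t) \<longlonglongrightarrow> w' t"
      by (rule dominated_tail_convex_combinations_converge[of "\<lambda>k. w (r k)" \<phi>\<^sub>W, OF wm \<phi>sq dom[OF wW]]) (rule that)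
    have "AE t in \<L> b. w' t = wl t"
      using weak[unfolded determines_tail_limits_def, rule_format, of id N c w'] c w' by (simp add: strict_mono_def)
    moreover have "AE t in \<L> b. \<forall>k. w k t \<in> W t" using wW by (simp add: AE_all_countable)
    ultimately show ?thesis using w'(2) on
    proof eventually_elim
      case (elim t)
      have "w' t \<in> closure (W t)"
        by (rule tail_weights_limit_in_closure[OF c elim(3)]) (use Wc[OF elim(4)] elim(2) in auto)
      then show ?case using Wc[OF elim(4)] elim(1) by simp
    qed
  qed
  then have wl_adm: "wl \<in> admissible_controls b W" by (rule adm[OF wl])
  have "?J wl \<le> (INF w'\<in>admissible_controls b W. ?J w')"
    unfolding robust_cost_def[of b T B F G K x\<^sub>0 u\<^sub>0 l \<phi> P wl]
  proof (rule SUP_least, clarify)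
    fix \<zeta> \<eta> assume P: "(\<zeta>, \<eta>) \<in> P"
    let ?m = "\<lambda>w. min_cost b T B F G K x\<^sub>0 u\<^sub>0 l \<phi> \<zeta> \<eta> w + ereal (control_cost b w)"
    show "?m wl \<le> (INF w'\<in>admissible_controls b W. ?J w')"
    proof (rule ccontr)
      assume "\<not> ?m wl \<le> (INF w'\<in>admissible_controls b W. ?J w')"
      \<comment> \<open>A real number lies strictly between two distinct extended reals even if one
        of them is infinite, so infinite costs need no separate treatment.\<close>
      then obtain C where C: "(INF w'\<in>admissible_controls b W. ?J w') < ereal C" "ereal C < ?m wl"
        using ereal_dense2 by (metis not_le)
      have "(\<lambda>n. ?J (w (r n))) \<longlonglongrightarrow> (INF w'\<in>admissible_controls b W. ?J w')"
        using LIMSEQ_subseq_LIMSEQ[OF lim r] by (simp add: o_def)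
      from order_tendstoD(2)[OF this C(1)]
      obtain n0 where n0: "\<And>n. n \<ge> n0 \<Longrightarrow> ?J (w (r n)) < ereal C" by (auto simp: eventually_sequentially)
      have "?m wl \<le> ereal C"
      \<comment> \<open>Dropping the first \<open>n0\<close> terms makes the strict bound hold for
        every index. The shifted sequence is again a subsequence, so \<open>wl\<close> keeps its
        characterising property.\<close>
      proof (rule min_cost_lower_semicontinuous[where w = "\<lambda>n. w (r (n + n0))" and \<phi>\<^sub>W = \<phi>\<^sub>W])
        show "hyp_multifunction b F" "hyp_multifunction b G" using assms by (auto simp: hyp_F_def hyp_G_def)
        show "?m (w (r (n + n0))) < ereal C" for n
        proof -
          have "?m (w (r (n + n0))) \<le> ?J (w (r (n + n0)))"
            unfolding robust_cost_def by (rule SUP_upper2[OF P]) simp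
          also have "\<dots> < ereal C" by (rule n0) simp
          finally show ?thesis .
        qed
        show "determines_tail_limits (\<L> b) (\<lambda>n. w (r (n + n0))) wl"
          unfolding determines_tail_limits_def
        proof (intro allI impI, elim conjE)
          fix s :: "nat \<Rightarrow> nat" and c N w'
          assume "strict_mono s" "\<forall>n. tail_weights n (N n) (c n)" "w' \<in> borel_measurable (\<L> b)"
            "AE t in \<L> b. (\<lambda>n. \<Sum>k\<le>N n. c n k *\<^sub>R w (r (s k + n0)) t) \<longlonglongrightarrow> w' t"
          then show "AE t in \<L> b. w' t = wl t"
            using weak[unfolded determines_tail_limits_def, rule_format, of "\<lambda>k. s k + n0" N c w'] by (simp add: strict_mono_def)
        qed
      qed (use assms \<phi>\<^sub>W wm dom[OF wW] wl in auto)
      then show False using C(2) by simp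
    qed
  qed
  moreover have "(INF w'\<in>admissible_controls b W. ?J w') \<le> ?J wl" by (rule INF_lower[OF wl_adm])
  ultimately show ?thesis using wl_adm by (intro bexI[of _ wl] antisym)
qed

end
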